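(* Let $q>2$ and $a>1$. Set $$D_a := \inf\left\{ \frac{\int_{B_1^2}|\nabla u|^2\,dx}{\left(\int_{B_1^2}\frac{|u|^q}{|x|^2(\log\frac{a}{|x|})^{\frac q2+1}}\,dx\right)^{\frac2q}}\ :\ u\in H_0^1(B_1^2)\setminus\{0\},\ \int_0^{2\pi}u(r\cos\theta,r\sin\theta)\,d\theta=0 \text{ for a.e. } r\in[0,1]\right\}.$$ Then $D_a>0$ and there exists a minimizer of $D_a$.
   Context: $B_1^2=\{x\in\mathbb{R}^2: |x|<1\}$. $H_0^1(B_1^2)$ is the completion of $C_0^\infty(B_1^2)$ with respect to the norm $\|\nabla u\|_{L^2}$. The spherical-average-zero condition on $u\in H_0^1(B_1^2)$ is equivalent to $u$ belonging to the orthogonal complement, with respect to the inner product $\int_{B_1^2}\nabla u\cdot\nabla v\,dx$, of the subspace of radial functions in $H_0^1(B_1^2)$. A minimizer of $D_a$ is an admissible $u$ at which the infimum is attained. *)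

theory Defs
  imports "HOL-Analysis.Analysis"
begin

text \<open>
  Functions on an open set \<open>\<Omega>\<close> are represented by total functions whose values outside \<open>\<Omega>\<close> are
  irrelevant, and classes of almost everywhere equal functions by Borel representatives
  (every class has one).
\<close>

primrec C_k :: "nat \<Rightarrow> ('a::euclidean_space \<Rightarrow> real) \<Rightarrow> bool" where
  "C_k 0 f \<longleftrightarrow> continuous_on UNIV f"
| "C_k (Suc k) f \<longleftrightarrow> (\<forall>x. f differentiable (at x)) \<and>
      (\<forall>v. C_k k (\<lambda>x. frechet_derivative f (at x) v))"

definition test_function :: "'a::euclidean_space set \<Rightarrow> ('a \<Rightarrow> real) \<Rightarrow> bool" where
  "test_function \<Omega> \<phi> \<longleftrightarrow> (\<forall>k. C_k k \<phi>) \<and>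
     compact (closure {x. \<phi> x \<noteq> 0}) \<and> closure {x. \<phi> x \<noteq> 0} \<subseteq> \<Omega>"

definition grad :: "('a::euclidean_space \<Rightarrow> real) \<Rightarrow> 'a \<Rightarrow> 'a" where
  "grad \<phi> x = (THE D. GDERIV \<phi> x :> D)"

definition has_weak_gradient ::
  "'a::euclidean_space set \<Rightarrow> ('a \<Rightarrow> real) \<Rightarrow> ('a \<Rightarrow> 'a) \<Rightarrow> bool" where
  "has_weak_gradient \<Omega> u g \<longleftrightarrow>
     (\<forall>K. compact K \<and> K \<subseteq> \<Omega> \<longrightarrow> set_integrable lborel K u \<and> set_integrable lborel K g) \<and>
     (\<forall>\<phi>. test_function \<Omega> \<phi> \<longrightarrow>
        (LINT x:\<Omega>|lborel. u x *\<^sub>R grad \<phi> x) = - (LINT x:\<Omega>|lborel. \<phi> x *\<^sub>R g x))"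

text \<open>Unique up to null subsets of \<open>\<Omega>\<close>, for open \<open>\<Omega>\<close>.\<close>

definition weak_grad :: "'a::euclidean_space set \<Rightarrow> ('a \<Rightarrow> real) \<Rightarrow> 'a \<Rightarrow> 'a" where
  "weak_grad \<Omega> u = (SOME g. has_weak_gradient \<Omega> u g)"

text \<open>
  The completion of the test functions on a bounded open \<open>\<Omega>\<close> under the norm \<open>\<parallel>\<nabla>\<phi>\<parallel>\<close> in \<open>L\<^sup>2\<close>.
  By the Poincare inequality a Cauchy sequence for this norm converges in \<open>L\<^sup>2(\<Omega>)\<close>; the class
  of the sequence is identified with its \<open>L\<^sup>2\<close> limit.
\<close>

definition H01 :: "'a::euclidean_space set \<Rightarrow> ('a \<Rightarrow> real) set" where
  "H01 \<Omega> = {u. set_borel_measurable lborel \<Omega> u \<and> set_integrable lborel \<Omega> (\<lambda>x. (u x)\<^sup>2) \<and>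
     (\<exists>\<phi>. (\<forall>n::nat. test_function \<Omega> (\<phi> n)) \<and>
        (\<forall>\<epsilon>>0. \<exists>N. \<forall>m\<ge>N. \<forall>n\<ge>N.
           (LINT x:\<Omega>|lborel. (norm (grad (\<phi> m) x - grad (\<phi> n) x))\<^sup>2) < \<epsilon>) \<and>
        (\<lambda>n. LINT x:\<Omega>|lborel. (\<phi> n x - u x)\<^sup>2) \<longlonglongrightarrow> 0)}"

definition dirichlet_energy :: "'a::euclidean_space set \<Rightarrow> ('a \<Rightarrow> real) \<Rightarrow> real" where
  "dirichlet_energy \<Omega> u = (LINT x:\<Omega>|lborel. (norm (weak_grad \<Omega> u x))\<^sup>2)"

abbreviation disc :: "(real^2) set" where
  "disc \<equiv> ball 0 1"

definition zero_circular_means :: "(real^2 \<Rightarrow> real) \<Rightarrow> bool" where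
  "zero_circular_means u \<longleftrightarrow>
     (AE r in lborel. r \<in> {0..1} \<longrightarrow>
        (LINT \<theta>:{0..2*pi}|lborel. u (vector [r * cos \<theta>, r * sin \<theta>])) = 0)"

definition admissible :: "(real^2 \<Rightarrow> real) set" where
  "admissible = {u \<in> H01 disc.
     \<not> (AE x in lborel. x \<in> disc \<longrightarrow> u x = 0) \<and> zero_circular_means u}"

definition log_weighted_integral :: "real \<Rightarrow> real \<Rightarrow> (real^2 \<Rightarrow> real) \<Rightarrow> real" where
  "log_weighted_integral q a u =
     (LINT x:disc|lborel. \<bar>u x\<bar> powr q / ((norm x)\<^sup>2 * (ln (a / norm x)) powr (q/2 + 1)))"

text \<open>
  A divergent weighted integral takes the value \<open>0\<close>, so the quotient is then \<open>0\<close>, which agrees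
  with the convention that a finite energy divided by infinity is \<open>0\<close>.
\<close>

definition quotient :: "real \<Rightarrow> real \<Rightarrow> (real^2 \<Rightarrow> real) \<Rightarrow> real" where
  "quotient q a u = dirichlet_energy disc u / (log_weighted_integral q a u) powr (2/q)"

definition D :: "real \<Rightarrow> real \<Rightarrow> real" where
  "D q a = (INF u\<in>admissible. quotient q a u)"

definition is_minimizer :: "real \<Rightarrow> real \<Rightarrow> (real^2 \<Rightarrow> real) \<Rightarrow> bool" where
  "is_minimizer q a u \<longleftrightarrow> u \<in> admissible \<and> quotient q a u = D q a"

end

(*
  For a function with zero circular means, comparing u with its rotations controls the L2 norm of
  u / |x| by the Dirichlet norm.  Applying the planar inequality |F|_2 <= |grad F|_1 to
  F = u^k / sqrt (|x|^2 + e^2) gives, by induction on k and as e tends to 0, bounds of all integrals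
  of u^(2k) / |x|^2 by powers of the Dirichlet norm; this yields D > 0.  Since the logarithmic factor
  tends to 0 at the origin, the weighted power functional is continuous along bounded sequences that
  converge in L2, and Rellich's theorem produces a maximiser of it on the unit ball of the Dirichlet
  norm.  The homogeneity of the quotient turns the maximiser into a minimiser.
*)
theory Submission
  imports Defs "HOL-Complex_Analysis.Great_Picard"
begin

section \<open>Square integrable functions\<close>

text \<open>The obstacle is the factor |x|^-2: it is not integrable at the origin, so no positive
  power of a continuous function with a nonzero value there is integrable against it. Zero means
  remove this because a rotation moves the point x with speed |x|: a difference of u along a circle,
  divided by |x|, costs no more than the gradient. Once the integrals of even powers are bounded,
  boundedness of the functional uses only the lower bound \<open>ln a > 0\<close> of the logarithm
  on the disc; its growth at the origin serves compactness alone. The regularised weight keeps F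
  differentiable, and for fixed e it is bounded. This matters because the test functions that
  approximate u need not have zero means: the induction is run for them with the norm of phi / sqrt
  (|x|^2 + e^2) kept as an unknown, and the means enter only in the limit. The limit of a maximising
  sequence is put back into the unit ball without weak topologies, and it is compared with the
  sequence by an elementary inequality whose constant can be brought close to 1.\<close>

definition L2 :: "('a::euclidean_space \<Rightarrow> 'b::euclidean_space) \<Rightarrow> bool" where
  "L2 f \<longleftrightarrow> f \<in> borel_measurable borel \<and> integrable lborel (\<lambda>x. (norm (f x))\<^sup>2)"

text \<open>Integrals run over the whole space, which may also be the line of rotation angles.
  Functions on a domain enter extended by zero, so that translations, rotations and Tonelli apply
  without mention of the domain.\<close>

definition l2 :: "('a::euclidean_space \<Rightarrow> 'b::euclidean_space) \<Rightarrow> real" where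
  "l2 f = sqrt (LINT x|lborel. (norm (f x))\<^sup>2)"

lemma L2_measurable: "L2 f \<Longrightarrow> f \<in> borel_measurable borel"
  by (simp add: L2_def)

lemma l2_nonneg [simp]: "0 \<le> l2 f"
  by (simp add: l2_def)

lemma l2_power2: "(l2 f)\<^sup>2 = (LINT x|lborel. (norm (f x))\<^sup>2)"
  by (simp add: l2_def)

lemma L2_nn_integral:
  assumes "L2 f"
  shows "(\<integral>\<^sup>+x. ennreal ((norm (f x))\<^sup>2) \<partial>lborel) = ennreal ((l2 f)\<^sup>2)"
  using assms unfolding L2_def l2_power2 by (intro nn_integral_eq_integral) auto

text \<open>Estimates are proved for nonnegative integrals, where Tonelli and Fatou ask for no
  integrability. This turns such a bound into membership together with a bound of the norm.\<close>

lemma L2_nn_integralI: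
  assumes [measurable]: "f \<in> borel_measurable borel"
    and le: "(\<integral>\<^sup>+x. ennreal ((norm (f x))\<^sup>2) \<partial>lborel) \<le> ennreal (c\<^sup>2)" and "0 \<le> c"
  shows "L2 f" "l2 f \<le> c"
proof -
  have fin: "(\<integral>\<^sup>+x. ennreal ((norm (f x))\<^sup>2) \<partial>lborel) < \<infinity>"
    using le by (metis ennreal_less_top infinity_ennreal_def order_le_less_trans)
  show L: "L2 f"
    unfolding L2_def by (intro conjI integrableI_bounded) (use fin in auto)
  have "ennreal ((l2 f)\<^sup>2) \<le> ennreal (c\<^sup>2)"
    using le L2_nn_integral[OF L] by simp
  then have "(l2 f)\<^sup>2 \<le> c\<^sup>2"
    by (simp add: ennreal_le_iff)
  then show "l2 f \<le> c"
    using \<open>0 \<le> c\<close> by (rule power2_le_imp_le)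
qed

lemma l2_zero [simp]: "l2 (\<lambda>x. 0) = 0"
  by (simp add: l2_def)

lemma L2_add:
  assumes "L2 f" "L2 g" shows "L2 (\<lambda>x. f x + g x)"
proof -
  have [measurable]: "f \<in> borel_measurable borel" "g \<in> borel_measurable borel"
    using assms by (auto simp: L2_def)
  have le: "(norm (f x + g x))\<^sup>2 \<le> 2 * (norm (f x))\<^sup>2 + 2 * (norm (g x))\<^sup>2" for x
  proof -
    have "(norm (f x + g x))\<^sup>2 \<le> (norm (f x) + norm (g x))\<^sup>2"
      by (intro power_mono norm_triangle_ineq) auto
    also have "\<dots> \<le> 2 * (norm (f x))\<^sup>2 + 2 * (norm (g x))\<^sup>2"
      using sum_squares_bound[of "norm (f x)" "norm (g x)"] by (simp add: power2_sum)
    finally show ?thesis .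
  qed
  have "integrable lborel (\<lambda>x. (norm (f x + g x))\<^sup>2)"
  proof (rule Bochner_Integration.integrable_bound)
    show "integrable lborel (\<lambda>x. 2 * (norm (f x))\<^sup>2 + 2 * (norm (g x))\<^sup>2)"
      using assms by (auto simp: L2_def)
    show "AE x in lborel. norm ((norm (f x + g x))\<^sup>2) \<le> norm (2 * (norm (f x))\<^sup>2 + 2 * (norm (g x))\<^sup>2)"
      using order_trans[OF le abs_ge_self] by (intro AE_I2) (simp only: real_norm_def abs_power2)
  qed measurable
  then show ?thesis
    unfolding L2_def by simp
qed

lemma L2_scaleR: "L2 f \<Longrightarrow> L2 (\<lambda>x. c *\<^sub>R f x)"
  by (auto simp: L2_def power_mult_distrib)

lemma l2_scaleR: "l2 (\<lambda>x. c *\<^sub>R f x) = \<bar>c\<bar> * l2 f"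
  by (auto simp: l2_def power_mult_distrib real_sqrt_mult)

lemma L2_minus: "L2 f \<Longrightarrow> L2 (\<lambda>x. - f x)"
  by (auto simp: L2_def)

lemma l2_minus: "l2 (\<lambda>x. - f x) = l2 f"
  by (simp add: l2_def)

lemma L2_diff: "L2 f \<Longrightarrow> L2 g \<Longrightarrow> L2 (\<lambda>x. f x - g x)"
  using L2_add[OF _ L2_minus, of f g] by simp

lemma l2_diff_commute: "l2 (\<lambda>x. f x - g x) = l2 (\<lambda>x. g x - f x)"
  by (simp add: l2_def norm_minus_commute)

lemma L2_norm_mult:
  assumes "L2 f" "L2 g"
  shows "integrable lborel (\<lambda>x. norm (f x) * norm (g x))"
    and "(LINT x|lborel. norm (f x) * norm (g x)) \<le> l2 f * l2 g"
proof -
  have [measurable]: "f \<in> borel_measurable borel" "g \<in> borel_measurable borel"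
    using assms by (auto simp: L2_def)
  show I: "integrable lborel (\<lambda>x. norm (f x) * norm (g x))"
  proof (rule Bochner_Integration.integrable_bound)
    show "integrable lborel (\<lambda>x. (norm (f x))\<^sup>2 + (norm (g x))\<^sup>2)"
      using assms by (auto simp: L2_def)
    have "norm (f x) * norm (g x) \<le> (norm (f x))\<^sup>2 + (norm (g x))\<^sup>2" for x
    proof -
      have "0 \<le> norm (f x) * norm (g x)" by simp
      with sum_squares_bound[of "norm (f x)" "norm (g x)"] show ?thesis by linarith
    qed
    then show "AE x in lborel. norm (norm (f x) * norm (g x)) \<le> norm ((norm (f x))\<^sup>2 + (norm (g x))\<^sup>2)"
      by auto
  qed auto
  have "(\<integral>\<^sup>+x. ennreal (norm (f x)) * ennreal (norm (g x)) \<partial>lborel)\<^sup>2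
      \<le> (\<integral>\<^sup>+x. ennreal (norm (f x)) ^ 2 \<partial>lborel) * (\<integral>\<^sup>+x. ennreal (norm (g x)) ^ 2 \<partial>lborel)"
    by (intro Cauchy_Schwarz_nn_integral) auto
  also have "\<dots> = ennreal ((l2 f)\<^sup>2) * ennreal ((l2 g)\<^sup>2)"
    using assms by (simp add: ennreal_power L2_nn_integral)
  also have "\<dots> = ennreal ((l2 f * l2 g)\<^sup>2)"
    by (simp add: ennreal_mult' power_mult_distrib)
  also have "(\<integral>\<^sup>+x. ennreal (norm (f x)) * ennreal (norm (g x)) \<partial>lborel)
      = ennreal (LINT x|lborel. norm (f x) * norm (g x))"
    using I by (subst nn_integral_eq_integral[symmetric]) (auto simp: ennreal_mult')
  finally have "(LINT x|lborel. norm (f x) * norm (g x))\<^sup>2 \<le> (l2 f * l2 g)\<^sup>2"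
    by (simp add: ennreal_power integral_nonneg)
  then show "(LINT x|lborel. norm (f x) * norm (g x)) \<le> l2 f * l2 g"
    by (rule power2_le_imp_le) simp
qed

lemma l2_triangle:
  assumes "L2 f" "L2 g"
  shows "l2 (\<lambda>x. f x + g x) \<le> l2 f + l2 g"
proof -
  have "(l2 (\<lambda>x. f x + g x))\<^sup>2 \<le> (LINT x|lborel. (norm (f x))\<^sup>2 + (norm (g x))\<^sup>2 + 2 * (norm (f x) * norm (g x)))"
    unfolding l2_power2
  proof (rule integral_mono)
    show "integrable lborel (\<lambda>x. (norm (f x))\<^sup>2 + (norm (g x))\<^sup>2 + 2 * (norm (f x) * norm (g x)))"
      using assms L2_norm_mult(1)[OF assms] by (auto simp: L2_def)
    fix x
    show "(norm (f x + g x))\<^sup>2 \<le> (norm (f x))\<^sup>2 + (norm (g x))\<^sup>2 + 2 * (norm (f x) * norm (g x))"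
      using power_mono[OF norm_triangle_ineq[of "f x" "g x"], of 2] by (simp add: power2_sum)
  qed (use L2_add[OF assms] in \<open>auto simp: L2_def\<close>)
  also have "\<dots> = (l2 f)\<^sup>2 + (l2 g)\<^sup>2 + 2 * (LINT x|lborel. norm (f x) * norm (g x))"
    using assms L2_norm_mult(1)[OF assms] by (simp add: L2_def l2_power2)
  also have "\<dots> \<le> (l2 f)\<^sup>2 + (l2 g)\<^sup>2 + 2 * (l2 f * l2 g)"
    using L2_norm_mult(2)[OF assms] by simp
  also have "\<dots> = (l2 f + l2 g)\<^sup>2"
    by (simp add: power2_sum)
  finally show ?thesis
    by (rule power2_le_imp_le) simp
qed

lemma l2_diff_triangle:
  assumes "L2 f" "L2 g" "L2 h"
  shows "l2 (\<lambda>x. f x - h x) \<le> l2 (\<lambda>x. f x - g x) + l2 (\<lambda>x. g x - h x)"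
  using l2_triangle[OF L2_diff[OF assms(1,2)] L2_diff[OF assms(2,3)]] by simp

lemma l2_le_l2_diff:
  assumes "L2 f" "L2 g"
  shows "l2 f \<le> l2 g + l2 (\<lambda>x. f x - g x)"
  using l2_triangle[OF assms(2) L2_diff[OF assms]] by simp

lemma l2_parallelogram:
  assumes "L2 f" "L2 g"
  shows "(l2 (\<lambda>x. f x - g x))\<^sup>2 + (l2 (\<lambda>x. f x + g x))\<^sup>2 = 2 * (l2 f)\<^sup>2 + 2 * (l2 g)\<^sup>2"
proof -
  have "(l2 (\<lambda>x. f x - g x))\<^sup>2 + (l2 (\<lambda>x. f x + g x))\<^sup>2
      = (LINT x|lborel. (norm (f x - g x))\<^sup>2 + (norm (f x + g x))\<^sup>2)"
    using L2_add[OF assms] L2_diff[OF assms] unfolding l2_power2 by (simp add: L2_def)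
  also have "\<dots> = (LINT x|lborel. 2 * (norm (f x))\<^sup>2 + 2 * (norm (g x))\<^sup>2)"
    by (intro Bochner_Integration.integral_cong) (auto simp: power2_norm_eq_inner inner_simps inner_commute)
  also have "\<dots> = 2 * (l2 f)\<^sup>2 + 2 * (l2 g)\<^sup>2"
    using assms unfolding l2_power2 by (simp add: L2_def)
  finally show ?thesis .
qed

lemma L2_cong_AE:
  assumes "L2 f" "g \<in> borel_measurable borel" "AE x in lborel. f x = g x"
  shows "L2 g" "l2 g = l2 f"
proof -
  have [measurable]: "f \<in> borel_measurable borel" "g \<in> borel_measurable borel"
    using assms by (auto simp: L2_def)
  have eq: "AE x in lborel. (norm (f x))\<^sup>2 = (norm (g x))\<^sup>2"
    using assms(3) by auto
  show "L2 g"
    using assms(1) integrable_cong_AE[of "\<lambda>x. (norm (f x))\<^sup>2" lborel "\<lambda>x. (norm (g x))\<^sup>2"] eq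
    by (simp add: L2_def)
  show "l2 g = l2 f"
    unfolding l2_def using integral_cong_AE[of "\<lambda>x. (norm (f x))\<^sup>2" lborel "\<lambda>x. (norm (g x))\<^sup>2"] eq
    by simp
qed

lemma L2_bound:
  assumes "L2 f" "g \<in> borel_measurable borel" "\<And>x. norm (g x) \<le> c * norm (f x)" "0 \<le> c"
  shows "L2 g" "l2 g \<le> c * l2 f"
proof -
  have "(\<integral>\<^sup>+x. ennreal ((norm (g x))\<^sup>2) \<partial>lborel) \<le> (\<integral>\<^sup>+x. ennreal (c\<^sup>2) * ennreal ((norm (f x))\<^sup>2) \<partial>lborel)"
    using power_mono[OF assms(3), of _ 2]
    by (intro nn_integral_mono) (auto simp: ennreal_mult'[symmetric] power_mult_distrib ennreal_le_iff)
  also have "\<dots> = ennreal (c\<^sup>2) * (\<integral>\<^sup>+x. ennreal ((norm (f x))\<^sup>2) \<partial>lborel)"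
    using L2_measurable[OF assms(1)] by (intro nn_integral_cmult) auto
  also have "\<dots> = ennreal ((c * l2 f)\<^sup>2)"
    using L2_nn_integral[OF assms(1)] by (simp add: ennreal_mult'[symmetric] power_mult_distrib)
  finally have le: "(\<integral>\<^sup>+x. ennreal ((norm (g x))\<^sup>2) \<partial>lborel) \<le> ennreal ((c * l2 f)\<^sup>2)" .
  show "L2 g" "l2 g \<le> c * l2 f"
    using L2_nn_integralI[OF assms(2) le] \<open>0 \<le> c\<close> by auto
qed

lemma L2_indicator_scaleR:
  assumes "L2 f" "A \<in> sets borel"
  shows "L2 (\<lambda>x. indicator A x *\<^sub>R f x)" "l2 (\<lambda>x. indicator A x *\<^sub>R f x) \<le> l2 f"
proof -
  have m: "(\<lambda>x. indicator A x *\<^sub>R f x) \<in> borel_measurable borel"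
    using L2_measurable[OF assms(1)] assms(2) by measurable
  show "L2 (\<lambda>x. indicator A x *\<^sub>R f x)" "l2 (\<lambda>x. indicator A x *\<^sub>R f x) \<le> l2 f"
    using L2_bound[OF assms(1) m, of 1] by (auto simp: indicator_def)
qed

lemma L2_indicator:
  assumes "A \<in> sets borel" "emeasure lborel A < \<infinity>"
  shows "L2 (indicator A :: _ \<Rightarrow> real)" "l2 (indicator A :: _ \<Rightarrow> real) = sqrt (measure lborel A)"
proof -
  have eq: "(\<lambda>x. (norm (indicator A x :: real))\<^sup>2) = indicator A"
    by (auto simp: indicator_def fun_eq_iff)
  show "L2 (indicator A :: _ \<Rightarrow> real)" "l2 (indicator A :: _ \<Rightarrow> real) = sqrt (measure lborel A)"
    using assms unfolding L2_def l2_def eq by (auto simp: integrable_real_indicator)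
qed

text \<open>Cauchy-Schwarz against the indicator. It is applied to the angle interval, to grid
  squares and to domains of finite measure.\<close>

lemma L2_set_integrable:
  assumes "L2 f" "A \<in> sets borel" "emeasure lborel A < \<infinity>"
  shows "set_integrable lborel A f"
    and "(LINT x:A|lborel. norm (f x)) \<le> sqrt (measure lborel A) * l2 f"
    and "norm (LINT x:A|lborel. f x) \<le> sqrt (measure lborel A) * l2 f"
proof -
  note ind = L2_indicator[OF assms(2,3)]
  note CS = L2_norm_mult[OF ind(1) assms(1)]
  have eq: "(\<lambda>x. norm (indicator A x :: real) * norm (f x)) = (\<lambda>x. norm (indicator A x *\<^sub>R f x))"
    by auto
  show I: "set_integrable lborel A f"
    using CS(1) L2_measurable[OF assms(1)] assms(2) unfolding eq set_integrable_def
    by (subst (asm) integrable_norm_iff) auto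
  show le: "(LINT x:A|lborel. norm (f x)) \<le> sqrt (measure lborel A) * l2 f"
    using CS(2) unfolding ind(2) by (simp add: set_lebesgue_integral_def)
  have "norm (LINT x:A|lborel. f x) \<le> (LINT x:A|lborel. norm (f x))"
    using integral_norm_bound[of lborel "\<lambda>x. indicator A x *\<^sub>R f x"] by (simp add: set_lebesgue_integral_def)
  with le show "norm (LINT x:A|lborel. f x) \<le> sqrt (measure lborel A) * l2 f" by simp
qed

section \<open>Almost everywhere convergence and completeness\<close>

lemma L2_AE_subseq:
  assumes "\<And>n. L2 (f n)" "L2 g" "(\<lambda>n. l2 (\<lambda>x. f n x - g x)) \<longlonglongrightarrow> 0"
  obtains r where "strict_mono r" "AE x in lborel. (\<lambda>n. f (r n) x) \<longlonglongrightarrow> g x"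
proof -
  have "(\<lambda>n. (l2 (\<lambda>x. f n x - g x))\<^sup>2) \<longlonglongrightarrow> 0"
    using tendsto_power[OF assms(3), of 2] by simp
  then have "\<exists>r::nat\<Rightarrow>nat. strict_mono r \<and> (AE x in lborel. (\<lambda>n. (norm (f (r n) x - g x))\<^sup>2) \<longlonglongrightarrow> 0)"
    using L2_diff[OF assms(1,2)] unfolding l2_power2
    by (intro tendsto_L1_AE_subseq[where u="\<lambda>n x. (norm (f n x - g x))\<^sup>2"]) (auto simp: L2_def)
  then obtain r :: "nat \<Rightarrow> nat" where r: "strict_mono r" and
    lim: "AE x in lborel. (\<lambda>n. (norm (f (r n) x - g x))\<^sup>2) \<longlonglongrightarrow> 0" by auto
  from lim have "AE x in lborel. (\<lambda>n. f (r n) x) \<longlonglongrightarrow> g x"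
  proof eventually_elim
    case (elim x)
    have "(\<lambda>n. sqrt ((norm (f (r n) x - g x))\<^sup>2)) \<longlonglongrightarrow> sqrt 0"
      using elim by (rule tendsto_real_sqrt)
    then have "(\<lambda>n. norm (f (r n) x - g x)) \<longlonglongrightarrow> 0" by simp
    then show ?case
      using LIM_zero_cancel tendsto_norm_zero_iff by blast
  qed
  with r that show ?thesis by blast
qed

text \<open>Fatou's lemma in the form in which inequalities pass from test functions to their
  limits: the bounds \<open>b n\<close> may vary with n as long as they converge.\<close>

lemma nn_integral_le_AE_limit:
  fixes f :: "nat \<Rightarrow> 'a \<Rightarrow> ennreal"
  assumes [measurable]: "\<And>n. f n \<in> borel_measurable M" and lim: "AE x in M. (\<lambda>n. f n x) \<longlonglongrightarrow> F x"
    and le: "\<And>n. (\<integral>\<^sup>+x. f n x \<partial>M) \<le> b n" and b: "b \<longlonglongrightarrow> B"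
  shows "(\<integral>\<^sup>+x. F x \<partial>M) \<le> B"
proof -
  have "(\<integral>\<^sup>+x. F x \<partial>M) = (\<integral>\<^sup>+x. liminf (\<lambda>n. f n x) \<partial>M)"
    using lim
  proof (intro nn_integral_cong_AE, eventually_elim)
    case (elim x)
    then show ?case by (intro lim_imp_Liminf[symmetric]) auto
  qed
  also have "\<dots> \<le> liminf (\<lambda>n. \<integral>\<^sup>+x. f n x \<partial>M)"
    by (rule nn_integral_liminf) measurable
  also have "\<dots> \<le> liminf b"
    by (intro Liminf_mono always_eventually allI le)
  also have "\<dots> = B"
    using b by (intro lim_imp_Liminf) auto
  finally show ?thesis .
qed

text \<open>Riesz-Fischer. On a set of finite measure an L2 Cauchy sequence is L1 Cauchy, so a
  subsequence converges almost everywhere; Fatou's lemma then bounds the L2 distance to the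
  pointwise limit by the Cauchy bound.\<close>

lemma L2_complete:
  fixes f :: "nat \<Rightarrow> 'a::euclidean_space \<Rightarrow> 'b::euclidean_space"
  assumes f: "\<And>n. L2 (f n)" and supp: "\<And>n x. x \<notin> A \<Longrightarrow> f n x = 0"
    and A: "A \<in> sets borel" "emeasure lborel A < \<infinity>"
    and Cauchy: "\<And>e. e > 0 \<Longrightarrow> \<exists>N. \<forall>m\<ge>N. \<forall>n\<ge>N. l2 (\<lambda>x. f m x - f n x) < e"
  obtains g where "L2 g" "\<And>x. x \<notin> A \<Longrightarrow> g x = 0" "(\<lambda>n. l2 (\<lambda>x. f n x - g x)) \<longlonglongrightarrow> 0"
proof -
  have [measurable]: "f n \<in> borel_measurable borel" for n
    using f by (simp add: L2_def)
  have ind: "(\<lambda>x. indicator A x *\<^sub>R f n x) = f n" for n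
    using supp by (auto simp: indicator_def fun_eq_iff)
  have "integrable lborel (f n)" for n
    using L2_set_integrable(1)[OF f A, of n] by (simp add: set_integrable_def ind)
  moreover have "\<exists>N. \<forall>i\<ge>N. \<forall>j\<ge>N. (LINT x|lborel. norm (f i x - f j x)) < e" if e: "e > 0" for e
  proof -
    \<comment> \<open>The summand 1 keeps \<open>c\<close> positive when A is a null set.\<close>
    define c where "c = sqrt (measure lborel A) + 1"
    have c: "c > 0" by (auto simp: c_def add_nonneg_pos)
    obtain N where N: "\<And>m n. m \<ge> N \<Longrightarrow> n \<ge> N \<Longrightarrow> l2 (\<lambda>x. f m x - f n x) < e / c"
      using Cauchy[of "e / c"] e c by (meson divide_pos_pos)
    have "(LINT x|lborel. norm (f i x - f j x)) < e" if "i \<ge> N" "j \<ge> N" for i j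
    proof -
      have "(LINT x|lborel. norm (f i x - f j x)) = (LINT x:A|lborel. norm (f i x - f j x))"
        unfolding set_lebesgue_integral_def
        by (intro Bochner_Integration.integral_cong) (auto simp: indicator_def supp)
      also have "\<dots> \<le> sqrt (measure lborel A) * l2 (\<lambda>x. f i x - f j x)"
        by (rule L2_set_integrable(2)[OF L2_diff[OF f f] A])
      also have "\<dots> \<le> c * l2 (\<lambda>x. f i x - f j x)"
        by (auto simp: c_def mult_right_mono)
      also have "\<dots> < c * (e / c)"
        using N[OF that] c by (intro mult_strict_left_mono) auto
      finally show ?thesis using c by simp
    qed
    then show ?thesis by blast
  qed
  ultimately obtain r where r: "strict_mono r" "AE x in lborel. Cauchy (\<lambda>i. f (r i) x)"
    using cauchy_L1_AE_cauchy_subseq[of lborel f] by blast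
  \<comment> \<open>Where the subsequence diverges, \<open>lim\<close> is an unspecified value, but
    only on a null set. Outside A all terms are 0, so \<open>g\<close> vanishes there at every
    point.\<close>
  define g where "g x = lim (\<lambda>i. f (r i) x)" for x
  have gm [measurable]: "g \<in> borel_measurable borel"
    unfolding g_def by (rule borel_measurable_lim_metric) auto
  have conv: "AE x in lborel. (\<lambda>i. f (r i) x) \<longlonglongrightarrow> g x"
    using r(2) by eventually_elim (auto simp: g_def Cauchy_convergent_iff convergent_LIMSEQ_iff)
  have key: "L2 (\<lambda>x. f n x - g x) \<and> l2 (\<lambda>x. f n x - g x) \<le> e"
    if N: "\<And>m n. m \<ge> N \<Longrightarrow> n \<ge> N \<Longrightarrow> l2 (\<lambda>x. f m x - f n x) < e" and n: "n \<ge> N" and "e > 0" for n N e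
  proof -
    have "(\<integral>\<^sup>+x. ennreal ((norm (f n x - g x))\<^sup>2) \<partial>lborel) \<le> ennreal (e\<^sup>2)"
    proof (rule nn_integral_le_AE_limit[OF _ _ _ tendsto_const])
      show "AE x in lborel. (\<lambda>i. ennreal ((norm (f n x - f (r (i + N)) x))\<^sup>2)) \<longlonglongrightarrow> ennreal ((norm (f n x - g x))\<^sup>2)"
        using conv
      proof eventually_elim
        case (elim x)
        show ?case by (intro tendsto_intros LIMSEQ_ignore_initial_segment[OF elim])
      qed
      fix i
      have "r (i + N) \<ge> N" using seq_suble[OF r(1), of "i + N"] by simp
      then have "(l2 (\<lambda>x. f n x - f (r (i + N)) x))\<^sup>2 \<le> e\<^sup>2"
        using N[OF n, of "r (i + N)"] by (intro power_mono) auto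
      then show "(\<integral>\<^sup>+x. ennreal ((norm (f n x - f (r (i + N)) x))\<^sup>2) \<partial>lborel) \<le> ennreal (e\<^sup>2)"
        using L2_nn_integral[OF L2_diff[OF f f], of n "r (i + N)"] by (simp add: ennreal_le_iff)
    qed measurable
    then show ?thesis
      using L2_nn_integralI[of "\<lambda>x. f n x - g x" e] \<open>e > 0\<close> by simp
  qed
  have ex: "\<exists>N. \<forall>n\<ge>N. L2 (\<lambda>x. f n x - g x) \<and> l2 (\<lambda>x. f n x - g x) \<le> e" if "e > 0" for e
    using Cauchy[OF that] key[OF _ _ that] by blast
  have "L2 g"
  proof -
    obtain N where "L2 (\<lambda>x. f N x - g x)" using ex[of 1] by auto
    from L2_diff[OF f this, of N] show ?thesis by simp
  qed
  moreover have "g x = 0" if "x \<notin> A" for x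
    using supp[OF that] by (simp add: g_def)
  moreover have "(\<lambda>n. l2 (\<lambda>x. f n x - g x)) \<longlonglongrightarrow> 0"
  proof (rule LIMSEQ_I)
    fix e :: real assume "e > 0"
    then obtain N where N: "\<And>n. n \<ge> N \<Longrightarrow> l2 (\<lambda>x. f n x - g x) \<le> e / 2"
      using ex[of "e/2"] by auto
    have "norm (l2 (\<lambda>x. f n x - g x) - 0) < e" if "n \<ge> N" for n
      using N[OF that] \<open>e > 0\<close> by simp
    then show "\<exists>no. \<forall>n\<ge>no. norm (l2 (\<lambda>x. f n x - g x) - 0) < e"
      by blast
  qed
  ultimately show ?thesis using that by blast
qed

lemma l2_tendsto:
  assumes "\<And>n. L2 (f n)" "L2 g" "(\<lambda>n. l2 (\<lambda>x. f n x - g x)) \<longlonglongrightarrow> 0"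
  shows "(\<lambda>n. l2 (f n)) \<longlonglongrightarrow> l2 g"
proof -
  have "\<bar>l2 (f n) - l2 g\<bar> \<le> l2 (\<lambda>x. f n x - g x)" for n
    using l2_le_l2_diff[OF assms(1,2), of n] l2_le_l2_diff[OF assms(2,1), of n]
      l2_diff_commute[of g "f n"] by linarith
  then have "(\<lambda>n. l2 (f n) - l2 g) \<longlonglongrightarrow> 0"
    by (intro Lim_null_comparison[OF _ assms(3)]) auto
  then show ?thesis by (rule LIM_zero_cancel)
qed

section \<open>Smooth functions of compact support\<close>

text \<open>Unfolding \<open>C_k\<close> takes repeated directional derivatives and never leaves a
  class that is closed under them, so one closure property gives every order of smoothness at
  once.\<close>

lemma C_k_coinduct:
  assumes "\<And>f x. f \<in> F \<Longrightarrow> f differentiable (at x)"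
    and "\<And>f v. f \<in> F \<Longrightarrow> (\<lambda>x. frechet_derivative f (at x) v) \<in> F"
    and "f \<in> F"
  shows "C_k k f"
  using assms(3)
proof (induction k arbitrary: f)
  case 0
  then show ?case
    using assms(1) by (auto intro!: differentiable_imp_continuous_on simp: differentiable_on_def
        intro: differentiable_at_withinI)
qed (use assms(1,2) in auto)

lemma C_k_add: "C_k k f \<Longrightarrow> C_k k g \<Longrightarrow> C_k k (\<lambda>x. f x + g x)"
proof (induction k arbitrary: f g)
  case (Suc k)
  have "(\<lambda>x. frechet_derivative (\<lambda>y. f y + g y) (at x) v)
      = (\<lambda>x. frechet_derivative f (at x) v + frechet_derivative g (at x) v)" for v
    using Suc.prems
    by (intro ext) (simp add: frechet_derivative_at[symmetric, OF has_derivative_add[OF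
          frechet_derivative_works[THEN iffD1] frechet_derivative_works[THEN iffD1]]])
  with Suc show ?case by (simp add: differentiable_add)
qed (auto intro: continuous_on_add)

lemma C_k_scale: "C_k k f \<Longrightarrow> C_k k (\<lambda>x. c * f x)"
proof (induction k arbitrary: f)
  case (Suc k)
  have "(\<lambda>x. frechet_derivative (\<lambda>y. c * f y) (at x) v)
      = (\<lambda>x. c * frechet_derivative f (at x) v)" for v
    using Suc.prems
    by (intro ext) (simp add: frechet_derivative_at[symmetric, OF has_derivative_mult_right[OF
          frechet_derivative_works[THEN iffD1]]])
  with Suc show ?case by (simp add: differentiable_mult)
qed (auto intro: continuous_on_mult)

section \<open>Bump functions supported in boxes\<close>

definition flat :: "real poly \<Rightarrow> real \<Rightarrow> real" where
  "flat p t = (if t > 0 then poly p (1 / t) * exp (- (1 / t)) else 0)"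

lemma poly_times_exp_minus_tendsto_0:
  "((\<lambda>x::real. poly p x * exp (- x)) \<longlongrightarrow> 0) at_top"
proof -
  have "((\<lambda>x. \<Sum>i\<le>degree p. coeff p i * (x ^ i / exp x)) \<longlongrightarrow> (\<Sum>i\<le>degree p. coeff p i * 0)) at_top"
    by (intro tendsto_sum tendsto_mult tendsto_const tendsto_power_div_exp_0)
  moreover have "(\<Sum>i\<le>degree p. coeff p i * (x ^ i / exp x)) = poly p x * exp (- x)" for x
    by (simp add: poly_altdef sum_distrib_right exp_minus field_simps sum_divide_distrib)
  ultimately show ?thesis by simp
qed

text \<open>For t > 0 the derivative of p(1/t) exp (-1/t) is t^-2 (p - p')(1/t) exp (-1/t), and
  \<open>[:0, 0, 1:]\<close> is the factor t^-2 written as a polynomial in 1/t. The polynomial in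
  \<open>flat\<close> is there to make the family closed under differentiation.\<close>

lemma DERIV_flat: "(flat p has_real_derivative flat ([:0, 0, 1:] * (p - pderiv p)) t) (at t)"
proof -
  consider "t > 0" | "t < 0" | "t = 0" by linarith
  then show ?thesis
  proof cases
    case 1
    have "((\<lambda>t. poly p (1 / t) * exp (- (1 / t))) has_real_derivative
        (poly (pderiv p) (1 / t) * (- 1 / t\<^sup>2)) * exp (- (1 / t))
          + poly p (1 / t) * (exp (- (1 / t)) * (1 / t\<^sup>2))) (at t)"
      using 1 by (auto intro!: derivative_eq_intros DERIV_chain2[OF poly_DERIV] simp: power2_eq_square)
    also have "(poly (pderiv p) (1 / t) * (- 1 / t\<^sup>2)) * exp (- (1 / t))
          + poly p (1 / t) * (exp (- (1 / t)) * (1 / t\<^sup>2)) = flat ([:0, 0, 1:] * (p - pderiv p)) t"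
      using 1 by (simp add: flat_def field_simps power2_eq_square)
    finally show ?thesis
      by (rule DERIV_cong_ev[THEN iffD1, rotated -1])
        (use 1 in \<open>auto simp: flat_def eventually_nhds intro!: exI[of _ "{0<..}"]\<close>)
  next
    case 2
    have "((\<lambda>t. 0) has_real_derivative 0) (at t)" by simp
    then show ?thesis
      by (rule DERIV_cong_ev[THEN iffD1, rotated -1])
        (use 2 in \<open>auto simp: flat_def eventually_nhds intro!: exI[of _ "{..<0}"]\<close>)
  next
    case 3
    have "((\<lambda>h. flat p h / h) \<longlongrightarrow> 0) (at_right 0)"
    proof (rule Lim_transform_eventually)
      \<comment> \<open>With x = 1/h the difference quotient at 0 from the right becomes x p(x) exp
        (-x) as x tends to infinity.\<close>
      show "((\<lambda>h. poly ([:0, 1:] * p) (inverse h) * exp (- inverse h)) \<longlongrightarrow> 0) (at_right 0)"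
        by (rule filterlim_compose[OF poly_times_exp_minus_tendsto_0 filterlim_inverse_at_top_right])
      show "\<forall>\<^sub>F h in at_right 0. poly ([:0, 1:] * p) (inverse h) * exp (- inverse h) = flat p h / h"
        by (auto simp: eventually_at_right_field flat_def field_simps intro!: exI[of _ 1])
    qed
    moreover have "((\<lambda>h. flat p h / h) \<longlongrightarrow> 0) (at_left 0)"
      by (rule Lim_transform_eventually[OF tendsto_const])
        (auto simp: eventually_at_left_field flat_def intro!: exI[of _ "-1"])
    ultimately have "((\<lambda>h. flat p h / h) \<longlongrightarrow> 0) (at 0)"
      by (simp add: filterlim_split_at)
    then show ?thesis
      using 3 by (simp add: DERIV_def flat_def)
  qed
qed

text \<open>A class of functions that is closed under differentiation, so that membership gives all \<open>C_k\<close>.\<close>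

inductive_set flat_algebra :: "('a::euclidean_space \<Rightarrow> real) set" where
  flat: "(\<lambda>x. flat p (b + c \<bullet> x)) \<in> flat_algebra"
| const: "(\<lambda>x. k) \<in> flat_algebra"
| add: "f \<in> flat_algebra \<Longrightarrow> g \<in> flat_algebra \<Longrightarrow> (\<lambda>x. f x + g x) \<in> flat_algebra"
| mult: "f \<in> flat_algebra \<Longrightarrow> g \<in> flat_algebra \<Longrightarrow> (\<lambda>x. f x * g x) \<in> flat_algebra"

lemma flat_algebra_derivative:
  "f \<in> flat_algebra \<Longrightarrow>
    \<exists>f'. (\<forall>x. (f has_derivative (\<lambda>v. f' v x)) (at x)) \<and> (\<forall>v. f' v \<in> flat_algebra)"
proof (induction rule: flat_algebra.induct)
  case (flat p b c)
  have "((\<lambda>x. flat p (b + c \<bullet> x)) has_derivative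
      (\<lambda>v. flat ([:0, 0, 1:] * (p - pderiv p)) (b + c \<bullet> x) * (c \<bullet> v))) (at x)" for x
    using DERIV_flat[unfolded has_field_derivative_def]
    by (rule has_derivative_compose[rotated]) (auto intro!: derivative_eq_intros)
  then show ?case
    by (intro exI[of _ "\<lambda>v x. flat ([:0, 0, 1:] * (p - pderiv p)) (b + c \<bullet> x) * (c \<bullet> v)"])
      (auto intro!: flat_algebra.intros)
next
  case (const k)
  show ?case
    by (intro exI[of _ "\<lambda>v x. 0"]) (auto intro!: flat_algebra.intros)
next
  case (add f g)
  then obtain f' g' where
    "\<forall>x. (f has_derivative (\<lambda>v. f' v x)) (at x)" "\<forall>v. f' v \<in> flat_algebra"
    "\<forall>x. (g has_derivative (\<lambda>v. g' v x)) (at x)" "\<forall>v. g' v \<in> flat_algebra" by auto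
  then show ?case
    by (intro exI[of _ "\<lambda>v x. f' v x + g' v x"]) (auto intro!: flat_algebra.intros has_derivative_add)
next
  case (mult f g)
  then obtain f' g' where
    "\<forall>x. (f has_derivative (\<lambda>v. f' v x)) (at x)" "\<forall>v. f' v \<in> flat_algebra"
    "\<forall>x. (g has_derivative (\<lambda>v. g' v x)) (at x)" "\<forall>v. g' v \<in> flat_algebra" by auto
  with mult.hyps show ?case
    by (intro exI[of _ "\<lambda>v x. f x * g' v x + f' v x * g x"]) (auto intro!: flat_algebra.intros has_derivative_mult)
qed

lemma flat_algebra_C_k: "f \<in> flat_algebra \<Longrightarrow> C_k k f"
proof (rule C_k_coinduct[of flat_algebra])
  fix f :: "'a \<Rightarrow> real" and x v
  assume "f \<in> flat_algebra"
  then obtain f' where f': "\<And>x. (f has_derivative (\<lambda>v. f' v x)) (at x)" "\<And>v. f' v \<in> flat_algebra"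
    using flat_algebra_derivative[of f] by auto
  show "f differentiable at x"
    using f'(1)[of x] by (rule differentiableI)
  have "(\<lambda>x. frechet_derivative f (at x) v) = f' v"
    by (simp add: fun_eq_iff frechet_derivative_at[OF f'(1), symmetric])
  then show "(\<lambda>x. frechet_derivative f (at x) v) \<in> flat_algebra"
    using f'(2) by simp
qed

text \<open>Each coordinate contributes one factor for each of the two faces. The parameter n is a
  steepness: for every n > 0 the function is positive exactly on \<open>box a b\<close>, and as n
  grows it tends to the indicator. This supplies enough test functions without convolution.\<close>

definition box_bump :: "real \<Rightarrow> 'a::euclidean_space \<Rightarrow> 'a \<Rightarrow> 'a \<Rightarrow> real" where
  "box_bump n a b x = (\<Prod>i\<in>Basis. flat 1 (n * ((x - a) \<bullet> i)) * flat 1 (n * ((b - x) \<bullet> i)))"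

lemma flat_algebra_prod:
  "finite I \<Longrightarrow> (\<And>i. i \<in> I \<Longrightarrow> f i \<in> flat_algebra) \<Longrightarrow> (\<lambda>x. \<Prod>i\<in>I. f i x) \<in> flat_algebra"
  by (induction rule: finite_induct) (auto intro: flat_algebra.intros)

lemma box_bump_flat_algebra: "box_bump n a b \<in> flat_algebra"
proof -
  have "(\<lambda>x. flat 1 (n * ((x - a) \<bullet> i)) * flat 1 (n * ((b - x) \<bullet> i))) \<in> flat_algebra" for i
  proof -
    have "(\<lambda>x. flat 1 (- n * (a \<bullet> i) + (n *\<^sub>R i) \<bullet> x) * flat 1 (n * (b \<bullet> i) + (- n *\<^sub>R i) \<bullet> x)) \<in> flat_algebra"
      by (intro flat_algebra.intros)
    also have "(\<lambda>x. flat 1 (- n * (a \<bullet> i) + (n *\<^sub>R i) \<bullet> x) * flat 1 (n * (b \<bullet> i) + (- n *\<^sub>R i) \<bullet> x))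
      = (\<lambda>x. flat 1 (n * ((x - a) \<bullet> i)) * flat 1 (n * ((b - x) \<bullet> i)))"
      by (auto simp: fun_eq_iff algebra_simps inner_simps inner_commute)
    finally show ?thesis .
  qed
  then show ?thesis
    unfolding box_bump_def[abs_def] by (intro flat_algebra_prod) auto
qed

lemma flat_1_bounds: "0 \<le> flat 1 t" "flat 1 t \<le> 1"
  by (auto simp: flat_def)

lemma box_bump_bounds: "0 \<le> box_bump n a b x" "box_bump n a b x \<le> 1"
  unfolding box_bump_def
  by (auto intro!: prod_nonneg prod_le_1 mult_le_one mult_nonneg_nonneg flat_1_bounds)

lemma box_bump_eq_0_iff:
  assumes "n > 0"
  shows "box_bump n a b x = 0 \<longleftrightarrow> x \<notin> box a b"
  using assms
  by (force simp: box_bump_def box_def flat_def zero_less_mult_iff inner_simps not_less)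

lemma box_bump_tendsto:
  "(\<lambda>n. box_bump (real (Suc n)) a b x) \<longlonglongrightarrow> indicator (box a b) x"
proof (cases "x \<in> box a b")
  case True
  have *: "(\<lambda>n. flat 1 (real (Suc n) * t)) \<longlonglongrightarrow> 1" if "t > 0" for t
  proof -
    have "(\<lambda>n. exp (- (1 / (real (Suc n) * t)))) \<longlonglongrightarrow> exp (- 0)"
    proof (intro tendsto_exp tendsto_minus)
      have "(\<lambda>n. inverse (real (Suc n)) * (1 / t)) \<longlonglongrightarrow> 0 * (1 / t)"
        by (intro tendsto_mult LIMSEQ_inverse_real_of_nat tendsto_const)
      then show "(\<lambda>n. 1 / (real (Suc n) * t)) \<longlonglongrightarrow> 0"
        by (simp add: field_simps)
    qed
    moreover have "flat 1 (real (Suc n) * t) = exp (- (1 / (real (Suc n) * t)))" for n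
      using that by (auto simp: flat_def zero_less_mult_iff)
    ultimately show ?thesis by simp
  qed
  have "(\<lambda>n. box_bump (real (Suc n)) a b x) \<longlonglongrightarrow> (\<Prod>i\<in>(Basis::'a set). 1 * 1)"
    unfolding box_bump_def using True
    by (intro tendsto_prod tendsto_mult *) (auto simp: box_def inner_simps)
  with True show ?thesis by simp
next
  case False
  then have "box_bump (real (Suc n)) a b x = 0" for n
    by (subst box_bump_eq_0_iff) auto
  with False show ?thesis by (simp del: of_nat_Suc)
qed

lemma test_function_box_bump:
  assumes "n > 0" "cbox a b \<subseteq> \<Omega>"
  shows "test_function \<Omega> (box_bump n a b)"
proof -
  have sub: "closure {x. box_bump n a b x \<noteq> 0} \<subseteq> cbox a b"
    using assms(1) box_subset_cbox by (intro closure_minimal) (auto simp: box_bump_eq_0_iff)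
  then have "bounded (closure {x. box_bump n a b x \<noteq> 0})"
    using bounded_cbox bounded_subset by blast
  with sub show ?thesis
    using assms(2) flat_algebra_C_k[OF box_bump_flat_algebra]
    by (auto simp: test_function_def compact_eq_bounded_closed)
qed

section \<open>Linear combinations of test functions and their gradients\<close>

lemma compact_closed_subset: "compact S \<Longrightarrow> closed T \<Longrightarrow> T \<subseteq> S \<Longrightarrow> compact T"
  using compact_Int_closed[of S T] by (simp add: Int_absorb1)

lemma test_function_add:
  assumes "test_function \<Omega> f" "test_function \<Omega> g"
  shows "test_function \<Omega> (\<lambda>x. f x + g x)"
proof -
  have "closure {x. f x + g x \<noteq> 0} \<subseteq> closure ({x. f x \<noteq> 0} \<union> {x. g x \<noteq> 0})"
    by (intro closure_mono) auto
  then have sub: "closure {x. f x + g x \<noteq> 0} \<subseteq> closure {x. f x \<noteq> 0} \<union> closure {x. g x \<noteq> 0}"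
    by (simp add: closure_Un)
  then have "compact (closure {x. f x + g x \<noteq> 0})"
    using assms by (intro compact_closed_subset[OF _ closed_closure sub]) (auto simp: test_function_def)
  with sub assms show ?thesis
    by (auto simp: test_function_def C_k_add)
qed

lemma test_function_scale:
  assumes "test_function \<Omega> f"
  shows "test_function \<Omega> (\<lambda>x. c * f x)"
proof -
  have sub: "closure {x. c * f x \<noteq> 0} \<subseteq> closure {x. f x \<noteq> 0}"
    by (intro closure_mono) auto
  then have "compact (closure {x. c * f x \<noteq> 0})"
    using assms by (intro compact_closed_subset[OF _ closed_closure sub]) (auto simp: test_function_def)
  with sub assms show ?thesis
    by (auto simp: test_function_def C_k_scale)
qed

text \<open>Inequalities are proved in this class. It is easily seen to contain products and
  quotients by the regularised norm, whereas for \<open>test_function\<close> every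
  \<open>C_k\<close> would have to be checked again. K only has to contain the support.\<close>

definition C1_compact :: "('a::euclidean_space \<Rightarrow> real) \<Rightarrow> ('a \<Rightarrow> 'a) \<Rightarrow> 'a set \<Rightarrow> bool" where
  "C1_compact f g K \<longleftrightarrow> (\<forall>x. GDERIV f x :> g x) \<and> continuous_on UNIV g \<and> compact K \<and>
     (\<forall>x. x \<notin> K \<longrightarrow> f x = 0 \<and> g x = 0)"

lemma GDERIV_unique:
  assumes "GDERIV f x :> d" "GDERIV f x :> e" shows "d = e"
proof -
  have "(\<lambda>h. h \<bullet> d) = (\<lambda>h. h \<bullet> e)"
    using assms unfolding gderiv_def by (rule has_derivative_unique)
  then show ?thesis by (metis (no_types) vector_eq_rdot inner_commute)
qed

lemma grad_eq: "GDERIV f x :> d \<Longrightarrow> grad f x = d"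
  unfolding grad_def by (rule the_equality) (auto intro: GDERIV_unique)

text \<open>The gradient is assembled from the directional derivatives along the basis, which
  represent the Frechet derivative as an inner product and are continuous by the first-order case of
  \<open>C_k\<close>.\<close>

lemma test_function_C1_compact:
  assumes "test_function \<Omega> \<phi>"
  obtains K where "K \<subseteq> \<Omega>" "C1_compact \<phi> (grad \<phi>) K"
proof -
  let ?K = "closure {x. \<phi> x \<noteq> 0}"
  let ?D = "\<lambda>x v. frechet_derivative \<phi> (at x) v"
  have C: "C_k (Suc 0) \<phi>" using assms by (simp add: test_function_def)
  have G: "GDERIV \<phi> x :> (\<Sum>b\<in>Basis. ?D x b *\<^sub>R b)" for x
  proof -
    have D: "(\<phi> has_derivative ?D x) (at x)"
      using C by (simp add: frechet_derivative_works)
    have "?D x v = v \<bullet> (\<Sum>b\<in>Basis. ?D x b *\<^sub>R b)" for v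
    proof -
      interpret linear "?D x" using D by (rule has_derivative_linear)
      have "?D x v = ?D x (\<Sum>b\<in>Basis. (v \<bullet> b) *\<^sub>R b)" by (simp add: euclidean_representation)
      also have "\<dots> = v \<bullet> (\<Sum>b\<in>Basis. ?D x b *\<^sub>R b)"
        by (simp only: sum scaleR inner_sum_right) (simp add: mult.commute)
      finally show ?thesis .
    qed
    then have "?D x = (\<lambda>v. v \<bullet> (\<Sum>b\<in>Basis. ?D x b *\<^sub>R b))" by (intro ext)
    with D show ?thesis unfolding gderiv_def by (rule has_derivative_eq_rhs)
  qed
  have eq: "grad \<phi> = (\<lambda>x. \<Sum>b\<in>Basis. ?D x b *\<^sub>R b)"
    using grad_eq[OF G] by auto
  have "continuous_on UNIV (grad \<phi>)"
    unfolding eq using C by (auto intro!: continuous_intros)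
  moreover have "grad \<phi> x = 0" if "x \<notin> ?K" for x
  proof (rule grad_eq)
    \<comment> \<open>The complement of the closed support is open, so the function vanishes in a
      neighbourhood of x.\<close>
    have ev: "eventually (\<lambda>y. 0 = \<phi> y) (nhds x)"
      using that closure_subset[of "{x. \<phi> x \<noteq> 0}"]
      by (auto simp: eventually_nhds intro!: exI[of _ "- ?K"])
    have "eventually (\<lambda>y. 0 = \<phi> y) (at x)"
      using ev unfolding eventually_at_filter by (rule eventually_mono) simp
    moreover have "0 = \<phi> x"
      using ev by (rule eventually_nhds_x_imp_x)
    ultimately have "(\<phi> has_derivative (\<lambda>h. 0)) (at x)"
      using has_derivative_transform_eventually[OF has_derivative_const[of 0], of \<phi> x UNIV] by simp
    then show "GDERIV \<phi> x :> 0"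
      by (simp add: gderiv_def)
  qed
  moreover have "\<phi> x = 0" if "x \<notin> ?K" for x
    using that closure_subset[of "{x. \<phi> x \<noteq> 0}"] by auto
  moreover have "GDERIV \<phi> x :> grad \<phi> x" for x
    using G[of x] unfolding eq .
  ultimately have "C1_compact \<phi> (grad \<phi>) ?K"
    using assms unfolding C1_compact_def test_function_def by blast
  with that assms show ?thesis by (auto simp: test_function_def)
qed

lemma grad_add:
  assumes "test_function \<Omega> f" "test_function \<Omega> g"
  shows "grad (\<lambda>x. f x + g x) x = grad f x + grad g x"
  by (rule grad_eq, rule GDERIV_add)
    (use assms in \<open>auto elim!: test_function_C1_compact simp: C1_compact_def\<close>)

lemma grad_scale:
  assumes "test_function \<Omega> f"
  shows "grad (\<lambda>x. c * f x) x = c *\<^sub>R grad f x"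
proof -
  have "GDERIV f x :> grad f x"
    using assms by (auto elim!: test_function_C1_compact simp: C1_compact_def)
  from GDERIV_mult[OF GDERIV_const this, of c] show ?thesis
    by (intro grad_eq) simp
qed

lemma C1_compact_continuous: "C1_compact f g K \<Longrightarrow> continuous_on UNIV f"
  unfolding C1_compact_def gderiv_def
  by (meson continuous_at_imp_continuous_on has_derivative_continuous)

lemma L2_compact_support:
  fixes f :: "'a::euclidean_space \<Rightarrow> 'b::euclidean_space"
  assumes "continuous_on UNIV f" "compact K" "\<And>x. x \<notin> K \<Longrightarrow> f x = 0"
  shows "L2 f"
proof -
  have "integrable lborel (\<lambda>x. indicator K x *\<^sub>R (norm (f x))\<^sup>2)"
    by (intro borel_integrable_compact assms continuous_intros continuous_on_subset[OF assms(1)]) auto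
  also have "(\<lambda>x. indicator K x *\<^sub>R (norm (f x))\<^sup>2) = (\<lambda>x. (norm (f x))\<^sup>2)"
    using assms(3) by (auto simp: indicator_def fun_eq_iff)
  finally show ?thesis
    using assms(1) by (auto simp: L2_def borel_measurable_continuous_onI)
qed

lemma C1_compact_L2:
  assumes "C1_compact f g K" shows "L2 f" "L2 g"
  using assms C1_compact_continuous[OF assms]
  by (auto intro!: L2_compact_support[of _ K] simp: C1_compact_def)

lemma test_function_L2:
  assumes "test_function \<Omega> \<phi>" shows "L2 \<phi>" "L2 (grad \<phi>)"
  using assms by (auto elim!: test_function_C1_compact simp: C1_compact_L2)

lemma test_function_outside:
  assumes "test_function \<Omega> \<phi>" "x \<notin> \<Omega>" shows "\<phi> x = 0" "grad \<phi> x = 0"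
proof -
  obtain K where "K \<subseteq> \<Omega>" "C1_compact \<phi> (grad \<phi>) K"
    using assms(1) by (rule test_function_C1_compact)
  with assms(2) show "\<phi> x = 0" "grad \<phi> x = 0"
    by (auto simp: C1_compact_def)
qed

section \<open>Measure preserving maps and flows\<close>

text \<open>Equality with the image measure serves nonnegative integrals, Bochner integrals and null
  sets alike, and covers both translations and rotations.\<close>

definition measure_preserving :: "('a::euclidean_space \<Rightarrow> 'a) \<Rightarrow> bool" where
  "measure_preserving T \<longleftrightarrow> T \<in> borel_measurable borel \<and> distr lborel borel T = lborel"

lemma measure_preserving_measurable: "measure_preserving T \<Longrightarrow> T \<in> borel_measurable borel"
  by (simp add: measure_preserving_def)

lemma measure_preserving_translation: "measure_preserving (\<lambda>x. x + z)"
  using lborel_distr_plus[of z] by (simp add: measure_preserving_def add.commute[of _ z])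

lemma measure_preserving_nn_integral:
  assumes "measure_preserving T" "f \<in> borel_measurable borel"
  shows "(\<integral>\<^sup>+x. f (T x) \<partial>lborel) = (\<integral>\<^sup>+x. f x \<partial>lborel)"
proof -
  have "(\<integral>\<^sup>+x. f x \<partial>lborel) = (\<integral>\<^sup>+x. f x \<partial>(distr lborel borel T))"
    using assms(1) by (simp add: measure_preserving_def)
  also have "\<dots> = (\<integral>\<^sup>+x. f (T x) \<partial>lborel)"
    using assms by (intro nn_integral_distr) (auto simp: measure_preserving_def)
  finally show ?thesis by simp
qed

lemma measure_preserving_integral:
  fixes f :: "'a::euclidean_space \<Rightarrow> 'b::{banach, second_countable_topology}"
  assumes "measure_preserving T" "f \<in> borel_measurable borel"
  shows "(LINT x|lborel. f (T x)) = (LINT x|lborel. f x)"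
proof -
  have "(LINT x|lborel. f x) = (LINT x|(distr lborel borel T). f x)"
    using assms(1) by (simp add: measure_preserving_def)
  also have "\<dots> = (LINT x|lborel. f (T x))"
    using assms by (intro integral_distr) (auto simp: measure_preserving_def)
  finally show ?thesis by simp
qed

lemma measure_preserving_AE:
  assumes T: "measure_preserving T" and "AE x in lborel. P x"
  shows "AE x in lborel. P (T x)"
proof -
  obtain N where N: "N \<in> null_sets lborel" "{x. \<not> P x} \<subseteq> N"
    using assms(2) by (auto elim!: AE_E2 simp: eventually_ae_filter)
  have [measurable]: "T \<in> borel_measurable borel" "N \<in> sets borel"
    using T N by (auto simp: measure_preserving_def)
  have "emeasure lborel (T -` N) = emeasure (distr lborel borel T) N"
    by (subst emeasure_distr) auto
  also have "\<dots> = 0"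
    using T N by (simp add: measure_preserving_def null_sets_def)
  finally have "T -` N \<in> null_sets lborel"
    using measurable_sets[of T borel borel N] by (auto simp: null_sets_def)
  then show ?thesis
    using N(2) by (intro AE_I'[of "T -` N"]) auto
qed

text \<open>The fundamental theorem of calculus along the flow lines, Cauchy--Schwarz in the time variable
  and the invariance of the measure.\<close>

lemma flow_difference_estimate:
  fixes F F' :: "real \<Rightarrow> 'a::euclidean_space \<Rightarrow> 'a"
  assumes C: "C1_compact \<phi> g K"
    and F: "\<And>s. measure_preserving (F s)"
    and cont: "continuous_on UNIV (\<lambda>p. F (fst p) (snd p))"
    and der: "\<And>s x. ((\<lambda>s. F s x) has_vector_derivative F' s x) (at s)"
    and cont': "\<And>x. continuous_on UNIV (\<lambda>s. F' s x)"
    and bd: "\<And>s x. norm (F' s x) \<le> \<sigma> x" and \<sigma>: "\<And>x. \<sigma> x > 0" "\<sigma> \<in> borel_measurable borel"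
    and "0 \<le> a"
  shows "(\<integral>\<^sup>+x. ennreal ((\<phi> (F a x) - \<phi> (F 0 x))\<^sup>2 / (\<sigma> x)\<^sup>2) \<partial>lborel) \<le> ennreal (a\<^sup>2 * (l2 g)\<^sup>2)"
proof -
  have gcont: "continuous_on UNIV g" and gder: "\<And>x. GDERIV \<phi> x :> g x"
    using C by (auto simp: C1_compact_def)
  have [measurable]: "g \<in> borel_measurable borel" "\<phi> \<in> borel_measurable borel"
    using C1_compact_L2[OF C] by (auto simp: L2_def)
  have Fm [measurable]: "(\<lambda>p. F (fst p) (snd p)) \<in> borel_measurable (borel \<Otimes>\<^sub>M borel)"
    using borel_measurable_continuous_onI[OF cont] by (simp add: borel_prod)
  have "continuous_on UNIV (\<lambda>p. F (snd p) (fst p))"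
  proof -
    have "continuous_on UNIV (\<lambda>p::'a \<times> real. (snd p, fst p))"
      by (intro continuous_intros)
    from continuous_on_compose2[OF cont this] show ?thesis by simp
  qed
  from borel_measurable_continuous_onI[OF this]
  have [measurable]: "(\<lambda>p. F (snd p) (fst p)) \<in> borel_measurable (borel \<Otimes>\<^sub>M borel)"
    by (simp add: borel_prod)
  have Fx: "continuous_on UNIV (\<lambda>s. F s x)" for x
    using der by (intro continuous_at_imp_continuous_on ballI) (rule has_vector_derivative_continuous)
  have [measurable]: "(\<lambda>s. F s x) \<in> borel_measurable borel" for x
    by (rule borel_measurable_continuous_onI[OF Fx])
  let ?I = "indicator {0..a} :: real \<Rightarrow> real"
  have point: "ennreal ((\<phi> (F a x) - \<phi> (F 0 x))\<^sup>2 / (\<sigma> x)\<^sup>2)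
      \<le> ennreal a * (\<integral>\<^sup>+s. ennreal (?I s) * ennreal ((norm (g (F s x)))\<^sup>2) \<partial>lborel)" for x
  proof -
    let ?d = "\<lambda>s. F' s x \<bullet> g (F s x)"
    let ?J = "\<integral>\<^sup>+s. ennreal (?I s) * ennreal (?I s * norm (g (F s x))) \<partial>lborel"
    have d: "((\<lambda>s. \<phi> (F s x)) has_vector_derivative ?d s) (at s)" for s
    proof -
      have "((\<lambda>s. \<phi> (F s x)) has_derivative (\<lambda>h. (h *\<^sub>R F' s x) \<bullet> g (F s x))) (at s)"
        by (rule has_derivative_compose[OF der[unfolded has_vector_derivative_def] gder[unfolded gderiv_def]])
      then show ?thesis by (simp add: has_vector_derivative_def)
    qed
    have cd: "continuous_on UNIV ?d"
      by (intro continuous_on_inner cont' continuous_on_compose2[OF gcont Fx]) auto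
    have FTC: "(\<integral>s. ?I s *\<^sub>R ?d s \<partial>lborel) = \<phi> (F a x) - \<phi> (F 0 x)"
      by (rule integral_FTC_Icc[OF \<open>0 \<le> a\<close> has_vector_derivative_at_within[OF d]])
         (rule continuous_on_subset[OF cd], simp)
    have int: "integrable lborel (\<lambda>s. ?I s *\<^sub>R ?d s)"
      by (intro borel_integrable_compact continuous_on_subset[OF cd]) auto
    have "ennreal \<bar>\<phi> (F a x) - \<phi> (F 0 x)\<bar> \<le> (\<integral>\<^sup>+s. norm (?I s *\<^sub>R ?d s) \<partial>lborel)"
      using integral_norm_bound_ennreal[OF int] unfolding FTC by simp
    also have "\<dots> \<le> (\<integral>\<^sup>+s. ennreal (\<sigma> x) * (ennreal (?I s) * ennreal (?I s * norm (g (F s x)))) \<partial>lborel)"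
    proof (rule nn_integral_mono)
      fix s
      have "\<bar>?d s\<bar> \<le> norm (F' s x) * norm (g (F s x))" by (rule Cauchy_Schwarz_ineq2)
      also have "\<dots> \<le> \<sigma> x * norm (g (F s x))" by (intro mult_right_mono bd) auto
      finally show "ennreal (norm (?I s *\<^sub>R ?d s)) \<le> ennreal (\<sigma> x) * (ennreal (?I s) * ennreal (?I s * norm (g (F s x))))"
        using \<sigma>(1)[of x] by (auto simp: indicator_def ennreal_mult'[symmetric])
    qed
    also have "\<dots> = ennreal (\<sigma> x) * ?J"
      by (intro nn_integral_cmult) measurable
    finally have 1: "ennreal \<bar>\<phi> (F a x) - \<phi> (F 0 x)\<bar> \<le> ennreal (\<sigma> x) * ?J" .
    have "?J\<^sup>2 \<le> (\<integral>\<^sup>+s. (ennreal (?I s))\<^sup>2 \<partial>lborel) * (\<integral>\<^sup>+s. (ennreal (?I s * norm (g (F s x))))\<^sup>2 \<partial>lborel)"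
      by (rule Cauchy_Schwarz_nn_integral) auto
    also have "(\<integral>\<^sup>+s. (ennreal (?I s))\<^sup>2 \<partial>lborel) = (\<integral>\<^sup>+s. indicator {0..a} s \<partial>lborel)"
      by (intro nn_integral_cong) (auto simp: indicator_def)
    also have "\<dots> = ennreal a" using \<open>0 \<le> a\<close> by simp
    also have "(\<integral>\<^sup>+s. (ennreal (?I s * norm (g (F s x))))\<^sup>2 \<partial>lborel)
      = (\<integral>\<^sup>+s. ennreal (?I s) * ennreal ((norm (g (F s x)))\<^sup>2) \<partial>lborel)"
      by (intro nn_integral_cong) (auto simp: indicator_def ennreal_power)
    finally have 2: "?J\<^sup>2 \<le> ennreal a * (\<integral>\<^sup>+s. ennreal (?I s) * ennreal ((norm (g (F s x)))\<^sup>2) \<partial>lborel)" .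
    \<comment> \<open>The speed bound depends only on the starting point x, so it left the time
      integral as a factor and cancels here.\<close>
    have "(ennreal (\<bar>\<phi> (F a x) - \<phi> (F 0 x)\<bar> / \<sigma> x))\<^sup>2 = (ennreal (1 / \<sigma> x) * ennreal \<bar>\<phi> (F a x) - \<phi> (F 0 x)\<bar>)\<^sup>2"
      using \<sigma>(1)[of x] by (simp add: ennreal_mult'[symmetric])
    also have "\<dots> \<le> (ennreal (1 / \<sigma> x) * (ennreal (\<sigma> x) * ?J))\<^sup>2"
      by (intro power_mono mult_left_mono 1) auto
    also have "ennreal (1 / \<sigma> x) * (ennreal (\<sigma> x) * ?J) = ?J"
      using \<sigma>(1)[of x] by (simp add: mult.assoc[symmetric] ennreal_mult'[symmetric])
    finally show ?thesis
      using 2 \<sigma>(1)[of x] by (simp add: ennreal_power power_divide)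
  qed
  have "(\<integral>\<^sup>+x. ennreal ((\<phi> (F a x) - \<phi> (F 0 x))\<^sup>2 / (\<sigma> x)\<^sup>2) \<partial>lborel)
      \<le> (\<integral>\<^sup>+x. ennreal a * (\<integral>\<^sup>+s. ennreal (?I s) * ennreal ((norm (g (F s x)))\<^sup>2) \<partial>lborel) \<partial>lborel)"
    by (intro nn_integral_mono point)
  also have "\<dots> = ennreal a * (\<integral>\<^sup>+x. (\<integral>\<^sup>+s. ennreal (?I s) * ennreal ((norm (g (F s x)))\<^sup>2) \<partial>lborel) \<partial>lborel)"
    by (intro nn_integral_cmult lborel.borel_measurable_nn_integral) measurable
  also have "(\<integral>\<^sup>+x. (\<integral>\<^sup>+s. ennreal (?I s) * ennreal ((norm (g (F s x)))\<^sup>2) \<partial>lborel) \<partial>lborel)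
     = (\<integral>\<^sup>+s. (\<integral>\<^sup>+x. ennreal (?I s) * ennreal ((norm (g (F s x)))\<^sup>2) \<partial>lborel) \<partial>lborel)"
    by (rule lborel_pair.Fubini') measurable
  \<comment> \<open>After Tonelli every time s contributes the same amount, because
    \<open>F s\<close> preserves the measure. One factor a comes from here, the other from
    Cauchy-Schwarz in time.\<close>
  also have "\<dots> = (\<integral>\<^sup>+s. ennreal (?I s) * ennreal ((l2 g)\<^sup>2) \<partial>lborel)"
  proof (rule nn_integral_cong)
    fix s
    have [measurable]: "F s \<in> borel_measurable borel"
      using F by (rule measure_preserving_measurable)
    have "(\<integral>\<^sup>+x. ennreal ((norm (g (F s x)))\<^sup>2) \<partial>lborel) = ennreal ((l2 g)\<^sup>2)"
      using measure_preserving_nn_integral[OF F, of "\<lambda>x. ennreal ((norm (g x))\<^sup>2)"]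
        L2_nn_integral[OF C1_compact_L2(2)[OF C]] by simp
    then show "(\<integral>\<^sup>+x. ennreal (?I s) * ennreal ((norm (g (F s x)))\<^sup>2) \<partial>lborel) = ennreal (?I s) * ennreal ((l2 g)\<^sup>2)"
      by (subst nn_integral_cmult) auto
  qed
  also have "\<dots> = (\<integral>\<^sup>+s. ennreal ((l2 g)\<^sup>2) * indicator {0..a} s \<partial>lborel)"
    by (intro nn_integral_cong) (auto simp: indicator_def)
  also have "\<dots> = ennreal ((l2 g)\<^sup>2) * ennreal a"
    using \<open>0 \<le> a\<close> by (subst nn_integral_cmult_indicator) auto
  also have "ennreal a * (ennreal ((l2 g)\<^sup>2) * ennreal a) = ennreal (a\<^sup>2 * (l2 g)\<^sup>2)"
    using \<open>0 \<le> a\<close> by (simp add: ennreal_mult'[symmetric] power2_eq_square mult_ac)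
  finally show ?thesis .
qed

section \<open>Integration by parts and uniqueness of weak gradients\<close>

text \<open>The fundamental theorem of calculus along the segment from x to x + e gives f(x + e) -
  f(x). Its integral over x is 0 by translation invariance, and by Fubini it is the inner product of
  e with the integral of g.\<close>

lemma C1_compact_integral_grad_eq_0:
  assumes C: "C1_compact f g K"
  shows "(LINT x|lborel. g x) = 0"
proof -
  have gcont: "continuous_on UNIV g" and gder: "\<And>x. GDERIV f x :> g x"
    and K: "compact K" "\<And>x. x \<notin> K \<Longrightarrow> f x = 0" "\<And>x. x \<notin> K \<Longrightarrow> g x = 0"
    using C by (auto simp: C1_compact_def)
  have [measurable]: "g \<in> borel_measurable borel" "f \<in> borel_measurable borel"
    using C1_compact_L2[OF C] by (auto simp: L2_def)
  have supp_int: "integrable lborel h" if "continuous_on UNIV h" "\<And>x. x \<notin> K \<Longrightarrow> h x = 0"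
    for h :: "'a \<Rightarrow> 'b::euclidean_space"
  proof -
    have "integrable lborel (\<lambda>x. indicator K x *\<^sub>R h x)"
      by (intro borel_integrable_compact K continuous_on_subset[OF that(1)]) auto
    also have "(\<lambda>x. indicator K x *\<^sub>R h x) = h"
      using that(2) by (auto simp: indicator_def fun_eq_iff)
    finally show ?thesis .
  qed
  have fi: "integrable lborel f" and gi: "integrable lborel g"
    using supp_int[OF C1_compact_continuous[OF C] K(2)] supp_int[OF gcont K(3)] by auto
  have "(LINT x|lborel. g x) \<bullet> e = 0" for e
  proof -
    let ?I = "indicator {0..1} :: real \<Rightarrow> real"
    let ?h = "\<lambda>t x. ?I t *\<^sub>R (e \<bullet> g (x + t *\<^sub>R e))"
    \<comment> \<open>The points from which the segment in direction e meets K. The integrand is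
      supported in this compact set for all t in [0, 1], which gives the integrability that Fubini
      requires.\<close>
    let ?K' = "(\<lambda>(x, t). x - t *\<^sub>R e) ` (K \<times> {0..1})"
    have hc: "continuous_on UNIV (\<lambda>p. e \<bullet> g (snd p + fst p *\<^sub>R e))"
      by (intro continuous_intros continuous_on_compose2[OF gcont]) auto
    have K': "compact ?K'"
      by (intro compact_continuous_image compact_Times K) (auto intro!: continuous_intros simp: split_beta)
    have "integrable lborel (\<lambda>p. indicator ({0..1} \<times> ?K') p *\<^sub>R (e \<bullet> g (snd p + fst p *\<^sub>R e)))"
      by (intro borel_integrable_compact compact_Times K' continuous_on_subset[OF hc]) auto
    also have "(\<lambda>p. indicator ({0..1} \<times> ?K') p *\<^sub>R (e \<bullet> g (snd p + fst p *\<^sub>R e)))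
      = (\<lambda>(t, x). ?h t x)"
    proof (intro ext, clarify)
      fix t :: real and x
      have "e \<bullet> g (x + t *\<^sub>R e) = 0" if "t \<in> {0..1}" "x \<notin> ?K'"
      proof -
        have "x + t *\<^sub>R e \<notin> K"
          using that(2) by (rule contrapos_nn) (use that(1) in \<open>auto intro!: rev_image_eqI[of "(x + t *\<^sub>R e, t)"]\<close>)
        then show ?thesis by (simp add: K(3))
      qed
      then show "indicator ({0..1} \<times> ?K') (t, x) *\<^sub>R (e \<bullet> g (snd (t, x) + fst (t, x) *\<^sub>R e)) = ?h t x"
        by (auto simp: indicator_def)
    qed
    finally have hint: "integrable (lborel \<Otimes>\<^sub>M lborel) (\<lambda>(t, x). ?h t x)"
      by (simp add: lborel_prod)
    have FTC: "(LINT t|lborel. ?h t x) = f (x + e) - f x" for x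
    proof -
      have d: "((\<lambda>t. f (x + t *\<^sub>R e)) has_vector_derivative (e \<bullet> g (x + t *\<^sub>R e))) (at t)" for t
      proof -
        have "((\<lambda>t. x + t *\<^sub>R e) has_derivative (\<lambda>h. h *\<^sub>R e)) (at t)"
          by (auto intro!: derivative_eq_intros)
        from has_derivative_compose[OF this gder[unfolded gderiv_def]] show ?thesis
          by (simp add: has_vector_derivative_def)
      qed
      have "continuous_on {0..1} (\<lambda>t. e \<bullet> g (x + t *\<^sub>R e))"
        by (intro continuous_intros continuous_on_compose2[OF gcont]) auto
      then show ?thesis
        using integral_FTC_Icc[of 0 1 "\<lambda>t. f (x + t *\<^sub>R e)" "\<lambda>t. e \<bullet> g (x + t *\<^sub>R e)"]
          has_vector_derivative_at_within[OF d] by simp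
    qed
    have fe: "integrable lborel (\<lambda>x. f (x + e))"
    proof -
      have "integrable (distr lborel borel (\<lambda>x. x + e)) f"
        using fi measure_preserving_translation[of e] by (simp add: measure_preserving_def)
      then show ?thesis
        by (subst (asm) integrable_distr_eq) auto
    qed
    have "0 = (LINT x|lborel. f (x + e)) - (LINT x|lborel. f x)"
      by (subst measure_preserving_integral[OF measure_preserving_translation]) auto
    also have "\<dots> = (LINT x|lborel. f (x + e) - f x)"
      using fe fi by simp
    also have "\<dots> = (LINT x|lborel. LINT t|lborel. ?h t x)"
      by (simp only: FTC)
    also have "\<dots> = (LINT t|lborel. LINT x|lborel. ?h t x)"
      by (rule lborel_pair.Fubini_integral[OF hint])
    also have "\<dots> = (LINT t|lborel. ?I t *\<^sub>R (e \<bullet> (LINT x|lborel. g x)))"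
    proof (intro Bochner_Integration.integral_cong refl)
      fix t :: real
      have "(LINT x|lborel. e \<bullet> g (x + t *\<^sub>R e)) = (LINT x|lborel. e \<bullet> g x)"
        by (rule measure_preserving_integral[OF measure_preserving_translation]) auto
      then show "(LINT x|lborel. ?h t x) = ?I t *\<^sub>R (e \<bullet> (LINT x|lborel. g x))"
        using gi by (simp add: integral_inner_right)
    qed
    also have "\<dots> = e \<bullet> (LINT x|lborel. g x)" by simp
    finally show ?thesis by (simp add: inner_commute)
  qed
  \<comment> \<open>Taking e to be the integral itself makes its squared norm vanish.\<close>
  from this[of "LINT x|lborel. g x"] show ?thesis by simp
qed

lemma L2_integrable_scaleR:
  fixes f :: "'a::euclidean_space \<Rightarrow> real"
  assumes "L2 f" "L2 g"
  shows "integrable lborel (\<lambda>x. f x *\<^sub>R g x)" "norm (LINT x|lborel. f x *\<^sub>R g x) \<le> l2 f * l2 g"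
proof -
  have [measurable]: "f \<in> borel_measurable borel" "g \<in> borel_measurable borel"
    using assms by (auto simp: L2_def)
  show I: "integrable lborel (\<lambda>x. f x *\<^sub>R g x)"
    using L2_norm_mult(1)[OF assms] by (subst integrable_norm_iff[symmetric]) auto
  have "norm (LINT x|lborel. f x *\<^sub>R g x) \<le> (LINT x|lborel. norm (f x *\<^sub>R g x))"
    by (rule integral_norm_bound)
  with L2_norm_mult(2)[OF assms] show "norm (LINT x|lborel. f x *\<^sub>R g x) \<le> l2 f * l2 g" by simp
qed

text \<open>The product f f' has gradient f g' + f' g, and the integral of this gradient
  vanishes.\<close>

lemma C1_compact_integration_by_parts:
  assumes C: "C1_compact f g K" and C': "C1_compact f' g' K'"
  shows "(LINT x|lborel. f x *\<^sub>R g' x) = - (LINT x|lborel. f' x *\<^sub>R g x)"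
proof -
  have "C1_compact (\<lambda>x. f x * f' x) (\<lambda>x. f x *\<^sub>R g' x + f' x *\<^sub>R g x) K"
    using C C' C1_compact_continuous[OF C] C1_compact_continuous[OF C']
    unfolding C1_compact_def by (auto intro!: GDERIV_mult continuous_intros)
  from C1_compact_integral_grad_eq_0[OF this]
  have "(LINT x|lborel. f x *\<^sub>R g' x) + (LINT x|lborel. f' x *\<^sub>R g x) = 0"
    using L2_integrable_scaleR(1)[OF C1_compact_L2(1)[OF C] C1_compact_L2(2)[OF C']]
      L2_integrable_scaleR(1)[OF C1_compact_L2(1)[OF C'] C1_compact_L2(2)[OF C]] by simp
  then show ?thesis by (simp add: add_eq_0_iff)
qed

text \<open>Open boxes are closed under intersection and generate the Borel sets, so by a Dynkin
  argument the integral vanishes over every Borel set. The vanishing total integral handles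
  complements.\<close>

lemma integrable_box_integrals_0_imp_AE_0:
  fixes f :: "'a::euclidean_space \<Rightarrow> 'b::euclidean_space"
  assumes f: "integrable lborel f" and zero: "(LINT x|lborel. f x) = 0"
    and box: "\<And>c d. (LINT x:box c d|lborel. f x) = 0"
  shows "AE x in lborel. f x = 0"
proof (rule sigma_finite_measure.density_zero[OF sigma_finite_lborel f])
  fix A :: "'a set" assume "A \<in> sets lborel"
  then have A: "A \<in> sigma_sets UNIV (range (\<lambda>(a, b). box a b))"
    by (subst (asm) sets_lborel, subst (asm) borel_eq_box) simp
  have borel: "sigma_sets UNIV (range (\<lambda>(a, b). box a b :: 'a set)) = sets borel"
    by (simp add: borel_eq_box)
  have Int: "Int_stable (range (\<lambda>(a, b). box a b :: 'a set))"
    by (auto simp: Int_stable_def box_Int_box)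
  have sub: "range (\<lambda>(a, b). box a b :: 'a set) \<subseteq> Pow UNIV" by simp
  from A show "set_lebesgue_integral lborel A f = 0"
  proof (induction rule: sigma_sets_induct_disjoint[OF Int sub, consumes 1, case_names basic empty compl union])
    case (basic A)
    then show ?case using box by auto
  next
    case empty
    then show ?case by (simp add: set_lebesgue_integral_def)
  next
    case (compl A)
    then have A: "A \<in> sets lborel" using borel by simp
    have iA: "integrable lborel (\<lambda>x. indicator A x *\<^sub>R f x)"
      using A f by (rule integrable_mult_indicator)
    have "set_lebesgue_integral lborel (UNIV - A) f = (LINT x|lborel. f x - indicator A x *\<^sub>R f x)"
      unfolding set_lebesgue_integral_def
      by (intro Bochner_Integration.integral_cong) (auto simp: indicator_def)
    also have "\<dots> = 0"
      using compl f iA zero by (simp add: set_lebesgue_integral_def)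
    finally show ?case .
  next
    case (union A)
    have "set_integrable lborel (\<Union>i. A i) f"
      using union borel unfolding set_integrable_def
      by (intro integrable_mult_indicator f) auto
    then have "set_lebesgue_integral lborel (\<Union>i. A i) f = (\<Sum>i. set_lebesgue_integral lborel (A i) f)"
      using union borel by (intro lebesgue_integral_countable_add) (auto simp: disjoint_family_on_def)
    also have "\<dots> = 0" using union by simp
    finally show ?case .
  qed
qed

lemma AE_cbox_boundary: "AE x in lborel. x \<notin> cbox a b - box (a::'a::euclidean_space) b"
proof -
  have "cbox a b - box a b \<in> null_sets lborel"
    using negligible_frontier_interval[of a b]
    by (auto simp: negligible_iff_null_sets null_sets_completion_iff)
  then show ?thesis by (rule AE_not_in)
qed

text \<open>The fundamental lemma of the calculus of variations. Bump functions tend to indicators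
  of boxes, the integrals over boxes determine an integrable function up to null sets, and countably
  many closed boxes cover the open set.\<close>

lemma weak_gradient_unique:
  fixes g h :: "'a::euclidean_space \<Rightarrow> 'a"
  assumes "open \<Omega>" and g: "has_weak_gradient \<Omega> u g" and h: "has_weak_gradient \<Omega> u h"
  shows "AE x in lborel. x \<in> \<Omega> \<longrightarrow> g x = h x"
proof -
  let ?f = "\<lambda>x. g x - h x"
  have fint: "set_integrable lborel K ?f" if "compact K" "K \<subseteq> \<Omega>" for K
    using g h that by (auto simp: has_weak_gradient_def intro!: set_integral_diff)
  have test: "(LINT x|lborel. \<phi> x *\<^sub>R ?f x) = 0" if \<phi>: "test_function \<Omega> \<phi>" for \<phi>
  proof -
    obtain K where K: "K \<subseteq> \<Omega>" and C: "C1_compact \<phi> (grad \<phi>) K"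
      using test_function_C1_compact[OF \<phi>] by auto
    have K': "compact K" "\<And>x. x \<notin> K \<Longrightarrow> \<phi> x = 0"
      using C by (auto simp: C1_compact_def)
    have \<phi>c: "continuous_on UNIV \<phi>" using C by (rule C1_compact_continuous)
    then have [measurable]: "\<phi> \<in> borel_measurable borel" by (rule borel_measurable_continuous_onI)
    obtain B where B: "\<And>x. \<bar>\<phi> x\<bar> \<le> B"
    proof -
      have "bounded (\<phi> ` K)"
        by (intro compact_imp_bounded compact_continuous_image K' continuous_on_subset[OF \<phi>c]) auto
      then obtain B where B: "\<And>x. x \<in> K \<Longrightarrow> \<bar>\<phi> x\<bar> \<le> B"
        by (auto simp: bounded_iff)
      have "\<bar>\<phi> x\<bar> \<le> \<bar>B\<bar>" for x
        using B[of x] K'(2)[of x] by (cases "x \<in> K") auto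
      then show ?thesis using that by blast
    qed
    have int: "integrable lborel (\<lambda>x. \<phi> x *\<^sub>R k x)" if k: "set_integrable lborel K k" for k :: "'a \<Rightarrow> 'a"
    proof (rule Bochner_Integration.integrable_bound)
      show "integrable lborel (\<lambda>x. B *\<^sub>R (indicator K x *\<^sub>R k x))"
        using k unfolding set_integrable_def by (rule integrable_scaleR_right)
      have eq: "(\<lambda>x. \<phi> x *\<^sub>R k x) = (\<lambda>x. \<phi> x *\<^sub>R (indicator K x *\<^sub>R k x))"
        using K'(2) by (auto simp: indicator_def fun_eq_iff)
      have [measurable]: "(\<lambda>x. indicator K x *\<^sub>R k x) \<in> borel_measurable borel"
        using borel_measurable_integrable[OF k[unfolded set_integrable_def]] by simp
      show "(\<lambda>x. \<phi> x *\<^sub>R k x) \<in> borel_measurable lborel"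
        unfolding eq by measurable
      have "norm (\<phi> x *\<^sub>R k x) \<le> norm (B *\<^sub>R indicator K x *\<^sub>R k x)" for x
        using K'(2)[of x] order_trans[OF B abs_ge_self, of x]
        by (cases "x \<in> K") (auto intro!: mult_right_mono)
      then show "AE x in lborel. norm (\<phi> x *\<^sub>R k x) \<le> norm (B *\<^sub>R indicator K x *\<^sub>R k x)" by auto
    qed
    have ind: "(LINT x:\<Omega>|lborel. \<phi> x *\<^sub>R k x) = (LINT x|lborel. \<phi> x *\<^sub>R k x)" for k :: "'a \<Rightarrow> 'a"
      unfolding set_lebesgue_integral_def using K K'(2)
      by (intro Bochner_Integration.integral_cong) (auto simp: indicator_def)
    have "(LINT x|lborel. \<phi> x *\<^sub>R g x) = (LINT x|lborel. \<phi> x *\<^sub>R h x)"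
    proof -
      have "(LINT x:\<Omega>|lborel. u x *\<^sub>R grad \<phi> x) = - (LINT x:\<Omega>|lborel. \<phi> x *\<^sub>R g x)"
        "(LINT x:\<Omega>|lborel. u x *\<^sub>R grad \<phi> x) = - (LINT x:\<Omega>|lborel. \<phi> x *\<^sub>R h x)"
        using g h \<phi> unfolding has_weak_gradient_def by blast+
      then show ?thesis unfolding ind by simp
    qed
    then show ?thesis
      using int[of g] int[of h] g h K K'(1)
      by (simp add: has_weak_gradient_def scaleR_diff_right)
  qed
  have box0: "(LINT x:box a b|lborel. ?f x) = 0" if "cbox a b \<subseteq> \<Omega>" for a b
  proof -
    let ?b = "\<lambda>n. box_bump (real (Suc n)) a b"
    let ?k = "\<lambda>x. indicator (cbox a b) x *\<^sub>R ?f x"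
    have ki: "integrable lborel ?k"
      using fint[OF compact_cbox that] by (simp add: set_integrable_def)
    have [measurable]: "?k \<in> borel_measurable borel"
      using borel_measurable_integrable[OF ki] by simp
    have [measurable]: "?b n \<in> borel_measurable borel" for n
      using test_function_L2(1)[OF test_function_box_bump[OF _ that, of "real (Suc n)"]]
      by (auto simp: L2_def)
    have z: "?b n x = 0" if "x \<notin> cbox a b" for n x
      using that box_subset_cbox[of a b] by (subst box_bump_eq_0_iff) auto
    have eq: "(\<lambda>x. ?b n x *\<^sub>R ?k x) = (\<lambda>x. ?b n x *\<^sub>R ?f x)" for n
      using z by (auto simp: indicator_def fun_eq_iff)
    have eq2: "(\<lambda>x. indicator (box a b) x *\<^sub>R ?k x) = (\<lambda>x. indicator (box a b) x *\<^sub>R ?f x)"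
      using box_subset_cbox[of a b] by (auto simp: indicator_def fun_eq_iff)
    have "(\<lambda>n. LINT x|lborel. ?b n x *\<^sub>R ?k x) \<longlonglongrightarrow> (LINT x|lborel. indicator (box a b) x *\<^sub>R ?k x)"
    proof (rule integral_dominated_convergence)
      show "integrable lborel (\<lambda>x. norm (?k x))" using ki by (rule integrable_norm)
      show "AE x in lborel. (\<lambda>n. ?b n x *\<^sub>R ?k x) \<longlonglongrightarrow> indicator (box a b) x *\<^sub>R ?k x"
        by (intro AE_I2 tendsto_scaleR box_bump_tendsto tendsto_const)
      have "norm (?b n x *\<^sub>R y) \<le> norm y" for n x and y :: 'a
        using box_bump_bounds[of "real (Suc n)" a b x]
        by (simp del: of_nat_Suc add: mult_left_le_one_le)
      then show "AE x in lborel. norm (?b n x *\<^sub>R ?k x) \<le> norm (?k x)" for n by (intro AE_I2)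
    qed measurable
    moreover have "(LINT x|lborel. ?b n x *\<^sub>R ?k x) = 0" for n
      unfolding eq by (intro test test_function_box_bump that) simp
    ultimately have "(LINT x|lborel. indicator (box a b) x *\<^sub>R ?k x) = 0"
      by (simp only: LIMSEQ_const_iff)
    then show ?thesis unfolding eq2 set_lebesgue_integral_def .
  qed
  have cbox: "AE x in lborel. x \<in> cbox a b \<longrightarrow> g x = h x" if "cbox a b \<subseteq> \<Omega>" for a b
  proof -
    let ?k = "\<lambda>x. indicator (box a b) x *\<^sub>R ?f x"
    have "set_integrable lborel (box a b) ?f"
      by (rule set_integrable_subset[OF fint[OF compact_cbox that]]) (auto simp: box_subset_cbox)
    then have ki: "integrable lborel ?k" by (simp add: set_integrable_def)
    have "AE x in lborel. ?k x = 0"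
    proof (rule integrable_box_integrals_0_imp_AE_0[OF ki])
      show "(LINT x|lborel. ?k x) = 0" using box0[OF that] by (simp add: set_lebesgue_integral_def)
      fix c d :: 'a
      \<comment> \<open>A box intersected with \<open>box a b\<close> is a box again, so the
        integral over it is already known.\<close>
      obtain a' b' where box': "box a b \<inter> box c d = box a' b'" by (simp add: box_Int_box)
      have "(LINT x:box c d|lborel. ?k x) = (LINT x:box a' b'|lborel. ?f x)"
        unfolding set_lebesgue_integral_def box'[symmetric]
        by (intro Bochner_Integration.integral_cong) (auto simp: indicator_def)
      also have "\<dots> = 0"
      \<comment> \<open>The closure of a nonempty open box is the closed one, which therefore stays
        inside \<open>cbox a b\<close>. When \<open>box a' b'\<close> is empty,
        \<open>cbox a' b'\<close> can be nonempty and need not lie in \<Omega>, so this case is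
        treated apart.\<close>
      proof (cases "box a' b' = {}")
        case False
        then have "cbox a' b' = closure (box a' b')" by simp
        also have "\<dots> \<subseteq> closure (box a b)" using box' by (intro closure_mono) auto
        also have "\<dots> \<subseteq> cbox a b" by (rule closure_minimal[OF _ closed_cbox]) (auto simp: box_def cbox_def less_imp_le)
        finally show ?thesis using that by (intro box0) auto
      qed (simp add: set_lebesgue_integral_def)
      finally show "(LINT x:box c d|lborel. ?k x) = 0" .
    qed
    with AE_cbox_boundary[of a b] show ?thesis
      by eventually_elim (auto simp: indicator_def)
  qed
  obtain \<D> where \<D>: "countable \<D>" "\<D> \<subseteq> Pow \<Omega>" "\<And>X. X \<in> \<D> \<Longrightarrow> \<exists>a b. X = cbox a b" "\<Union>\<D> = \<Omega>"
    using open_countable_Union_open_cbox[OF \<open>open \<Omega>\<close>] by metis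
  have "AE x in lborel. \<forall>X\<in>\<D>. x \<in> X \<longrightarrow> g x = h x"
    using \<D>(2,3) cbox by (subst AE_ball_countable[OF \<D>(1)]) blast
  then show ?thesis
    by eventually_elim (use \<D>(4) in blast)
qed

section \<open>The space of limits of test functions\<close>

text \<open>A single sequence of test functions approximates v, and its gradients approximate g,
  over the whole space. Carrying g along avoids the choice hidden in \<open>weak_grad\<close>. As
  test functions vanish outside \<Omega>, v and g vanish there almost everywhere.\<close>

definition H1_pair ::
  "'a::euclidean_space set \<Rightarrow> ('a \<Rightarrow> real) \<Rightarrow> ('a \<Rightarrow> 'a) \<Rightarrow> bool" where
  "H1_pair \<Omega> v g \<longleftrightarrow> L2 v \<and> L2 g \<and> (\<exists>\<phi>. (\<forall>n::nat. test_function \<Omega> (\<phi> n)) \<and>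
     (\<lambda>n. l2 (\<lambda>x. \<phi> n x - v x)) \<longlonglongrightarrow> 0 \<and> (\<lambda>n. l2 (\<lambda>x. grad (\<phi> n) x - g x)) \<longlonglongrightarrow> 0)"

lemma tendsto_0_power2_iff: "(\<lambda>n. (f n)\<^sup>2) \<longlonglongrightarrow> 0 \<longleftrightarrow> f \<longlonglongrightarrow> (0::real)"
proof
  assume "(\<lambda>n. (f n)\<^sup>2) \<longlonglongrightarrow> 0"
  from tendsto_real_sqrt[OF this] show "f \<longlonglongrightarrow> 0"
    by (simp add: tendsto_rabs_zero_iff)
qed (use tendsto_power[of f 0 sequentially 2] in simp)

lemma set_integral_norm_power2_eq_l2:
  assumes "\<And>x. x \<in> \<Omega> \<Longrightarrow> norm (f x) = norm (h x)" "\<And>x. x \<notin> \<Omega> \<Longrightarrow> h x = 0"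
  shows "(LINT x:\<Omega>|lborel. (norm (f x))\<^sup>2) = (l2 h)\<^sup>2"
  unfolding set_lebesgue_integral_def l2_power2 using assms
  by (intro Bochner_Integration.integral_cong) (auto simp: indicator_def)

text \<open>Values of u outside \<Omega> are arbitrary, so the pair is formed with the extension by
  zero. Its gradient is the L2 limit of the Cauchy sequence in the definition of
  \<open>H01\<close>.\<close>

lemma H01_imp_H1_pair:
  fixes u :: "'a::euclidean_space \<Rightarrow> real"
  assumes u: "u \<in> H01 \<Omega>" and \<Omega>: "open \<Omega>" "bounded \<Omega>"
  obtains g where "H1_pair \<Omega> (\<lambda>x. indicator \<Omega> x * u x) g"
proof -
  let ?v = "\<lambda>x. indicator \<Omega> x * u x"
  obtain \<phi> where \<phi>: "\<And>n::nat. test_function \<Omega> (\<phi> n)"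
    and Cauchy: "\<And>\<epsilon>. \<epsilon> > 0 \<Longrightarrow> \<exists>N. \<forall>m\<ge>N. \<forall>n\<ge>N.
           (LINT x:\<Omega>|lborel. (norm (grad (\<phi> m) x - grad (\<phi> n) x))\<^sup>2) < \<epsilon>"
    and lim: "(\<lambda>n. LINT x:\<Omega>|lborel. (\<phi> n x - u x)\<^sup>2) \<longlonglongrightarrow> 0"
    using u by (auto simp: H01_def)
  have v: "L2 ?v"
  proof -
    have "(\<lambda>x. indicator \<Omega> x *\<^sub>R (u x)\<^sup>2) = (\<lambda>x. (?v x)\<^sup>2)"
      by (auto simp: indicator_def fun_eq_iff)
    then show ?thesis
      using u by (simp add: H01_def L2_def set_borel_measurable_def set_integrable_def)
  qed
  have "(LINT x:\<Omega>|lborel. (\<phi> n x - u x)\<^sup>2) = (l2 (\<lambda>x. \<phi> n x - ?v x))\<^sup>2" for n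
    using set_integral_norm_power2_eq_l2[of \<Omega> "\<lambda>x. \<phi> n x - u x" "\<lambda>x. \<phi> n x - ?v x"]
      test_function_outside(1)[OF \<phi>] by (simp add: indicator_def)
  with lim have lim': "(\<lambda>n. l2 (\<lambda>x. \<phi> n x - ?v x)) \<longlonglongrightarrow> 0"
    by (simp add: tendsto_0_power2_iff)
  have eq: "(LINT x:\<Omega>|lborel. (norm (grad (\<phi> m) x - grad (\<phi> n) x))\<^sup>2)
     = (l2 (\<lambda>x. grad (\<phi> m) x - grad (\<phi> n) x))\<^sup>2" for m n
    using test_function_outside(2)[OF \<phi>] by (intro set_integral_norm_power2_eq_l2) auto
  obtain g where "L2 g" "(\<lambda>n. l2 (\<lambda>x. grad (\<phi> n) x - g x)) \<longlonglongrightarrow> 0"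
  proof (rule L2_complete[of "\<lambda>n. grad (\<phi> n)" \<Omega>])
    show "L2 (grad (\<phi> n))" for n using test_function_L2[OF \<phi>] by auto
    show "x \<notin> \<Omega> \<Longrightarrow> grad (\<phi> n) x = 0" for n x using test_function_outside[OF \<phi>] by auto
    show "\<Omega> \<in> sets borel" "emeasure lborel \<Omega> < \<infinity>"
      using \<Omega> emeasure_bounded_finite by auto
    fix e :: real assume "e > 0"
    then obtain N where N: "\<And>m n. m \<ge> N \<Longrightarrow> n \<ge> N \<Longrightarrow> (l2 (\<lambda>x. grad (\<phi> m) x - grad (\<phi> n) x))\<^sup>2 < e\<^sup>2"
      using Cauchy[of "e\<^sup>2"] unfolding eq by (meson zero_less_power)
    have "l2 (\<lambda>x. grad (\<phi> m) x - grad (\<phi> n) x) < e" if "m \<ge> N" "n \<ge> N" for m n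
      using N[OF that] by (rule power_less_imp_less_base) (use \<open>e > 0\<close> in simp)
    then show "\<exists>N. \<forall>m\<ge>N. \<forall>n\<ge>N. l2 (\<lambda>x. grad (\<phi> m) x - grad (\<phi> n) x) < e" by blast
  qed
  with v lim' \<phi> have "H1_pair \<Omega> ?v g" unfolding H1_pair_def by blast
  with that show ?thesis by blast
qed

lemma H01_limitI:
  assumes \<phi>: "\<And>n::nat. test_function \<Omega> (\<phi> n)" and v: "L2 v" "\<And>x. x \<notin> \<Omega> \<Longrightarrow> v x = 0"
    and lim: "(\<lambda>n. l2 (\<lambda>x. \<phi> n x - v x)) \<longlonglongrightarrow> 0"
    and Cauchy: "\<And>e. e > 0 \<Longrightarrow> \<exists>N. \<forall>m\<ge>N. \<forall>n\<ge>N. l2 (\<lambda>x. grad (\<phi> m) x - grad (\<phi> n) x) < e"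
  shows "v \<in> H01 \<Omega>"
proof -
  have ind: "(\<lambda>x. indicator \<Omega> x * v x) = v" "(\<lambda>x. indicator \<Omega> x * (v x)\<^sup>2) = (\<lambda>x. (v x)\<^sup>2)"
    using v(2) by (auto simp: indicator_def fun_eq_iff)
  have "(LINT x:\<Omega>|lborel. (\<phi> n x - v x)\<^sup>2) = (l2 (\<lambda>x. \<phi> n x - v x))\<^sup>2" for n
    using set_integral_norm_power2_eq_l2[of \<Omega> "\<lambda>x. \<phi> n x - v x" "\<lambda>x. \<phi> n x - v x"]
      test_function_outside(1)[OF \<phi>] v(2) by simp
  with lim have 1: "(\<lambda>n. LINT x:\<Omega>|lborel. (\<phi> n x - v x)\<^sup>2) \<longlonglongrightarrow> 0"
    by (simp add: tendsto_0_power2_iff)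
  have eq: "(LINT x:\<Omega>|lborel. (norm (grad (\<phi> m) x - grad (\<phi> n) x))\<^sup>2)
     = (l2 (\<lambda>x. grad (\<phi> m) x - grad (\<phi> n) x))\<^sup>2" for m n
    using test_function_outside(2)[OF \<phi>] by (intro set_integral_norm_power2_eq_l2) auto
  have 2: "\<exists>N. \<forall>m\<ge>N. \<forall>n\<ge>N. (LINT x:\<Omega>|lborel. (norm (grad (\<phi> m) x - grad (\<phi> n) x))\<^sup>2) < \<epsilon>"
    if "\<epsilon> > 0" for \<epsilon>
  proof -
    obtain N where N: "\<And>m n. m \<ge> N \<Longrightarrow> n \<ge> N \<Longrightarrow> l2 (\<lambda>x. grad (\<phi> m) x - grad (\<phi> n) x) < sqrt \<epsilon>"
      using Cauchy[of "sqrt \<epsilon>"] \<open>\<epsilon> > 0\<close> by (metis real_sqrt_gt_zero)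
    have "(l2 (\<lambda>x. grad (\<phi> m) x - grad (\<phi> n) x))\<^sup>2 < \<epsilon>" if "m \<ge> N" "n \<ge> N" for m n
      using power_strict_mono[OF N[OF that], of 2] \<open>\<epsilon> > 0\<close> by simp
    then show ?thesis unfolding eq by blast
  qed
  show ?thesis
    using v(1) \<phi> 1 2 unfolding H01_def
    by (auto simp: L2_def set_borel_measurable_def set_integrable_def ind intro!: exI[of _ \<phi>])
qed

lemma H1_pair_imp_H01:
  assumes "H1_pair \<Omega> v g" "\<And>x. x \<notin> \<Omega> \<Longrightarrow> v x = 0"
  shows "v \<in> H01 \<Omega>"
proof -
  obtain \<phi> where p: "L2 v" "L2 g" "\<And>n::nat. test_function \<Omega> (\<phi> n)"
    "(\<lambda>n. l2 (\<lambda>x. \<phi> n x - v x)) \<longlonglongrightarrow> 0" "(\<lambda>n. l2 (\<lambda>x. grad (\<phi> n) x - g x)) \<longlonglongrightarrow> 0"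
    using assms(1) unfolding H1_pair_def by blast
  note L = test_function_L2(2)[OF p(3)]
  show ?thesis
  proof (rule H01_limitI[OF p(3) p(1) assms(2) p(4)])
    fix e :: real assume "e > 0"
    then obtain N where N: "\<And>n. n \<ge> N \<Longrightarrow> l2 (\<lambda>x. grad (\<phi> n) x - g x) < e / 2"
      using LIMSEQ_D[OF p(5), of "e / 2"] by auto
    have "l2 (\<lambda>x. grad (\<phi> m) x - grad (\<phi> n) x) < e" if "m \<ge> N" "n \<ge> N" for m n
      using l2_diff_triangle[OF L p(2) L, of m n] N[OF that(1)] N[OF that(2)]
        l2_diff_commute[of g "grad (\<phi> n)"] by linarith
    then show "\<exists>N. \<forall>m\<ge>N. \<forall>n\<ge>N. l2 (\<lambda>x. grad (\<phi> m) x - grad (\<phi> n) x) < e" by blast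
  qed auto
qed

text \<open>Integration by parts holds for each approximating test function, and both sides are
  continuous in L2 by Cauchy-Schwarz.\<close>

lemma H1_pair_has_weak_gradient:
  fixes u :: "'a::euclidean_space \<Rightarrow> real"
  assumes p: "H1_pair \<Omega> v g" and \<Omega>: "open \<Omega>" and u: "\<And>x. x \<in> \<Omega> \<Longrightarrow> u x = v x"
  shows "has_weak_gradient \<Omega> u g"
proof -
  obtain \<phi> where p: "L2 v" "L2 g" "\<And>n::nat. test_function \<Omega> (\<phi> n)"
    "(\<lambda>n. l2 (\<lambda>x. \<phi> n x - v x)) \<longlonglongrightarrow> 0" "(\<lambda>n. l2 (\<lambda>x. grad (\<phi> n) x - g x)) \<longlonglongrightarrow> 0"
    using p unfolding H1_pair_def by blast
  show ?thesis
    unfolding has_weak_gradient_def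
  proof (intro conjI allI impI; (elim conjE)?)
    fix K assume K: "compact K" "K \<subseteq> \<Omega>"
    then have Kb: "K \<in> sets borel" "emeasure lborel K < \<infinity>"
      using emeasure_compact_finite by (auto simp: borel_compact)
    show "set_integrable lborel K g" using L2_set_integrable(1)[OF p(2) Kb] .
    have "set_integrable lborel K v" using L2_set_integrable(1)[OF p(1) Kb] .
    also have "set_integrable lborel K v = set_integrable lborel K u"
      using K(2) u by (intro set_integrable_cong) auto
    finally show "set_integrable lborel K u" .
  next
    fix \<psi> assume \<psi>: "test_function \<Omega> \<psi>"
    note \<psi>L = test_function_L2[OF \<psi>]
    note \<phi>L = test_function_L2[OF p(3)]
    have eq1: "(LINT x:\<Omega>|lborel. u x *\<^sub>R grad \<psi> x) = (LINT x|lborel. v x *\<^sub>R grad \<psi> x)"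
      unfolding set_lebesgue_integral_def using u test_function_outside(2)[OF \<psi>]
      by (intro Bochner_Integration.integral_cong) (auto simp: indicator_def)
    have eq2: "(LINT x:\<Omega>|lborel. \<psi> x *\<^sub>R g x) = (LINT x|lborel. \<psi> x *\<^sub>R g x)"
      unfolding set_lebesgue_integral_def using test_function_outside(1)[OF \<psi>]
      by (intro Bochner_Integration.integral_cong) (auto simp: indicator_def)
    have parts: "(LINT x|lborel. \<phi> n x *\<^sub>R grad \<psi> x) = - (LINT x|lborel. \<psi> x *\<^sub>R grad (\<phi> n) x)" for n
      using test_function_C1_compact[OF p(3)] test_function_C1_compact[OF \<psi>]
        C1_compact_integration_by_parts by metis
    have "(\<lambda>n. (LINT x|lborel. \<phi> n x *\<^sub>R grad \<psi> x) - (LINT x|lborel. v x *\<^sub>R grad \<psi> x)) \<longlonglongrightarrow> 0"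
    proof (rule Lim_null_comparison)
      show "(\<lambda>n. l2 (\<lambda>x. \<phi> n x - v x) * l2 (grad \<psi>)) \<longlonglongrightarrow> 0"
        using tendsto_mult_left_zero[OF p(4)] .
      have "(LINT x|lborel. \<phi> n x *\<^sub>R grad \<psi> x) - (LINT x|lborel. v x *\<^sub>R grad \<psi> x)
        = (LINT x|lborel. (\<phi> n x - v x) *\<^sub>R grad \<psi> x)" for n
        using L2_integrable_scaleR(1)[OF \<phi>L(1) \<psi>L(2)] L2_integrable_scaleR(1)[OF p(1) \<psi>L(2)]
        by (simp add: scaleR_diff_left)
      then show "\<forall>\<^sub>F n in sequentially. norm ((LINT x|lborel. \<phi> n x *\<^sub>R grad \<psi> x) - (LINT x|lborel. v x *\<^sub>R grad \<psi> x))
          \<le> l2 (\<lambda>x. \<phi> n x - v x) * l2 (grad \<psi>)"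
        using L2_integrable_scaleR(2)[OF L2_diff[OF \<phi>L(1) p(1)] \<psi>L(2)] by simp
    qed
    then have lim1: "(\<lambda>n. (LINT x|lborel. \<phi> n x *\<^sub>R grad \<psi> x)) \<longlonglongrightarrow> (LINT x|lborel. v x *\<^sub>R grad \<psi> x)"
      by (rule LIM_zero_cancel)
    have "(\<lambda>n. (LINT x|lborel. \<psi> x *\<^sub>R grad (\<phi> n) x) - (LINT x|lborel. \<psi> x *\<^sub>R g x)) \<longlonglongrightarrow> 0"
    proof (rule Lim_null_comparison)
      show "(\<lambda>n. l2 \<psi> * l2 (\<lambda>x. grad (\<phi> n) x - g x)) \<longlonglongrightarrow> 0"
        using tendsto_mult_right_zero[OF p(5)] .
      have "(LINT x|lborel. \<psi> x *\<^sub>R grad (\<phi> n) x) - (LINT x|lborel. \<psi> x *\<^sub>R g x)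
        = (LINT x|lborel. \<psi> x *\<^sub>R (grad (\<phi> n) x - g x))" for n
        using L2_integrable_scaleR(1)[OF \<psi>L(1) \<phi>L(2)] L2_integrable_scaleR(1)[OF \<psi>L(1) p(2)]
        by (simp add: scaleR_diff_right)
      then show "\<forall>\<^sub>F n in sequentially. norm ((LINT x|lborel. \<psi> x *\<^sub>R grad (\<phi> n) x) - (LINT x|lborel. \<psi> x *\<^sub>R g x))
          \<le> l2 \<psi> * l2 (\<lambda>x. grad (\<phi> n) x - g x)"
        using L2_integrable_scaleR(2)[OF \<psi>L(1) L2_diff[OF \<phi>L(2) p(2)]] by simp
    qed
    then have lim2: "(\<lambda>n. (LINT x|lborel. \<psi> x *\<^sub>R grad (\<phi> n) x)) \<longlonglongrightarrow> (LINT x|lborel. \<psi> x *\<^sub>R g x)"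
      by (rule LIM_zero_cancel)
    show "(LINT x:\<Omega>|lborel. u x *\<^sub>R grad \<psi> x) = - (LINT x:\<Omega>|lborel. \<psi> x *\<^sub>R g x)"
      using LIMSEQ_unique[OF lim1[unfolded parts] tendsto_minus[OF lim2]] unfolding eq1 eq2 .
  qed
qed

text \<open>\<open>weak_grad\<close> is some weak gradient, hence equal to g almost everywhere in
  \<Omega>. It remains to settle the measurability of the chosen function and the values of g
  outside \<Omega>.\<close>

lemma H1_pair_energy:
  fixes u :: "'a::euclidean_space \<Rightarrow> real"
  assumes p: "H1_pair \<Omega> v g" and \<Omega>: "open \<Omega>" and u: "\<And>x. x \<in> \<Omega> \<Longrightarrow> u x = v x"
  shows "dirichlet_energy \<Omega> u = (l2 g)\<^sup>2"
proof -
  define w where "w = weak_grad \<Omega> u"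
  have g: "has_weak_gradient \<Omega> u g" using p \<Omega> u by (rule H1_pair_has_weak_gradient)
  then have w: "has_weak_gradient \<Omega> u w" unfolding w_def weak_grad_def by (rule someI[of "has_weak_gradient \<Omega> u"])
  have AE: "AE x in lborel. x \<in> \<Omega> \<longrightarrow> g x = w x" using \<Omega> g w by (rule weak_gradient_unique)
  \<comment> \<open>A weak gradient is only known to be integrable on compact subsets; measurability
    on all of \<Omega> comes from the limit along a compact exhaustion.\<close>
  obtain C where C: "\<And>n::nat. compact (C n)" "\<And>n. C n \<subseteq> \<Omega>" "\<And>n. C n \<subseteq> interior (C (Suc n))" "\<Union> (range C) = \<Omega>"
    using open_Union_compact_subsets[OF \<Omega>] by metis
  have mono: "C m \<subseteq> C n" if "m \<le> n" for m n
    using that by (rule lift_Suc_mono_le[rotated]) (use C(3) interior_subset in blast)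
  have wm: "(\<lambda>x. indicator \<Omega> x *\<^sub>R w x) \<in> borel_measurable borel"
  proof (rule borel_measurable_LIMSEQ_metric)
    show "(\<lambda>x. indicator (C n) x *\<^sub>R w x) \<in> borel_measurable borel" for n
      using w C(1,2)[of n] borel_measurable_integrable
      unfolding has_weak_gradient_def set_integrable_def by force
    fix x :: 'a
    show "(\<lambda>n. indicator (C n) x *\<^sub>R w x) \<longlonglongrightarrow> indicator \<Omega> x *\<^sub>R w x"
    proof (cases "x \<in> \<Omega>")
      case True
      then obtain N where "x \<in> C N" using C(4) by auto
      then have "\<forall>\<^sub>F n in sequentially. indicator (C n) x *\<^sub>R w x = w x"
        using mono by (intro eventually_sequentiallyI[of N]) (auto simp: indicator_def)
      with True show ?thesis by (simp add: tendsto_eventually)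
    next
      case False
      then have "x \<notin> C n" for n using C(2) by auto
      with False show ?thesis by simp
    qed
  qed
  obtain \<phi> where q: "L2 v" "L2 g" "\<And>n::nat. test_function \<Omega> (\<phi> n)"
    "(\<lambda>n. l2 (\<lambda>x. \<phi> n x - v x)) \<longlonglongrightarrow> 0" "(\<lambda>n. l2 (\<lambda>x. grad (\<phi> n) x - g x)) \<longlonglongrightarrow> 0"
    using p unfolding H1_pair_def by blast
  \<comment> \<open>Gradients of test functions vanish outside \<Omega>, and an almost everywhere
    convergent subsequence passes this on to g.\<close>
  obtain r where "AE x in lborel. (\<lambda>n. grad (\<phi> (r n)) x) \<longlonglongrightarrow> g x"
    using L2_AE_subseq[OF test_function_L2(2)[OF q(3)] q(2) q(5)] by metis
  then have out: "AE x in lborel. x \<notin> \<Omega> \<longrightarrow> g x = 0"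
  proof eventually_elim
    case (elim x)
    show ?case
    proof
      assume "x \<notin> \<Omega>"
      with elim have "(\<lambda>n. 0) \<longlonglongrightarrow> g x"
        by (simp add: test_function_outside(2)[OF q(3)])
      then show "g x = 0" by (simp add: LIMSEQ_const_iff)
    qed
  qed
  have "AE x in lborel. g x = indicator \<Omega> x *\<^sub>R w x"
    using AE out by eventually_elim (auto simp: indicator_def)
  from L2_cong_AE(2)[OF q(2) wm this] show ?thesis
    unfolding dirichlet_energy_def w_def[symmetric]
    by (subst set_integral_norm_power2_eq_l2[of _ _ "\<lambda>x. indicator \<Omega> x *\<^sub>R w x"]) auto
qed

lemma H1_pair_scaleR:
  assumes "H1_pair \<Omega> v g"
  shows "H1_pair \<Omega> (\<lambda>x. c * v x) (\<lambda>x. c *\<^sub>R g x)"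
proof -
  obtain \<phi> where p: "L2 v" "L2 g" "\<And>n::nat. test_function \<Omega> (\<phi> n)"
    "(\<lambda>n. l2 (\<lambda>x. \<phi> n x - v x)) \<longlonglongrightarrow> 0" "(\<lambda>n. l2 (\<lambda>x. grad (\<phi> n) x - g x)) \<longlonglongrightarrow> 0"
    using assms unfolding H1_pair_def by blast
  have "l2 (\<lambda>x. c * \<phi> n x - c * v x) = \<bar>c\<bar> * l2 (\<lambda>x. \<phi> n x - v x)" for n
    using l2_scaleR[of c "\<lambda>x. \<phi> n x - v x"] by (simp add: right_diff_distrib)
  moreover have "l2 (\<lambda>x. grad (\<lambda>x. c * \<phi> n x) x - c *\<^sub>R g x) = \<bar>c\<bar> * l2 (\<lambda>x. grad (\<phi> n) x - g x)" for n
    using l2_scaleR[of c "\<lambda>x. grad (\<phi> n) x - g x"] by (simp add: grad_scale[OF p(3)] scaleR_diff_right)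
  ultimately show ?thesis
    using p L2_scaleR[of v c] L2_scaleR[of g c] unfolding H1_pair_def
    by (intro conjI exI[of _ "\<lambda>n x. c * \<phi> n x"])
      (auto intro!: test_function_scale tendsto_mult_right_zero)
qed

lemma H1_pair_add:
  assumes "H1_pair \<Omega> v g" "H1_pair \<Omega> w h"
  shows "H1_pair \<Omega> (\<lambda>x. v x + w x) (\<lambda>x. g x + h x)"
proof -
  obtain \<phi> where p: "L2 v" "L2 g" "\<And>n::nat. test_function \<Omega> (\<phi> n)"
    "(\<lambda>n. l2 (\<lambda>x. \<phi> n x - v x)) \<longlonglongrightarrow> 0" "(\<lambda>n. l2 (\<lambda>x. grad (\<phi> n) x - g x)) \<longlonglongrightarrow> 0"
    using assms(1) unfolding H1_pair_def by blast
  obtain \<psi> where q: "L2 w" "L2 h" "\<And>n::nat. test_function \<Omega> (\<psi> n)"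
    "(\<lambda>n. l2 (\<lambda>x. \<psi> n x - w x)) \<longlonglongrightarrow> 0" "(\<lambda>n. l2 (\<lambda>x. grad (\<psi> n) x - h x)) \<longlonglongrightarrow> 0"
    using assms(2) unfolding H1_pair_def by blast
  note pL = test_function_L2[OF p(3)] and qL = test_function_L2[OF q(3)]
  have "(\<lambda>n. l2 (\<lambda>x. (\<phi> n x + \<psi> n x) - (v x + w x))) \<longlonglongrightarrow> 0"
  proof (rule Lim_null_comparison)
    show "(\<lambda>n. l2 (\<lambda>x. \<phi> n x - v x) + l2 (\<lambda>x. \<psi> n x - w x)) \<longlonglongrightarrow> 0"
      using tendsto_add[OF p(4) q(4)] by simp
    show "\<forall>\<^sub>F n in sequentially. norm (l2 (\<lambda>x. (\<phi> n x + \<psi> n x) - (v x + w x)))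
        \<le> l2 (\<lambda>x. \<phi> n x - v x) + l2 (\<lambda>x. \<psi> n x - w x)"
      using l2_triangle[OF L2_diff[OF pL(1) p(1)] L2_diff[OF qL(1) q(1)]]
      by (simp add: add_diff_add)
  qed
  moreover have "(\<lambda>n. l2 (\<lambda>x. grad (\<lambda>x. \<phi> n x + \<psi> n x) x - (g x + h x))) \<longlonglongrightarrow> 0"
    unfolding grad_add[OF p(3) q(3)]
  proof (rule Lim_null_comparison)
    show "(\<lambda>n. l2 (\<lambda>x. grad (\<phi> n) x - g x) + l2 (\<lambda>x. grad (\<psi> n) x - h x)) \<longlonglongrightarrow> 0"
      using tendsto_add[OF p(5) q(5)] by simp
    show "\<forall>\<^sub>F n in sequentially. norm (l2 (\<lambda>x. (grad (\<phi> n) x + grad (\<psi> n) x) - (g x + h x)))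
        \<le> l2 (\<lambda>x. grad (\<phi> n) x - g x) + l2 (\<lambda>x. grad (\<psi> n) x - h x)"
      using l2_triangle[OF L2_diff[OF pL(2) p(2)] L2_diff[OF qL(2) q(2)]]
      by (simp add: add_diff_add)
  qed
  ultimately show ?thesis
    using p q L2_add[of v w] L2_add[of g h] unfolding H1_pair_def
    by (intro conjI exI[of _ "\<lambda>n x. \<phi> n x + \<psi> n x"]) (auto intro!: test_function_add)
qed

lemma H1_pair_diff:
  assumes "H1_pair \<Omega> v g" "H1_pair \<Omega> w h"
  shows "H1_pair \<Omega> (\<lambda>x. v x - w x) (\<lambda>x. g x - h x)"
  using H1_pair_add[OF assms(1) H1_pair_scaleR[OF assms(2), of "-1"]] by simp

section \<open>Rotations and circular means\<close>

definition perp :: "real^2 \<Rightarrow> real^2" where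
  "perp x = vector [- x$2, x$1]"

definition rot :: "real \<Rightarrow> real^2 \<Rightarrow> real^2" where
  "rot t x = cos t *\<^sub>R x + sin t *\<^sub>R perp x"

lemma perp_nth [simp]: "perp x $ 1 = - x$2" "perp x $ 2 = x$1"
  by (simp_all add: perp_def)

lemma rot_nth [simp]: "rot t x $ 1 = cos t * x$1 - sin t * x$2" "rot t x $ 2 = cos t * x$2 + sin t * x$1"
  by (simp_all add: rot_def)

lemma norm_real2_power2: "(norm (x::real^2))\<^sup>2 = (x$1)\<^sup>2 + (x$2)\<^sup>2"
  by (simp add: norm_vec_def L2_set_def sum_2)

lemma linear_perp: "linear perp"
  by (rule linearI) (simp_all add: vec_eq_iff forall_2)

lemma continuous_on_perp [continuous_intros]:
  fixes f :: "'a::euclidean_space \<Rightarrow> real^2"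
  shows "continuous_on S f \<Longrightarrow> continuous_on S (\<lambda>x. perp (f x))"
  using linear_continuous_on_compose[OF _ linear_perp] .

text \<open>Serves twice: with coefficients cos and sin for the length of \<open>rot t x\<close>,
  and with - sin and cos for the speed of the rotation flow, which is the norm of x.\<close>

lemma norm_circle_combination:
  assumes "c\<^sup>2 + s\<^sup>2 = 1"
  shows "norm (c *\<^sub>R x + s *\<^sub>R perp x) = norm x"
proof (rule power2_eq_imp_eq)
  have "(norm (c *\<^sub>R x + s *\<^sub>R perp x))\<^sup>2 = (c\<^sup>2 + s\<^sup>2) * (norm x)\<^sup>2"
    unfolding norm_real2_power2 by (simp add: power2_eq_square algebra_simps)
  then show "(norm (c *\<^sub>R x + s *\<^sub>R perp x))\<^sup>2 = (norm x)\<^sup>2"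
    using assms by simp
qed auto

lemma norm_rot [simp]: "norm (rot t x) = norm x"
  unfolding rot_def by (rule norm_circle_combination) simp

lemma linear_rot: "linear (rot t)"
  by (rule linearI) (simp_all add: vec_eq_iff forall_2 algebra_simps)

lemma rot_rot: "rot s (rot t x) = rot (s + t) x"
  by (simp add: vec_eq_iff forall_2 cos_add sin_add algebra_simps)

lemma rot_0 [simp]: "rot 0 x = x"
  by (simp add: rot_def)

lemma rot_2pi: "rot (t + 2 * pi) x = rot t x"
  by (simp add: rot_def)

lemma continuous_on_rot: "continuous_on UNIV (\<lambda>p. rot (fst p) (snd p))"
  unfolding rot_def by (intro continuous_intros)

lemma rot_measurable [measurable]:
  "(\<lambda>p. rot (fst p) (snd p)) \<in> borel_measurable (borel \<Otimes>\<^sub>M borel)"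
  "(\<lambda>p. rot (snd p) (fst p)) \<in> borel_measurable (borel \<Otimes>\<^sub>M borel)"
  "rot t \<in> borel_measurable borel" "(\<lambda>t. rot t x) \<in> borel_measurable borel"
proof -
  show "(\<lambda>p. rot (fst p) (snd p)) \<in> borel_measurable (borel \<Otimes>\<^sub>M borel)"
    using borel_measurable_continuous_onI[OF continuous_on_rot] by (simp add: borel_prod)
  have "continuous_on UNIV (\<lambda>p. rot (snd p) (fst p))"
    unfolding rot_def by (intro continuous_intros)
  from borel_measurable_continuous_onI[OF this]
  show "(\<lambda>p. rot (snd p) (fst p)) \<in> borel_measurable (borel \<Otimes>\<^sub>M borel)"
    by (simp add: borel_prod)
  have "continuous_on UNIV (\<lambda>x. rot t x)" "continuous_on UNIV (\<lambda>t. rot t x)"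
    unfolding rot_def by (intro continuous_intros)+
  then show "rot t \<in> borel_measurable borel" "(\<lambda>t. rot t x) \<in> borel_measurable borel"
    by (auto intro: borel_measurable_continuous_onI)
qed

text \<open>The preimage of a box is its image under the inverse rotation, orthogonal maps preserve
  Lebesgue measure, and boxes determine \<open>lborel\<close>.\<close>

lemma measure_preserving_rot: "measure_preserving (rot t)"
  unfolding measure_preserving_def
proof
  show "rot t \<in> borel_measurable borel" by measurable
  show "distr lborel borel (rot t) = lborel"
  proof (rule lborel_eqI[symmetric])
    fix l u :: "real^2" assume le: "\<And>b. b \<in> Basis \<Longrightarrow> l \<bullet> b \<le> u \<bullet> b"
    have ot: "orthogonal_transformation (rot (- t))"
      by (simp add: orthogonal_transformation linear_rot)
    have lm: "box l u \<in> lmeasurable" by simp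
    have eq: "rot t -` box l u = rot (- t) ` box l u"
    proof safe
      fix x assume "rot t x \<in> box l u"
      then show "x \<in> rot (- t) ` box l u"
        by (intro image_eqI[of _ _ "rot t x"]) (simp_all add: rot_rot)
    qed (simp add: rot_rot)
    have m: "rot t -` box l u \<in> sets borel"
      using measurable_sets[of "rot t" borel borel "box l u"] by simp
    have "emeasure (distr lborel borel (rot t)) (box l u) = emeasure lborel (rot t -` box l u)"
      by (subst emeasure_distr) auto
    also have "\<dots> = emeasure lebesgue (rot t -` box l u)"
      using m by simp
    also have "\<dots> = ennreal (measure lebesgue (rot t -` box l u))"
      unfolding eq using measurable_orthogonal_image[OF ot lm] by (simp add: emeasure_eq_measure2)
    also have "measure lebesgue (rot t -` box l u) = measure lebesgue (box l u)"
      unfolding eq by (rule measure_orthogonal_image[OF ot lm])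
    also have "ennreal \<dots> = (\<Prod>b\<in>Basis. (u - l) \<bullet> b)"
      using le by (simp add: measure_lborel_box_eq)
    finally show "emeasure (distr lborel borel (rot t)) (box l u) = (\<Prod>b\<in>Basis. (u - l) \<bullet> b)" .
  qed simp
qed

text \<open>A substitute for the norm that is smooth at the origin and at least e, so that dividing
  by it preserves differentiability and square integrability. It lies above the norm, hence bounds
  the speed of rotations, and tends to the norm as e tends to 0.\<close>

definition soft_norm :: "real \<Rightarrow> real^2 \<Rightarrow> real" where
  "soft_norm e x = sqrt ((norm x)\<^sup>2 + e\<^sup>2)"

lemma soft_norm_pos: "e > 0 \<Longrightarrow> soft_norm e x > 0"
  by (simp add: soft_norm_def add_nonneg_pos)

lemma norm_le_soft_norm: "norm x \<le> soft_norm e x"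
  unfolding soft_norm_def by (rule real_le_rsqrt) simp

lemma soft_norm_ge: "e > 0 \<Longrightarrow> e \<le> soft_norm e x"
  unfolding soft_norm_def by (rule real_le_rsqrt) simp

lemma continuous_on_soft_norm [continuous_intros]: "continuous_on S (soft_norm e)"
  unfolding soft_norm_def by (intro continuous_intros)

lemma soft_norm_measurable [measurable]: "soft_norm e \<in> borel_measurable borel"
  by (rule borel_measurable_continuous_onI[OF continuous_on_soft_norm])

text \<open>Fatou's lemma along an almost everywhere convergent subsequence. Preimages of null sets
  under T are null, so the subsequence also converges at T x for almost every x.\<close>

lemma H1_pair_difference_estimate:
  fixes v :: "'a::euclidean_space \<Rightarrow> real"
  assumes p: "H1_pair \<Omega> v g" and T: "measure_preserving T" and [measurable]: "\<sigma> \<in> borel_measurable borel"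
    and est: "\<And>\<phi>. test_function \<Omega> \<phi> \<Longrightarrow>
      (\<integral>\<^sup>+x. ennreal ((\<phi> (T x) - \<phi> x)\<^sup>2 / (\<sigma> x)\<^sup>2) \<partial>lborel) \<le> ennreal (c\<^sup>2 * (l2 (grad \<phi>))\<^sup>2)"
  shows "(\<integral>\<^sup>+x. ennreal ((v (T x) - v x)\<^sup>2 / (\<sigma> x)\<^sup>2) \<partial>lborel) \<le> ennreal (c\<^sup>2 * (l2 g)\<^sup>2)"
proof -
  obtain \<phi> where q: "L2 v" "L2 g" "\<And>n::nat. test_function \<Omega> (\<phi> n)"
    "(\<lambda>n. l2 (\<lambda>x. \<phi> n x - v x)) \<longlonglongrightarrow> 0" "(\<lambda>n. l2 (\<lambda>x. grad (\<phi> n) x - g x)) \<longlonglongrightarrow> 0"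
    using p unfolding H1_pair_def by blast
  note L = test_function_L2[OF q(3)]
  have [measurable]: "\<phi> n \<in> borel_measurable borel" "T \<in> borel_measurable borel" "v \<in> borel_measurable borel" for n
    using L(1) T q(1) by (auto simp: L2_def measure_preserving_def)
  obtain r where r: "strict_mono r" and AE: "AE x in lborel. (\<lambda>n. \<phi> (r n) x) \<longlonglongrightarrow> v x"
    using L2_AE_subseq[OF L(1) q(1) q(4)] by metis
  show ?thesis
  proof (rule nn_integral_le_AE_limit)
    show "AE x in lborel. (\<lambda>n. ennreal ((\<phi> (r n) (T x) - \<phi> (r n) x)\<^sup>2 / (\<sigma> x)\<^sup>2))
        \<longlonglongrightarrow> ennreal ((v (T x) - v x)\<^sup>2 / (\<sigma> x)\<^sup>2)"
      using AE measure_preserving_AE[OF T AE]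
    proof eventually_elim
      case (elim x)
      show ?case unfolding divide_inverse by (intro tendsto_ennrealI tendsto_intros elim)
    qed
    show "(\<integral>\<^sup>+x. ennreal ((\<phi> (r n) (T x) - \<phi> (r n) x)\<^sup>2 / (\<sigma> x)\<^sup>2) \<partial>lborel)
        \<le> ennreal (c\<^sup>2 * (l2 (grad (\<phi> (r n))))\<^sup>2)" for n
      by (rule est[OF q(3)])
    show "(\<lambda>n. ennreal (c\<^sup>2 * (l2 (grad (\<phi> (r n))))\<^sup>2)) \<longlonglongrightarrow> ennreal (c\<^sup>2 * (l2 g)\<^sup>2)"
      using LIMSEQ_subseq_LIMSEQ[OF l2_tendsto[OF L(2) q(2) q(5)] r]
      by (intro tendsto_ennrealI tendsto_mult tendsto_power tendsto_const) (simp add: o_def)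
  qed measurable
qed

text \<open>A rotation orbit is traversed with speed \<open>norm x\<close>, which
  \<open>soft_norm e x\<close> dominates; unlike the norm it is positive at the origin too, as a
  speed bound has to be.\<close>

lemma rotation_difference_estimate:
  assumes p: "H1_pair \<Omega> v g" and "e > 0" "0 \<le> t"
  shows "(\<integral>\<^sup>+x. ennreal ((v (rot t x) - v x)\<^sup>2 / (soft_norm e x)\<^sup>2) \<partial>lborel) \<le> ennreal (t\<^sup>2 * (l2 g)\<^sup>2)"
proof (rule H1_pair_difference_estimate[OF p measure_preserving_rot soft_norm_measurable])
  fix \<phi> assume "test_function \<Omega> \<phi>"
  then obtain K where C: "C1_compact \<phi> (grad \<phi>) K"
    by (rule test_function_C1_compact)
  have "(\<integral>\<^sup>+x. ennreal ((\<phi> (rot t x) - \<phi> (rot 0 x))\<^sup>2 / (soft_norm e x)\<^sup>2) \<partial>lborel) \<le> ennreal (t\<^sup>2 * (l2 (grad \<phi>))\<^sup>2)"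
  proof (rule flow_difference_estimate[OF C measure_preserving_rot continuous_on_rot])
    show "((\<lambda>s. rot s x) has_vector_derivative (- sin s *\<^sub>R x + cos s *\<^sub>R perp x)) (at s)" for s x
      unfolding rot_def by (auto intro!: derivative_eq_intros)
    show "continuous_on UNIV (\<lambda>s. - sin s *\<^sub>R x + cos s *\<^sub>R perp x)" for x
      by (intro continuous_intros)
    show "norm (- sin s *\<^sub>R x + cos s *\<^sub>R perp x) \<le> soft_norm e x" for s x
      using norm_circle_combination[of "- sin s" "cos s" x] norm_le_soft_norm[of x e] by simp
  qed (use soft_norm_pos assms in auto)
  then show "(\<integral>\<^sup>+x. ennreal ((\<phi> (rot t x) - \<phi> x)\<^sup>2 / (soft_norm e x)\<^sup>2) \<partial>lborel) \<le> ennreal (t\<^sup>2 * (l2 (grad \<phi>))\<^sup>2)"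
    by simp
qed

text \<open>The integral over the angle, without the factor 1/(2 pi), as a function of the point
  instead of the radius. In this form zero means combine directly with the invariance of the measure
  under rotations; polar coordinates serve only the comparison with
  \<open>zero_circular_means\<close>.\<close>

definition rot_mean :: "(real^2 \<Rightarrow> real) \<Rightarrow> real^2 \<Rightarrow> real" where
  "rot_mean v x = (LINT t:{0..2*pi}|lborel. v (rot t x))"

definition rot_mean_zero :: "(real^2 \<Rightarrow> real) \<Rightarrow> bool" where
  "rot_mean_zero v \<longleftrightarrow> (AE x in lborel. rot_mean v x = 0)"

text \<open>When the integral over the circle vanishes, \<open>2 * pi * v x\<close> is minus the
  integral of \<open>v (rot t x) - v x\<close> over the angle, and Cauchy-Schwarz on the angle
  interval gives the bound.\<close>

lemma rot_mean_zero_pointwise: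
  assumes [measurable]: "v \<in> borel_measurable borel" and zero: "rot_mean v x = 0"
  shows "ennreal ((v x)\<^sup>2) \<le> ennreal (1 / (2 * pi)) *
    (\<integral>\<^sup>+t. ennreal (indicator {0..2*pi} t) * ennreal ((v (rot t x) - v x)\<^sup>2) \<partial>lborel)"
    (is "_ \<le> _ * ?J")
proof (cases "?J = \<infinity>")
  case True
  then show ?thesis by (simp add: ennreal_mult_top)
next
  case False
  define k where "k t = indicator {0..2*pi} t * (v (rot t x) - v x)" for t
  have [measurable]: "k \<in> borel_measurable borel" unfolding k_def by measurable
  have Jk: "?J = (\<integral>\<^sup>+t. ennreal ((norm (k t))\<^sup>2) \<partial>lborel)"
    by (intro nn_integral_cong) (auto simp: k_def indicator_def)
  obtain j where j: "j \<ge> 0" "?J = ennreal j"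
    using False by (cases ?J) auto
  have k: "L2 k" "l2 k \<le> sqrt j"
    using L2_nn_integralI[of k "sqrt j"] j Jk by auto
  let ?A = "{0..2*pi}"
  have A: "?A \<in> sets borel" "emeasure lborel ?A < \<infinity>" "measure lborel ?A = 2 * pi" by auto
  have ki: "integrable lborel (\<lambda>t. indicator ?A t *\<^sub>R k t)"
    using L2_set_integrable(1)[OF k(1) A(1,2)] by (simp add: set_integrable_def)
  have ci: "integrable lborel (\<lambda>t. indicator ?A t *\<^sub>R v x)"
    using A(1,2) by (intro integrable_scaleR_left integrable_real_indicator) auto
  have "rot_mean v x = (LINT t|lborel. indicator ?A t *\<^sub>R k t + indicator ?A t *\<^sub>R v x)"
    unfolding rot_mean_def set_lebesgue_integral_def
    by (intro Bochner_Integration.integral_cong) (auto simp: k_def indicator_def)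
  also have "\<dots> = (LINT t:?A|lborel. k t) + 2 * pi * v x"
    using ki ci by (simp add: set_lebesgue_integral_def)
  finally have "2 * pi * v x = - (LINT t:?A|lborel. k t)" using zero by simp
  then have "\<bar>2 * pi * v x\<bar> = norm (LINT t:?A|lborel. k t)" by simp
  also have "\<dots> \<le> sqrt (2 * pi) * l2 k"
    using L2_set_integrable(3)[OF k(1) A(1,2)] A(3) by simp
  also have "\<dots> \<le> sqrt (2 * pi) * sqrt j" by (intro mult_left_mono k) auto
  finally have "(2 * pi * v x)\<^sup>2 \<le> (sqrt (2 * pi) * sqrt j)\<^sup>2"
    by (metis abs_ge_zero power2_abs power_mono)
  moreover have "(2 * pi * v x)\<^sup>2 = (2 * pi) * ((2 * pi) * (v x)\<^sup>2)"
    by (simp add: power2_eq_square)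
  moreover have "(sqrt (2 * pi) * sqrt j)\<^sup>2 = (2 * pi) * j"
    using j(1) by (simp add: power_mult_distrib)
  ultimately have "(2 * pi) * ((2 * pi) * (v x)\<^sup>2) \<le> (2 * pi) * j"
    by (simp only:)
  then have "(2 * pi) * (v x)\<^sup>2 \<le> j"
    by (rule mult_left_le_imp_le) simp
  then have "(v x)\<^sup>2 \<le> 1 / (2 * pi) * j"
    by (simp add: field_simps)
  then show ?thesis
    using j by (simp add: ennreal_mult'[symmetric])
qed

text \<open>A Hardy inequality. The pointwise bound is integrated, Tonelli moves the angle outside,
  and the rotation estimate applies for each angle. The factors 1/(2 pi), (2 pi)^2 and the interval
  length 2 pi multiply to (2 pi)^2. The bound is independent of e.\<close>

lemma rot_mean_zero_weighted_estimate:
  assumes p: "H1_pair \<Omega> v g" and zero: "rot_mean_zero v" and "e > 0"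
  shows "(\<integral>\<^sup>+x. ennreal ((v x)\<^sup>2 / (soft_norm e x)\<^sup>2) \<partial>lborel) \<le> ennreal ((2 * pi * l2 g)\<^sup>2)"
proof -
  have [measurable]: "v \<in> borel_measurable borel"
    using p by (auto simp: H1_pair_def L2_def)
  let ?I = "indicator {0..2*pi} :: real \<Rightarrow> real"
  let ?w = "\<lambda>x. ennreal (1 / (soft_norm e x)\<^sup>2)"
  have w: "ennreal (y / (soft_norm e x)\<^sup>2) = ?w x * ennreal y" if "y \<ge> 0" for x y
    using that by (simp add: ennreal_mult'[symmetric])
  have "(\<integral>\<^sup>+x. ennreal ((v x)\<^sup>2 / (soft_norm e x)\<^sup>2) \<partial>lborel)
    \<le> (\<integral>\<^sup>+x. ennreal (1 / (2 * pi)) * (\<integral>\<^sup>+t. ennreal (?I t) * ennreal ((v (rot t x) - v x)\<^sup>2 / (soft_norm e x)\<^sup>2) \<partial>lborel) \<partial>lborel)"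
  proof (rule nn_integral_mono_AE)
    show "AE x in lborel. ennreal ((v x)\<^sup>2 / (soft_norm e x)\<^sup>2)
      \<le> ennreal (1 / (2 * pi)) * (\<integral>\<^sup>+t. ennreal (?I t) * ennreal ((v (rot t x) - v x)\<^sup>2 / (soft_norm e x)\<^sup>2) \<partial>lborel)"
      using zero unfolding rot_mean_zero_def
    proof eventually_elim
      case (elim x)
      have "ennreal ((v x)\<^sup>2 / (soft_norm e x)\<^sup>2) = ?w x * ennreal ((v x)\<^sup>2)" by (rule w) simp
      also have "\<dots> \<le> ?w x * (ennreal (1 / (2 * pi)) *
          (\<integral>\<^sup>+t. ennreal (?I t) * ennreal ((v (rot t x) - v x)\<^sup>2) \<partial>lborel))"
        by (intro mult_left_mono rot_mean_zero_pointwise elim) auto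
      also have "\<dots> = ennreal (1 / (2 * pi)) * (?w x * (\<integral>\<^sup>+t. ennreal (?I t) * ennreal ((v (rot t x) - v x)\<^sup>2) \<partial>lborel))"
        by (simp add: mult_ac)
      also have "?w x * (\<integral>\<^sup>+t. ennreal (?I t) * ennreal ((v (rot t x) - v x)\<^sup>2) \<partial>lborel)
        = (\<integral>\<^sup>+t. ennreal (?I t) * ennreal ((v (rot t x) - v x)\<^sup>2 / (soft_norm e x)\<^sup>2) \<partial>lborel)"
      proof -
        have "(\<integral>\<^sup>+t. ennreal (?I t) * ennreal ((v (rot t x) - v x)\<^sup>2 / (soft_norm e x)\<^sup>2) \<partial>lborel)
          = (\<integral>\<^sup>+t. ?w x * (ennreal (?I t) * ennreal ((v (rot t x) - v x)\<^sup>2)) \<partial>lborel)"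
        proof (rule nn_integral_cong)
          fix t
          show "ennreal (?I t) * ennreal ((v (rot t x) - v x)\<^sup>2 / (soft_norm e x)\<^sup>2)
            = ?w x * (ennreal (?I t) * ennreal ((v (rot t x) - v x)\<^sup>2))"
            unfolding w[OF zero_le_power2] by (rule mult.left_commute)
        qed
        also have "\<dots> = ?w x * (\<integral>\<^sup>+t. ennreal (?I t) * ennreal ((v (rot t x) - v x)\<^sup>2) \<partial>lborel)"
          by (rule nn_integral_cmult) measurable
        finally show ?thesis by simp
      qed
      finally show ?case .
    qed
  qed
  also have "\<dots> = ennreal (1 / (2 * pi)) * (\<integral>\<^sup>+x. (\<integral>\<^sup>+t. ennreal (?I t) * ennreal ((v (rot t x) - v x)\<^sup>2 / (soft_norm e x)\<^sup>2) \<partial>lborel) \<partial>lborel)"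
    by (intro nn_integral_cmult lborel.borel_measurable_nn_integral) measurable
  also have "(\<integral>\<^sup>+x. (\<integral>\<^sup>+t. ennreal (?I t) * ennreal ((v (rot t x) - v x)\<^sup>2 / (soft_norm e x)\<^sup>2) \<partial>lborel) \<partial>lborel)
     = (\<integral>\<^sup>+t. (\<integral>\<^sup>+x. ennreal (?I t) * ennreal ((v (rot t x) - v x)\<^sup>2 / (soft_norm e x)\<^sup>2) \<partial>lborel) \<partial>lborel)"
    by (rule lborel_pair.Fubini') measurable
  also have "\<dots> \<le> (\<integral>\<^sup>+t. ennreal ((2 * pi)\<^sup>2 * (l2 g)\<^sup>2) * indicator {0..2*pi} t \<partial>lborel)"
  proof (rule nn_integral_mono)
    fix t
    have "(\<integral>\<^sup>+x. ennreal ((v (rot t x) - v x)\<^sup>2 / (soft_norm e x)\<^sup>2) \<partial>lborel) \<le> ennreal ((2 * pi)\<^sup>2 * (l2 g)\<^sup>2)"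
      if t: "t \<in> {0..2*pi}"
    proof (rule order_trans[OF rotation_difference_estimate[OF p \<open>e > 0\<close>]])
      show "ennreal (t\<^sup>2 * (l2 g)\<^sup>2) \<le> ennreal ((2 * pi)\<^sup>2 * (l2 g)\<^sup>2)"
        using t by (intro ennreal_leI mult_right_mono power_mono) auto
    qed (use t in simp)
    then show "(\<integral>\<^sup>+x. ennreal (?I t) * ennreal ((v (rot t x) - v x)\<^sup>2 / (soft_norm e x)\<^sup>2) \<partial>lborel)
      \<le> ennreal ((2 * pi)\<^sup>2 * (l2 g)\<^sup>2) * indicator {0..2*pi} t"
      by (auto simp: indicator_def)
  qed
  also have "\<dots> = ennreal ((2 * pi)\<^sup>2 * (l2 g)\<^sup>2) * ennreal (2 * pi)"
    by (subst nn_integral_cmult_indicator) auto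
  also have "ennreal (1 / (2 * pi)) * (ennreal ((2 * pi)\<^sup>2 * (l2 g)\<^sup>2) * ennreal (2 * pi)) = ennreal ((2 * pi * l2 g)\<^sup>2)"
    by (simp add: ennreal_mult'[symmetric] power_mult_distrib field_simps)
  finally show ?thesis by (simp add: mult_left_mono)
qed

section \<open>From means on almost every circle to means through almost every point\<close>

lemma nn_integral_periodic_shift:
  fixes h :: "real \<Rightarrow> ennreal"
  assumes [measurable]: "h \<in> borel_measurable borel" and per: "\<And>t. h (t + p) = h t" and b: "0 \<le> b" "b \<le> p"
  shows "(\<integral>\<^sup>+t. h (t + b) * indicator {0..p} t \<partial>lborel) = (\<integral>\<^sup>+t. h t * indicator {0..p} t \<partial>lborel)"
proof -
  note tr = measure_preserving_nn_integral[OF measure_preserving_translation]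
  \<comment> \<open>Half-open intervals keep the pieces [b, p) and [p, b + p) disjoint; the second
    one is moved back by one period.\<close>
  have half_open: "(\<integral>\<^sup>+t. k t * indicator {0..p} t \<partial>lborel) = (\<integral>\<^sup>+t. k t * indicator {0..<p} t \<partial>lborel)" for k :: "real \<Rightarrow> ennreal"
    using AE_lborel_singleton[of p]
    by (intro nn_integral_cong_AE, elim eventually_mono) (auto simp: indicator_def)
  have "(\<integral>\<^sup>+t. h (t + b) * indicator {0..<p} t \<partial>lborel) = (\<integral>\<^sup>+t. h (t + b) * indicator {b..<b + p} (t + b) \<partial>lborel)"
    by (intro nn_integral_cong) (auto simp: indicator_def)
  also have "\<dots> = (\<integral>\<^sup>+t. h t * indicator {b..<b + p} t \<partial>lborel)"
    by (rule tr) measurable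
  also have "\<dots> = (\<integral>\<^sup>+t. h t * indicator {b..<p} t + h t * indicator {p..<b + p} t \<partial>lborel)"
    using b by (intro nn_integral_cong) (auto simp: indicator_def)
  also have "\<dots> = (\<integral>\<^sup>+t. h t * indicator {b..<p} t \<partial>lborel) + (\<integral>\<^sup>+t. h t * indicator {p..<b + p} t \<partial>lborel)"
    by (rule nn_integral_add) measurable
  also have "(\<integral>\<^sup>+t. h t * indicator {p..<b + p} t \<partial>lborel) = (\<integral>\<^sup>+t. h (t + p) * indicator {p..<b + p} (t + p) \<partial>lborel)"
    by (rule tr[symmetric]) measurable
  also have "\<dots> = (\<integral>\<^sup>+t. h t * indicator {0..<b} t \<partial>lborel)"
    by (intro nn_integral_cong) (auto simp: indicator_def per)
  also have "(\<integral>\<^sup>+t. h t * indicator {b..<p} t \<partial>lborel) + (\<integral>\<^sup>+t. h t * indicator {0..<b} t \<partial>lborel)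
    = (\<integral>\<^sup>+t. h t * indicator {b..<p} t + h t * indicator {0..<b} t \<partial>lborel)"
    by (rule nn_integral_add[symmetric]) measurable
  also have "\<dots> = (\<integral>\<^sup>+t. h t * indicator {0..<p} t \<partial>lborel)"
    using b by (intro nn_integral_cong) (auto simp: indicator_def)
  finally show ?thesis unfolding half_open .
qed

text \<open>On a circle where v is not integrable the integral is the default 0. Comparing the image
  measures of the angle interval on the circle covers this case as well, because the mean depends on
  nothing but that measure.\<close>

lemma rot_mean_rot:
  assumes [measurable]: "v \<in> borel_measurable borel" and b: "0 \<le> b" "b \<le> 2 * pi"
  shows "rot_mean v (rot b x) = rot_mean v x"
proof -
  define M where "M = density lborel (\<lambda>t. ennreal (indicator {0..2*pi} t))"
  have [simp, measurable_cong]: "sets M = sets borel" by (simp add: M_def)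
  have mean: "rot_mean v y = (LINT z|distr M borel (\<lambda>t. rot t y). v z)" for y
  proof -
    have "(LINT z|distr M borel (\<lambda>t. rot t y). v z) = (LINT t|M. v (rot t y))"
      by (rule integral_distr) measurable
    also have "\<dots> = rot_mean v y"
      unfolding M_def rot_mean_def set_lebesgue_integral_def by (rule integral_density) auto
    finally show ?thesis by simp
  qed
  have "distr M borel (\<lambda>t. rot t (rot b x)) = distr M borel (\<lambda>t. rot t x)"
  proof (rule measure_eqI)
    fix A assume "A \<in> sets (distr M borel (\<lambda>t. rot t (rot b x)))"
    then have [measurable]: "A \<in> sets borel" by simp
    have em: "emeasure (distr M borel (\<lambda>t. rot t y)) A = (\<integral>\<^sup>+t. indicator A (rot t y) * indicator {0..2*pi} t \<partial>lborel)" for y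
    proof -
      have "emeasure (distr M borel (\<lambda>t. rot t y)) A = emeasure M ((\<lambda>t. rot t y) -` A)"
        by (subst emeasure_distr) (auto simp: M_def)
      also have "\<dots> = (\<integral>\<^sup>+t. ennreal (indicator {0..2*pi} t) * indicator ((\<lambda>t. rot t y) -` A) t \<partial>lborel)"
        unfolding M_def using measurable_sets[of "\<lambda>t. rot t y" borel borel A]
        by (intro emeasure_density) auto
      also have "\<dots> = (\<integral>\<^sup>+t. indicator A (rot t y) * indicator {0..2*pi} t \<partial>lborel)"
        by (intro nn_integral_cong) (auto simp: indicator_def)
      finally show ?thesis .
    qed
    show "emeasure (distr M borel (\<lambda>t. rot t (rot b x))) A = emeasure (distr M borel (\<lambda>t. rot t x)) A"
      by (subst em, subst em, unfold rot_rot, rule nn_integral_periodic_shift[of "\<lambda>t. indicator A (rot t x)"]) (use b in \<open>auto simp: rot_2pi\<close>)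
  qed simp
  then show ?thesis by (simp add: mean)
qed

lemma polar_representation:
  fixes x :: "real^2"
  obtains b where "0 \<le> b" "b \<le> 2 * pi" "x = rot b (norm x *\<^sub>R vector [1, 0])"
proof (cases "x = 0")
  case True
  then have "x = rot 0 (norm x *\<^sub>R vector [1, 0])" by simp
  with that[of 0] show ?thesis by simp
next
  case False
  then have "(x$1 / norm x)\<^sup>2 + (x$2 / norm x)\<^sup>2 = 1"
    by (simp add: power_divide add_divide_distrib[symmetric] norm_real2_power2[symmetric])
  then obtain t where t: "0 \<le> t" "t < 2 * pi" "x$1 / norm x = cos t" "x$2 / norm x = sin t"
    by (rule sincos_total_2pi)
  have "cos t * norm x = x$1" "sin t * norm x = x$2"
    unfolding t(3,4)[symmetric] using False by simp_all
  then have "x = rot t (norm x *\<^sub>R vector [1, 0])"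
    by (simp add: vec_eq_iff forall_2)
  with that[of t] t show ?thesis by simp
qed

text \<open>Polar coordinates for radial sets, from areas of balls alone: the disc without the
  closed ball of radius y has area pi - pi y^2, the integral of 2 pi r over [y, 1], and half-lines
  determine the measure.\<close>

lemma distr_norm_disc:
  "distr (density lborel (indicator disc)) borel norm
    = density lborel (\<lambda>r. ennreal (2 * pi * r) * indicator {0..1} r)"
    (is "?M = ?N")
proof (rule measure_eqI_lessThan)
  fix x :: real
  have area: "emeasure lborel (ball (0::real^2) r) = ennreal (pi * r\<^sup>2)"
     "emeasure lborel (cball (0::real^2) r) = ennreal (pi * r\<^sup>2)" if "r \<ge> 0" for r
    using that by (simp_all add: emeasure_ball emeasure_cball unit_ball_vol_2)
  have M: "emeasure ?M {x<..} = emeasure lborel (disc - cball 0 x)"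
  proof -
    have m: "norm -` {x<..} \<in> sets (borel :: (real^2) measure)"
      using measurable_sets[of norm borel borel "{x<..}"] by simp
    have "emeasure ?M {x<..} = emeasure (density lborel (indicator disc)) (norm -` {x<..} :: (real^2) set)"
      by (subst emeasure_distr) auto
    also have "\<dots> = (\<integral>\<^sup>+y. indicator disc y * indicator (norm -` {x<..}) (y::real^2) \<partial>lborel)"
      using m by (intro emeasure_density) (auto intro!: borel_measurable_indicator)
    also have "\<dots> = (\<integral>\<^sup>+y. indicator (disc - cball 0 x) y \<partial>lborel)"
      by (intro nn_integral_cong) (auto simp: indicator_def)
    finally show ?thesis by simp
  qed
  then show "emeasure ?M {x<..} < \<infinity>"
  proof -
    have "emeasure lborel (disc - cball 0 x) \<le> emeasure lborel disc" by (rule emeasure_mono) auto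
    with M area(1)[of 1] show ?thesis by (simp add: le_less_trans)
  qed
  have N: "emeasure ?N {x<..} = (\<integral>\<^sup>+r. ennreal (2 * pi * r) * indicator {max 0 x..1} r \<partial>lborel)"
  proof -
    have "emeasure ?N {x<..} = (\<integral>\<^sup>+r. (ennreal (2 * pi * r) * indicator {0..1} r) * indicator {x<..} r \<partial>lborel)"
      by (intro emeasure_density) auto
    also have "\<dots> = (\<integral>\<^sup>+r. ennreal (2 * pi * r) * indicator {max 0 x..1} r \<partial>lborel)"
      using AE_lborel_singleton[of x]
      by (intro nn_integral_cong_AE, elim eventually_mono) (auto simp: indicator_def)
    finally show ?thesis .
  qed
  show "emeasure ?M {x<..} = emeasure ?N {x<..}"
  proof (cases "x \<le> 1")
    case True
    \<comment> \<open>For negative x the ball \<open>cball 0 x\<close> is empty; replacing x by 0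
      removes only the origin from the disc.\<close>
    define y where "y = max 0 x"
    have y: "0 \<le> y" "y \<le> 1" using True by (auto simp: y_def)
    have "emeasure lborel (disc - cball 0 x) = emeasure lborel (disc - cball 0 y)"
    proof (rule emeasure_eq_AE)
      show "AE z in lborel. (z \<in> disc - cball 0 x) = (z \<in> disc - cball 0 y)"
        using AE_lborel_singleton[of "0::real^2"] by eventually_elim (auto simp: y_def max_def dest: order_trans[OF norm_ge_zero])
    qed auto
    also have "\<dots> = ennreal (pi - pi * y\<^sup>2)"
    \<comment> \<open>For y = 1 the closed ball is not contained in the open disc, so the measures
      cannot simply be subtracted.\<close>
    proof (cases "y = 1")
      case True
      then have "disc - cball 0 y = {}" by auto
      then show ?thesis unfolding \<open>disc - cball 0 y = {}\<close> using True by simp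
    next
      case False
      then have "emeasure lborel (disc - cball 0 y) = emeasure lborel disc - emeasure lborel (cball (0::real^2) y)"
        using y area(2)[of y] by (intro emeasure_Diff) auto
      also have "\<dots> = ennreal (pi - pi * y\<^sup>2)"
        using y area(1)[of 1] area(2)[of y] by (simp add: ennreal_minus)
      finally show ?thesis .
    qed
    also have "\<dots> = (\<integral>\<^sup>+r. ennreal (2 * pi * r) * indicator {y..1} r \<partial>lborel)"
    proof -
      have "(\<integral>\<^sup>+r. ennreal (2 * pi * r) * indicator {y..1} r \<partial>lborel) = ennreal (pi * 1\<^sup>2 - pi * y\<^sup>2)"
        by (rule nn_integral_FTC_Icc[where F="\<lambda>r. pi * r\<^sup>2"])
          (use y in \<open>auto intro!: derivative_eq_intros\<close>)
      then show ?thesis by simp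
    qed
    finally show ?thesis unfolding M N y_def .
  next
    case False
    then have e: "disc - cball 0 x = {}" "{max 0 x..1} = {}" by auto
    show ?thesis unfolding M N e by simp
  qed
qed auto

lemma measurable_rot_mean [measurable]:
  assumes [measurable]: "v \<in> borel_measurable borel"
  shows "rot_mean v \<in> borel_measurable borel"
proof -
  have "(\<lambda>x. LINT t|lborel. indicator {0..2*pi} t *\<^sub>R v (rot t x)) \<in> borel_measurable borel"
    by (rule lborel.borel_measurable_lebesgue_integral) measurable
  then show ?thesis
    unfolding rot_mean_def[abs_def] set_lebesgue_integral_def .
qed

text \<open>On [0, 1] the density 2 pi r vanishes only at r = 0, so null sets of radii and radial
  null sets of the disc correspond in both directions.\<close>

lemma AE_disc_norm_iff:
  assumes [measurable]: "Measurable.pred borel P"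
  shows "(AE x in lborel. x \<in> disc \<longrightarrow> P (norm x)) \<longleftrightarrow> (AE r in lborel. r \<in> {0..1} \<longrightarrow> P r)"
proof -
  have "(AE x in lborel. x \<in> disc \<longrightarrow> P (norm x)) \<longleftrightarrow> (AE x in density lborel (indicator disc). P (norm x))"
    by (subst AE_density) (auto simp: indicator_def intro!: borel_measurable_indicator)
  also have "\<dots> \<longleftrightarrow> (AE r in distr (density lborel (indicator disc)) borel norm. P r)"
    by (subst AE_distr_iff) auto
  also have "\<dots> \<longleftrightarrow> (AE r in lborel. 0 < ennreal (2 * pi * r) * indicator {0..1} r \<longrightarrow> P r)"
    unfolding distr_norm_disc by (rule AE_density) measurable
  also have "\<dots> \<longleftrightarrow> (AE r in lborel. r \<in> {0..1} \<longrightarrow> P r)"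
  proof -
    have "AE r in lborel. (0 < ennreal (2 * pi * r) * indicator {0..1} r \<longrightarrow> P r) \<longleftrightarrow> (r \<in> {0..1} \<longrightarrow> P r)"
      using AE_lborel_singleton[of 0] by eventually_elim (auto simp: indicator_def ennreal_zero_less_mult_iff)
    then show ?thesis by (auto elim: AE_mp)
  qed
  finally show ?thesis .
qed

lemma zero_circular_means_iff:
  fixes u :: "real^2 \<Rightarrow> real"
  defines "v \<equiv> \<lambda>x. indicator disc x * u x"
  assumes [measurable]: "v \<in> borel_measurable borel"
  shows "zero_circular_means u \<longleftrightarrow> rot_mean_zero v"
proof -
  let ?e = "vector [1, 0] :: real^2"
  have ne: "norm ?e = 1"
    by (simp add: norm_vec_def L2_set_def sum_2)
  have circ: "(LINT t:{0..2*pi}|lborel. u (vector [r * cos t, r * sin t])) = rot_mean v (r *\<^sub>R ?e)"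
    if r: "0 \<le> r" "r < 1" for r
  proof -
    have "u (vector [r * cos t, r * sin t]) = v (rot t (r *\<^sub>R ?e))" for t
    proof -
      have "vector [r * cos t, r * sin t] = rot t (r *\<^sub>R ?e)"
        by (simp add: vec_eq_iff forall_2)
      moreover have "rot t (r *\<^sub>R ?e) \<in> disc" using r ne by simp
      ultimately show ?thesis by (simp add: v_def)
    qed
    then show ?thesis by (simp add: rot_mean_def)
  qed
  have radial: "rot_mean v x = rot_mean v (norm x *\<^sub>R ?e)" for x
    using polar_representation[of x] rot_mean_rot[OF assms(2)] by metis
  have outside: "rot_mean v x = 0" if "x \<notin> disc" for x
    using that unfolding rot_mean_def v_def by (simp add: set_lebesgue_integral_def)
  have [measurable]: "(\<lambda>r. rot_mean v (r *\<^sub>R ?e)) \<in> borel_measurable borel" by measurable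
  have "zero_circular_means u \<longleftrightarrow> (AE r in lborel. r \<in> {0..1} \<longrightarrow> rot_mean v (r *\<^sub>R ?e) = 0)"
  proof -
    \<comment> \<open>At r = 1 the cut-off v is 0 while u is arbitrary; this single radius is a null
      set.\<close>
    have "AE r in lborel. (r \<in> {0..1} \<longrightarrow> (LINT t:{0..2*pi}|lborel. u (vector [r * cos t, r * sin t])) = 0)
       \<longleftrightarrow> (r \<in> {0..1} \<longrightarrow> rot_mean v (r *\<^sub>R ?e) = 0)"
      using AE_lborel_singleton[of 1] by eventually_elim (auto simp: circ)
    then show ?thesis unfolding zero_circular_means_def by (auto elim: AE_mp)
  qed
  also have "\<dots> \<longleftrightarrow> (AE x in lborel. x \<in> disc \<longrightarrow> rot_mean v (norm x *\<^sub>R ?e) = 0)"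
    by (rule AE_disc_norm_iff[symmetric]) measurable
  also have "\<dots> \<longleftrightarrow> rot_mean_zero v"
    unfolding rot_mean_zero_def radial[symmetric] using outside by (intro AE_cong) auto
  finally show ?thesis .
qed

section \<open>A weighted Sobolev inequality in the plane\<close>

lemma Basis_real2: "(Basis :: (real^2) set) = {axis 1 1, axis 2 1}"
  by (auto simp: Basis_vec_def UNIV_2)

text \<open>Transfers the product structure to \<open>real^2\<close>, so that Tonelli can integrate
  along horizontal and vertical lines.\<close>

lemma lborel_real2: "distr lborel borel (\<lambda>p. vector [fst p, snd p] :: real^2) = (lborel :: (real^2) measure)"
  and measurable_vector2 [measurable]: "(\<lambda>p. vector [fst p, snd p] :: real^2) \<in> borel_measurable borel"
proof -
  have eq: "(\<lambda>p. vector [fst p, snd p] :: real^2) = (\<lambda>p. fst p *\<^sub>R axis 1 1 + snd p *\<^sub>R axis 2 1)"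
    by (auto simp: fun_eq_iff vec_eq_iff forall_2 axis_def)
  show m: "(\<lambda>p. vector [fst p, snd p] :: real^2) \<in> borel_measurable borel"
    unfolding eq by (intro borel_measurable_continuous_onI continuous_intros)
  show "distr lborel borel (\<lambda>p. vector [fst p, snd p] :: real^2) = (lborel :: (real^2) measure)"
  proof (rule lborel_eqI[symmetric])
    fix l u :: "real^2" assume le: "\<And>b. b \<in> Basis \<Longrightarrow> l \<bullet> b \<le> u \<bullet> b"
    have le': "l$1 \<le> u$1" "l$2 \<le> u$2"
      using le[of "axis 1 1"] le[of "axis 2 1"] by (auto simp: Basis_real2 inner_axis)
    have pre: "(\<lambda>p. vector [fst p, snd p]) -` box l u = {l$1<..<u$1} \<times> {l$2<..<u$2}"
      by (auto simp: mem_box_cart forall_2)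
    have "emeasure (distr lborel borel (\<lambda>p. vector [fst p, snd p] :: real^2)) (box l u)
      = emeasure lborel ((\<lambda>p. vector [fst p, snd p]) -` box l u)"
      using m by (subst emeasure_distr) auto
    also have "\<dots> = emeasure (lborel \<Otimes>\<^sub>M lborel) ({l$1<..<u$1} \<times> {l$2<..<u$2})"
      unfolding pre lborel_prod ..
    also have "\<dots> = ennreal (u$1 - l$1) * ennreal (u$2 - l$2)"
      using le' by (subst lborel.emeasure_pair_measure_Times) auto
    also have "\<dots> = (\<Prod>b\<in>Basis. (u - l) \<bullet> b)"
      using le' by (simp add: Basis_real2 axis_eq_axis inner_axis inner_simps ennreal_mult')
    finally show "emeasure (distr lborel borel (\<lambda>p. vector [fst p, snd p] :: real^2)) (box l u)
       = (\<Prod>b\<in>Basis. (u - l) \<bullet> b)" .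
  qed simp
qed

lemma measurable_vector2' [measurable]:
  "(\<lambda>(a, b). vector [a, b] :: real^2) \<in> borel_measurable (borel \<Otimes>\<^sub>M borel)"
  "(\<lambda>(b, a). vector [a, b] :: real^2) \<in> borel_measurable (borel \<Otimes>\<^sub>M borel)"
proof -
  show 1: "(\<lambda>(a, b). vector [a, b] :: real^2) \<in> borel_measurable (borel \<Otimes>\<^sub>M borel)"
    using measurable_vector2 by (simp add: borel_prod case_prod_unfold)
  show "(\<lambda>(b, a). vector [a, b] :: real^2) \<in> borel_measurable (borel \<Otimes>\<^sub>M borel)"
    using measurable_compose[OF measurable_pair_swap' 1] by (simp add: case_prod_unfold)
qed

lemma nn_integral_real2:
  assumes [measurable]: "f \<in> borel_measurable borel"
  shows "(\<integral>\<^sup>+x. f (x :: real^2) \<partial>lborel) = (\<integral>\<^sup>+a. \<integral>\<^sup>+b. f (vector [a, b]) \<partial>lborel \<partial>lborel)"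
    and "(\<integral>\<^sup>+x. f (x :: real^2) \<partial>lborel) = (\<integral>\<^sup>+b. \<integral>\<^sup>+a. f (vector [a, b]) \<partial>lborel \<partial>lborel)"
proof -
  have "(\<integral>\<^sup>+x. f (x :: real^2) \<partial>lborel) = (\<integral>\<^sup>+p. f (vector [fst p, snd p]) \<partial>(lborel :: (real \<times> real) measure))"
    by (subst lborel_real2[symmetric], rule nn_integral_distr) auto
  also have "\<dots> = (\<integral>\<^sup>+p. f (vector [fst p, snd p]) \<partial>(lborel \<Otimes>\<^sub>M lborel))"
    by (simp add: lborel_prod)
  also have "\<dots> = (\<integral>\<^sup>+a. \<integral>\<^sup>+b. f (vector [fst (a, b), snd (a, b)]) \<partial>lborel \<partial>lborel)"
    by (rule lborel.nn_integral_fst[symmetric]) (simp add: lborel_prod)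
  finally show 1: "(\<integral>\<^sup>+x. f (x :: real^2) \<partial>lborel) = (\<integral>\<^sup>+a. \<integral>\<^sup>+b. f (vector [a, b]) \<partial>lborel \<partial>lborel)" by simp
  also have "\<dots> = (\<integral>\<^sup>+b. \<integral>\<^sup>+a. f (vector [a, b]) \<partial>lborel \<partial>lborel)"
    by (rule lborel_pair.Fubini') measurable
  finally show "(\<integral>\<^sup>+x. f (x :: real^2) \<partial>lborel) = (\<integral>\<^sup>+b. \<integral>\<^sup>+a. f (vector [a, b]) \<partial>lborel \<partial>lborel)" .
qed

text \<open>The value at x is the integral of the derivative along a line that comes from outside
  the support.\<close>

lemma C1_compact_line_bound:
  fixes e :: "'a::euclidean_space"
  assumes C: "C1_compact f g K" and e: "norm e = 1"
  shows "ennreal \<bar>f x\<bar> \<le> (\<integral>\<^sup>+s. ennreal (norm (g (x + s *\<^sub>R e))) \<partial>lborel)"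
proof -
  have gcont: "continuous_on UNIV g" and gder: "\<And>x. GDERIV f x :> g x"
    and K: "compact K" "\<And>x. x \<notin> K \<Longrightarrow> f x = 0"
    using C by (auto simp: C1_compact_def)
  obtain R where R: "\<And>y. y \<in> K \<Longrightarrow> norm y \<le> R"
    using compact_imp_bounded[OF K(1)] by (auto simp: bounded_iff)
  \<comment> \<open>The point at distance c behind x has norm at least c - |x|, which exceeds R, so
    it lies outside K.\<close>
  define c where "c = norm x + \<bar>R\<bar> + 1"
  have c: "c > 0" by (auto simp: c_def intro: add_nonneg_pos)
  have far: "f (x + (- c) *\<^sub>R e) = 0"
  proof (rule K(2), rule notI)
    assume "x + (- c) *\<^sub>R e \<in> K"
    then have "norm (x + (- c) *\<^sub>R e) \<le> R" by (rule R)
    moreover have "norm ((- c) *\<^sub>R e) \<le> norm (x + (- c) *\<^sub>R e) + norm x"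
      using norm_triangle_ineq4[of "x + (- c) *\<^sub>R e" x] by simp
    ultimately show False using e c by (simp add: c_def)
  qed
  let ?d = "\<lambda>s. e \<bullet> g (x + s *\<^sub>R e)"
  let ?I = "indicator {- c..0} :: real \<Rightarrow> real"
  have d: "((\<lambda>s. f (x + s *\<^sub>R e)) has_vector_derivative ?d s) (at s)" for s
  proof -
    have "((\<lambda>t. x + t *\<^sub>R e) has_derivative (\<lambda>h. h *\<^sub>R e)) (at s)"
      by (auto intro!: derivative_eq_intros)
    from has_derivative_compose[OF this gder[unfolded gderiv_def]] show ?thesis
      by (simp add: has_vector_derivative_def)
  qed
  have cd: "continuous_on UNIV ?d"
    by (intro continuous_intros continuous_on_compose2[OF gcont]) auto
  have FTC: "(\<integral>s. ?I s *\<^sub>R ?d s \<partial>lborel) = f (x + 0 *\<^sub>R e) - f (x + (- c) *\<^sub>R e)"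
    using c by (intro integral_FTC_Icc has_vector_derivative_at_within[OF d] continuous_on_subset[OF cd]) auto
  have int: "integrable lborel (\<lambda>s. ?I s *\<^sub>R ?d s)"
    by (intro borel_integrable_compact continuous_on_subset[OF cd]) auto
  have "ennreal \<bar>f x\<bar> \<le> (\<integral>\<^sup>+s. norm (?I s *\<^sub>R ?d s) \<partial>lborel)"
    using integral_norm_bound_ennreal[OF int] unfolding FTC far by simp
  also have "\<dots> \<le> (\<integral>\<^sup>+s. ennreal (norm (g (x + s *\<^sub>R e))) \<partial>lborel)"
  proof (intro nn_integral_mono ennreal_leI)
    fix s
    show "norm (?I s *\<^sub>R ?d s) \<le> norm (g (x + s *\<^sub>R e))"
      using Cauchy_Schwarz_ineq2[of e "g (x + s *\<^sub>R e)"] e by (auto simp: indicator_def)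
  qed
  finally show ?thesis .
qed

text \<open>Gagliardo's argument: |f| at (a, b) is bounded by the horizontal line integral
  \<open>A b\<close>, which does not depend on a, and by the vertical one \<open>B a\<close>, which
  does not depend on b. The product of the two integrates to a product.\<close>

lemma C1_compact_sobolev:
  fixes f :: "real^2 \<Rightarrow> real"
  assumes C: "C1_compact f g K"
  shows "(\<integral>\<^sup>+x. ennreal ((f x)\<^sup>2) \<partial>lborel) \<le> (\<integral>\<^sup>+x. ennreal (norm (g x)) \<partial>lborel)\<^sup>2"
proof -
  have [measurable]: "g \<in> borel_measurable borel" "f \<in> borel_measurable borel"
    using C1_compact_L2[OF C] by (auto simp: L2_def)
  let ?G = "\<lambda>x. ennreal (norm (g x))"
  define A where "A b = (\<integral>\<^sup>+a. ?G (vector [a, b]) \<partial>lborel)" for b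
  define B where "B a = (\<integral>\<^sup>+b. ?G (vector [a, b]) \<partial>lborel)" for a
  have [measurable]: "A \<in> borel_measurable borel" "B \<in> borel_measurable borel"
    unfolding A_def B_def by (auto intro!: lborel.borel_measurable_nn_integral)
  have tr: "(\<integral>\<^sup>+s. h (c + s) \<partial>lborel) = (\<integral>\<^sup>+s. h s \<partial>lborel)" if "h \<in> borel_measurable borel"
    for h :: "real \<Rightarrow> ennreal" and c
    using measure_preserving_nn_integral[OF measure_preserving_translation that, of c] by (simp add: add.commute)
  have bound: "ennreal ((f (vector [a, b]))\<^sup>2) \<le> A b * B a" for a b
  proof -
    have "ennreal \<bar>f (vector [a, b])\<bar> \<le> (\<integral>\<^sup>+s. ?G (vector [a, b] + s *\<^sub>R axis 1 1) \<partial>lborel)"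
      by (rule C1_compact_line_bound[OF C]) simp
    also have "\<dots> = (\<integral>\<^sup>+s. ?G (vector [a + s, b]) \<partial>lborel)"
      by (intro nn_integral_cong arg_cong[where f="?G"]) (simp add: vec_eq_iff forall_2 axis_def)
    also have "\<dots> = A b"
      unfolding A_def by (rule tr) measurable
    finally have 1: "ennreal \<bar>f (vector [a, b])\<bar> \<le> A b" .
    have "ennreal \<bar>f (vector [a, b])\<bar> \<le> (\<integral>\<^sup>+s. ?G (vector [a, b] + s *\<^sub>R axis 2 1) \<partial>lborel)"
      by (rule C1_compact_line_bound[OF C]) simp
    also have "\<dots> = (\<integral>\<^sup>+s. ?G (vector [a, b + s]) \<partial>lborel)"
      by (intro nn_integral_cong arg_cong[where f="?G"]) (simp add: vec_eq_iff forall_2 axis_def)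
    also have "\<dots> = B a"
      unfolding B_def by (rule tr) measurable
    finally have 2: "ennreal \<bar>f (vector [a, b])\<bar> \<le> B a" .
    have "ennreal ((f (vector [a, b]))\<^sup>2) = ennreal \<bar>f (vector [a, b])\<bar> * ennreal \<bar>f (vector [a, b])\<bar>"
      by (simp add: ennreal_mult'[symmetric] power2_eq_square)
    also have "\<dots> \<le> A b * B a" by (intro mult_mono 1 2) auto
    finally show ?thesis .
  qed
  have "(\<integral>\<^sup>+x. ennreal ((f x)\<^sup>2) \<partial>lborel) = (\<integral>\<^sup>+a. \<integral>\<^sup>+b. ennreal ((f (vector [a, b]))\<^sup>2) \<partial>lborel \<partial>lborel)"
    by (rule nn_integral_real2) measurable
  also have "\<dots> \<le> (\<integral>\<^sup>+a. \<integral>\<^sup>+b. A b * B a \<partial>lborel \<partial>lborel)"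
    by (intro nn_integral_mono bound)
  also have "\<dots> = (\<integral>\<^sup>+b. A b \<partial>lborel) * (\<integral>\<^sup>+a. B a \<partial>lborel)"
    by (simp add: nn_integral_multc nn_integral_cmult)
  also have "(\<integral>\<^sup>+b. A b \<partial>lborel) = (\<integral>\<^sup>+x. ?G x \<partial>lborel)"
    unfolding A_def by (rule nn_integral_real2(2)[symmetric]) measurable
  also have "(\<integral>\<^sup>+a. B a \<partial>lborel) = (\<integral>\<^sup>+x. ?G x \<partial>lborel)"
    unfolding B_def by (rule nn_integral_real2(1)[symmetric]) measurable
  finally show ?thesis by (simp add: power2_eq_square)
qed

section \<open>Iteration over powers with the regularised weight\<close>

lemma C1_compact_weighted_power:
  assumes C: "C1_compact \<phi> g K" and "e > 0"
  shows "C1_compact (\<lambda>x. \<phi> x ^ Suc k / soft_norm e x)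
    (\<lambda>x. (real (Suc k) * \<phi> x ^ k / soft_norm e x) *\<^sub>R g x - (\<phi> x ^ Suc k / soft_norm e x ^ 3) *\<^sub>R x) K"
proof -
  let ?s = "soft_norm e"
  have pos: "?s x > 0" for x using \<open>e > 0\<close> by (rule soft_norm_pos)
  have nz: "?s x \<noteq> 0" for x using pos[of x] by simp
  note \<phi>c = C1_compact_continuous[OF C]
  have gcont: "continuous_on UNIV g" and gder: "\<And>x. GDERIV \<phi> x :> g x"
    using C by (auto simp: C1_compact_def)
  have "GDERIV (\<lambda>x. \<phi> x ^ Suc k / ?s x) x :>
    (real (Suc k) * \<phi> x ^ k / ?s x) *\<^sub>R g x - (\<phi> x ^ Suc k / ?s x ^ 3) *\<^sub>R x" for x
  proof -
    have q: "GDERIV (\<lambda>x. (norm x)\<^sup>2 + e\<^sup>2) x :> 2 *\<^sub>R x"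
      unfolding gderiv_def power2_norm_eq_inner
      by (auto intro!: derivative_eq_intros simp: inner_commute)
    \<comment> \<open>The outer function of a chain rule that yields - x / s^3 as the gradient of 1
      / s, where s is the regularised norm.\<close>
    have r: "DERIV (\<lambda>y. 1 / sqrt y) ((norm x)\<^sup>2 + e\<^sup>2) :> - (1 / (2 * ?s x ^ 3))"
    proof -
      have y: "(norm x)\<^sup>2 + e\<^sup>2 > 0" using \<open>e > 0\<close> by (simp add: add_nonneg_pos)
      have "DERIV (\<lambda>y. 1 / sqrt y) ((norm x)\<^sup>2 + e\<^sup>2) :> - (inverse (sqrt ((norm x)\<^sup>2 + e\<^sup>2)) / 2) / (sqrt ((norm x)\<^sup>2 + e\<^sup>2))\<^sup>2"
        using y by (auto intro!: derivative_eq_intros simp: power2_eq_square)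
      moreover have "- (inverse s / 2) / s\<^sup>2 = - (1 / (2 * s ^ 3))" for s :: real
        by (simp add: field_simps power_numeral_reduce)
      ultimately show ?thesis
        unfolding soft_norm_def by (simp only:)
    qed
    have s: "GDERIV (\<lambda>x. 1 / ?s x) x :> - (1 / (2 * ?s x ^ 3)) *\<^sub>R (2 *\<^sub>R x)"
      unfolding soft_norm_def[abs_def] using GDERIV_DERIV_compose[OF q r[unfolded soft_norm_def]] by simp
    have p: "GDERIV (\<lambda>x. \<phi> x ^ Suc k) x :> (real (Suc k) * \<phi> x ^ k) *\<^sub>R g x"
      using GDERIV_DERIV_compose[OF gder DERIV_pow[of "Suc k"]] by simp
    from GDERIV_mult[OF p s] show ?thesis
      by (simp add: algebra_simps add_divide_distrib)
  qed
  moreover have "continuous_on UNIV (\<lambda>x. (real (Suc k) * \<phi> x ^ k / ?s x) *\<^sub>R g x - (\<phi> x ^ Suc k / ?s x ^ 3) *\<^sub>R x)"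
    using nz by (intro continuous_intros \<phi>c gcont) auto
  ultimately show ?thesis
    using C unfolding C1_compact_def by auto
qed

text \<open>Gagliardo's inequality for phi^(k+2) / s, where s is the regularised norm. As |x| \<le>
  s, the gradient is at most (k+2) |phi^(k+1) / s| |g| + |phi^(k+1) / s| |phi / s|, and
  Cauchy-Schwarz takes out \<open>N (Suc k)\<close>, which is one power lower.\<close>

lemma weighted_power_step:
  assumes C: "C1_compact \<phi> g K" and "e > 0"
  defines "N \<equiv> \<lambda>k. l2 (\<lambda>x. \<phi> x ^ k / soft_norm e x)"
  shows "N (Suc (Suc k)) \<le> N (Suc k) * (real (Suc (Suc k)) * l2 g + N 1)"
proof -
  let ?s = "soft_norm e"
  let ?F = "\<lambda>k x. \<phi> x ^ k / ?s x"
  let ?G = "\<lambda>x. (real (Suc (Suc k)) * \<phi> x ^ Suc k / ?s x) *\<^sub>R g x - (\<phi> x ^ Suc (Suc k) / ?s x ^ 3) *\<^sub>R x"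
  have pos: "?s x > 0" for x using \<open>e > 0\<close> by (rule soft_norm_pos)
  note CF = C1_compact_weighted_power[OF C \<open>e > 0\<close>]
  have L: "L2 (?F (Suc k))" for k using C1_compact_L2(1)[OF CF] .
  have L1: "L2 (?F 1)" using L[of 0] by simp
  note Lg = C1_compact_L2(2)[OF C]
  have bound: "norm (?G x) \<le> real (Suc (Suc k)) * (norm (?F (Suc k) x) * norm (g x)) + norm (?F (Suc k) x) * norm (?F 1 x)" for x
  proof -
    have "norm (?G x) \<le> norm ((real (Suc (Suc k)) * \<phi> x ^ Suc k / ?s x) *\<^sub>R g x) + norm ((\<phi> x ^ Suc (Suc k) / ?s x ^ 3) *\<^sub>R x)"
      by (rule norm_triangle_ineq4)
    also have "norm ((real (Suc (Suc k)) * \<phi> x ^ Suc k / ?s x) *\<^sub>R g x) = real (Suc (Suc k)) * (norm (?F (Suc k) x) * norm (g x))"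
      by (simp add: abs_mult)
    also have "norm ((\<phi> x ^ Suc (Suc k) / ?s x ^ 3) *\<^sub>R x) = \<bar>\<phi> x\<bar> ^ Suc (Suc k) / ?s x ^ 3 * norm x"
      using pos[of x] by (simp add: abs_mult power_abs)
    also have "\<dots> \<le> \<bar>\<phi> x\<bar> ^ Suc (Suc k) / ?s x ^ 3 * ?s x"
      using pos[of x] norm_le_soft_norm[of x e] by (intro mult_left_mono) auto
    also have "\<dots> = norm (?F (Suc k) x) * norm (?F 1 x)"
      using pos[of x] by (simp add: abs_mult power_abs field_simps power_numeral_reduce)
    finally show ?thesis by simp
  qed
  have int: "integrable lborel (\<lambda>x. real (Suc (Suc k)) * (norm (?F (Suc k) x) * norm (g x)) + norm (?F (Suc k) x) * norm (?F 1 x))"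
    using L2_norm_mult(1)[OF L Lg, of k] L2_norm_mult(1)[OF L L1, of k]
    by (intro Bochner_Integration.integrable_add integrable_mult_right)
  have le: "(LINT x|lborel. real (Suc (Suc k)) * (norm (?F (Suc k) x) * norm (g x)) + norm (?F (Suc k) x) * norm (?F 1 x))
    \<le> N (Suc k) * (real (Suc (Suc k)) * l2 g + N 1)" (is "?J \<le> _")
  proof -
    have "?J = real (Suc (Suc k)) * (LINT x|lborel. norm (?F (Suc k) x) * norm (g x)) + (LINT x|lborel. norm (?F (Suc k) x) * norm (?F 1 x))"
      using L2_norm_mult(1)[OF L Lg, of k] L2_norm_mult(1)[OF L L1, of k]
      by (subst Bochner_Integration.integral_add) (simp_all only: integrable_mult_right integral_mult_right_zero)
    also have "\<dots> \<le> real (Suc (Suc k)) * (N (Suc k) * l2 g) + N (Suc k) * N 1"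
      unfolding N_def
      by (intro add_mono mult_left_mono L2_norm_mult(2)[OF L Lg] L2_norm_mult(2)[OF L L1]) auto
    finally show ?thesis by (simp add: algebra_simps)
  qed
  have "ennreal ((N (Suc (Suc k)))\<^sup>2) = (\<integral>\<^sup>+x. ennreal ((?F (Suc (Suc k)) x)\<^sup>2) \<partial>lborel)"
    unfolding N_def using L2_nn_integral[OF L, of "Suc k", symmetric] by (simp only: real_norm_def power2_abs)
  also have "\<dots> \<le> (\<integral>\<^sup>+x. ennreal (norm (?G x)) \<partial>lborel)\<^sup>2"
    by (rule C1_compact_sobolev[OF CF])
  also have "\<dots> \<le> (\<integral>\<^sup>+x. ennreal (real (Suc (Suc k)) * (norm (?F (Suc k) x) * norm (g x)) + norm (?F (Suc k) x) * norm (?F 1 x)) \<partial>lborel)\<^sup>2"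
    by (intro power_mono nn_integral_mono ennreal_leI bound) auto
  also have "\<dots> = (ennreal ?J)\<^sup>2"
    using int by (subst nn_integral_eq_integral) (auto intro!: AE_I2 add_nonneg_nonneg)
  also have "\<dots> = ennreal (?J\<^sup>2)"
    by (intro ennreal_power integral_nonneg) (auto intro!: add_nonneg_nonneg)
  finally have "(N (Suc (Suc k)))\<^sup>2 \<le> ?J\<^sup>2"
    by (simp add: ennreal_le_iff)
  then have "N (Suc (Suc k)) \<le> ?J"
    by (rule power2_le_imp_le) (auto intro!: integral_nonneg add_nonneg_nonneg)
  with le show ?thesis by linarith
qed

text \<open>The factorial collects the factors k + 2 of the single steps. The norm of
  \<open>\<phi> x / soft_norm e x\<close> stays on the right: for a test function that does not
  vanish at the origin it is unbounded as e tends to 0.\<close>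

lemma weighted_power_bound:
  assumes C: "C1_compact \<phi> g K" and "e > 0"
  shows "l2 (\<lambda>x. \<phi> x ^ Suc k / soft_norm e x)
    \<le> fact (Suc k) * (l2 g + l2 (\<lambda>x. \<phi> x / soft_norm e x)) ^ Suc k"
proof (induction k)
  case 0
  then show ?case by simp
next
  case (Suc k)
  let ?m = "l2 g + l2 (\<lambda>x. \<phi> x / soft_norm e x)"
  have m: "0 \<le> ?m" by simp
  have "l2 (\<lambda>x. \<phi> x ^ Suc (Suc k) / soft_norm e x)
    \<le> l2 (\<lambda>x. \<phi> x ^ Suc k / soft_norm e x) * (real (Suc (Suc k)) * l2 g + l2 (\<lambda>x. \<phi> x / soft_norm e x))"
    using weighted_power_step[OF assms, of k] by simp
  also have "\<dots> \<le> (fact (Suc k) * ?m ^ Suc k) * (real (Suc (Suc k)) * ?m)"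
  proof (rule mult_mono[OF Suc.IH])
    have "1 * l2 (\<lambda>x. \<phi> x / soft_norm e x) \<le> real (Suc (Suc k)) * l2 (\<lambda>x. \<phi> x / soft_norm e x)"
      by (rule mult_right_mono) auto
    then show "real (Suc (Suc k)) * l2 g + l2 (\<lambda>x. \<phi> x / soft_norm e x) \<le> real (Suc (Suc k)) * ?m"
      by (simp only: distrib_left)
  qed (use m in auto)
  also have "\<dots> = fact (Suc (Suc k)) * ?m ^ Suc (Suc k)"
    by (simp only: fact_Suc[of "Suc k"] power_Suc[of ?m "Suc k"] of_nat_mult mult_ac)
  finally show ?case .
qed

lemma soft_norm_quotient_L2:
  assumes "L2 f" "e > 0"
  shows "L2 (\<lambda>x. f x / soft_norm e x)" "l2 (\<lambda>x. f x / soft_norm e x) \<le> 1 / e * l2 f"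
proof -
  have m: "(\<lambda>x. f x / soft_norm e x) \<in> borel_measurable borel"
    using L2_measurable[OF assms(1)] by measurable
  have le: "norm (f x / soft_norm e x) \<le> 1 / e * norm (f x)" for x
  proof -
    have "\<bar>f x\<bar> / soft_norm e x \<le> \<bar>f x\<bar> / e"
      using soft_norm_ge[OF assms(2), of x] assms(2) by (intro divide_left_mono) auto
    then show ?thesis using soft_norm_pos[OF assms(2), of x] by simp
  qed
  show "L2 (\<lambda>x. f x / soft_norm e x)" "l2 (\<lambda>x. f x / soft_norm e x) \<le> 1 / e * l2 f"
    using L2_bound[OF assms(1) m le] assms(2) by auto
qed

text \<open>The approximating test functions need not have zero means, so their bound involves the
  quotient by \<open>soft_norm e\<close>. For fixed e this quotient depends continuously on the
  function in L2, and in the limit the Hardy inequality for v bounds it by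
  \<open>2 * pi * l2 g\<close>.\<close>

lemma rot_mean_zero_soft_power_estimate:
  assumes p: "H1_pair \<Omega> v g" and zero: "rot_mean_zero v" and e: "e > 0"
  shows "(\<integral>\<^sup>+x. ennreal ((v x ^ Suc k / soft_norm e x)\<^sup>2) \<partial>lborel)
    \<le> ennreal ((fact (Suc k) * ((1 + 2 * pi) * l2 g) ^ Suc k)\<^sup>2)"
proof -
  let ?s = "soft_norm e"
  obtain \<phi> where q: "L2 v" "L2 g" "\<And>n::nat. test_function \<Omega> (\<phi> n)"
    "(\<lambda>n. l2 (\<lambda>x. \<phi> n x - v x)) \<longlonglongrightarrow> 0" "(\<lambda>n. l2 (\<lambda>x. grad (\<phi> n) x - g x)) \<longlonglongrightarrow> 0"
    using p unfolding H1_pair_def by blast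
  note L = test_function_L2[OF q(3)]
  have [measurable]: "\<phi> n \<in> borel_measurable borel" "v \<in> borel_measurable borel" for n
    using L(1) q(1) by (auto simp: L2_def)
  obtain r where r: "strict_mono r" and AE: "AE x in lborel. (\<lambda>n. \<phi> (r n) x) \<longlonglongrightarrow> v x"
    using L2_AE_subseq[OF L(1) q(1) q(4)] by metis
  have vs: "l2 (\<lambda>x. v x / ?s x) \<le> 2 * pi * l2 g"
    by (rule L2_nn_integralI(2))
      (use rot_mean_zero_weighted_estimate[OF p zero e] in \<open>auto simp: power_divide\<close>)
  \<comment> \<open>The constant 1/e blows up as e tends to 0, so e stays fixed until n has been
    sent to infinity.\<close>
  have "(\<lambda>n. l2 (\<lambda>x. \<phi> n x / ?s x - v x / ?s x)) \<longlonglongrightarrow> 0"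
  proof (rule Lim_null_comparison)
    show "(\<lambda>n. 1 / e * l2 (\<lambda>x. \<phi> n x - v x)) \<longlonglongrightarrow> 0"
      by (rule tendsto_mult_right_zero[OF q(4)])
    show "\<forall>\<^sub>F n in sequentially. norm (l2 (\<lambda>x. \<phi> n x / ?s x - v x / ?s x)) \<le> 1 / e * l2 (\<lambda>x. \<phi> n x - v x)"
      using soft_norm_quotient_L2(2)[OF L2_diff[OF L(1) q(1)] e]
      by (intro always_eventually allI) (simp add: diff_divide_distrib)
  qed
  then have ls: "(\<lambda>n. l2 (\<lambda>x. \<phi> n x / ?s x)) \<longlonglongrightarrow> l2 (\<lambda>x. v x / ?s x)"
    by (intro l2_tendsto soft_norm_quotient_L2(1) L q e)
  define b where "b n = (fact (Suc k) * (l2 (grad (\<phi> n)) + l2 (\<lambda>x. \<phi> n x / ?s x)) ^ Suc k)\<^sup>2" for n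
  have "b \<longlonglongrightarrow> (fact (Suc k) * (l2 g + l2 (\<lambda>x. v x / ?s x)) ^ Suc k)\<^sup>2"
    unfolding b_def by (intro tendsto_intros ls l2_tendsto[OF L(2) q(2) q(5)])
  then have b_lim: "(\<lambda>n. ennreal (b (r n))) \<longlonglongrightarrow> ennreal ((fact (Suc k) * (l2 g + l2 (\<lambda>x. v x / ?s x)) ^ Suc k)\<^sup>2)"
    using LIMSEQ_subseq_LIMSEQ[OF _ r] by (intro tendsto_ennrealI) (auto simp: o_def)
  have bn: "(\<integral>\<^sup>+x. ennreal ((\<phi> n x ^ Suc k / ?s x)\<^sup>2) \<partial>lborel) \<le> ennreal (b n)" for n
  proof -
    obtain K where C: "C1_compact (\<phi> n) (grad (\<phi> n)) K"
      using test_function_C1_compact[OF q(3)] by metis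
    have "L2 (\<lambda>x. \<phi> n x ^ Suc k / ?s x)"
      using C1_compact_L2(1)[OF C1_compact_weighted_power[OF C e]] .
    from L2_nn_integral[OF this]
    have "(\<integral>\<^sup>+x. ennreal ((\<phi> n x ^ Suc k / ?s x)\<^sup>2) \<partial>lborel) = ennreal ((l2 (\<lambda>x. \<phi> n x ^ Suc k / ?s x))\<^sup>2)"
      by (simp only: real_norm_def power2_abs)
    also have "\<dots> \<le> ennreal (b n)"
      unfolding b_def by (intro ennreal_leI power_mono weighted_power_bound[OF C e] l2_nonneg)
    finally show ?thesis .
  qed
  have "(\<integral>\<^sup>+x. ennreal ((v x ^ Suc k / ?s x)\<^sup>2) \<partial>lborel)
      \<le> ennreal ((fact (Suc k) * (l2 g + l2 (\<lambda>x. v x / ?s x)) ^ Suc k)\<^sup>2)"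
  proof (rule nn_integral_le_AE_limit[OF _ _ bn b_lim])
    show "AE x in lborel. (\<lambda>n. ennreal ((\<phi> (r n) x ^ Suc k / ?s x)\<^sup>2)) \<longlonglongrightarrow> ennreal ((v x ^ Suc k / ?s x)\<^sup>2)"
      using AE
    proof eventually_elim
      case (elim x)
      show ?case unfolding divide_inverse by (intro tendsto_ennrealI tendsto_intros elim)
    qed
  qed measurable
  also have "\<dots> \<le> ennreal ((fact (Suc k) * ((1 + 2 * pi) * l2 g) ^ Suc k)\<^sup>2)"
    using vs
    by (intro ennreal_leI power_mono mult_left_mono) (auto simp: algebra_simps)
  finally show ?thesis .
qed

text \<open>The bound does not depend on e, so Fatou's lemma removes the regularisation.\<close>

lemma rot_mean_zero_power_estimate:
  assumes p: "H1_pair \<Omega> v g" and zero: "rot_mean_zero v"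
  shows "(\<integral>\<^sup>+x. ennreal ((v x ^ Suc k / norm x)\<^sup>2) \<partial>lborel)
    \<le> ennreal ((fact (Suc k) * ((1 + 2 * pi) * l2 g) ^ Suc k)\<^sup>2)" (is "_ \<le> ?B")
proof -
  have [measurable]: "v \<in> borel_measurable borel"
    using p by (auto simp: H1_pair_def L2_def)
  define e where "e n = inverse (real (Suc n))" for n
  have e: "e n > 0" for n by (simp add: e_def)
  show ?thesis
  proof (rule nn_integral_le_AE_limit[OF _ _ rot_mean_zero_soft_power_estimate[OF p zero e] tendsto_const])
    show "AE x in lborel. (\<lambda>n. ennreal ((v x ^ Suc k / soft_norm (e n) x)\<^sup>2)) \<longlonglongrightarrow> ennreal ((v x ^ Suc k / norm x)\<^sup>2)"
      using AE_lborel_singleton[of "0::real^2"]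
    proof eventually_elim
      case (elim x)
      have "(\<lambda>n. soft_norm (e n) x) \<longlonglongrightarrow> sqrt ((norm x)\<^sup>2 + 0\<^sup>2)"
        unfolding soft_norm_def e_def by (intro tendsto_intros LIMSEQ_inverse_real_of_nat)
      then show ?case
        using elim by (intro tendsto_ennrealI tendsto_intros) auto
    qed
  qed measurable
qed

text \<open>Inside the unit disc, division by \<open>norm x\<close> can only increase |v| away from
  the origin, so the case k = 0 of the weighted estimate contains a Poincare inequality.\<close>

lemma rot_mean_zero_poincare:
  assumes p: "H1_pair disc v g" and zero: "rot_mean_zero v" and out: "\<And>x. x \<notin> disc \<Longrightarrow> v x = 0"
  shows "l2 v \<le> (1 + 2 * pi) * l2 g"
proof -
  have m: "v \<in> borel_measurable borel"
    using p by (auto simp: H1_pair_def L2_def)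
  have "(\<integral>\<^sup>+x. ennreal ((norm (v x))\<^sup>2) \<partial>lborel) \<le> (\<integral>\<^sup>+x. ennreal ((v x ^ Suc 0 / norm x)\<^sup>2) \<partial>lborel)"
    using AE_lborel_singleton[of "0::real^2"]
  proof (intro nn_integral_mono_AE, eventually_elim)
    case (elim x)
    have "\<bar>v x\<bar> \<le> \<bar>v x\<bar> / norm x"
    proof (cases "x \<in> disc")
      case True
      then have "norm x * \<bar>v x\<bar> \<le> 1 * \<bar>v x\<bar>" by (intro mult_right_mono) auto
      then show ?thesis using elim by (simp add: field_simps)
    qed (simp add: out)
    from power_mono[OF this, of 2] show "ennreal ((norm (v x))\<^sup>2) \<le> ennreal ((v x ^ Suc 0 / norm x)\<^sup>2)"
      by (simp add: power_divide ennreal_leI)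
  qed
  also have "\<dots> \<le> ennreal (((1 + 2 * pi) * l2 g)\<^sup>2)"
    using rot_mean_zero_power_estimate[OF p zero, of 0] by simp
  finally show ?thesis
    by (rule L2_nn_integralI(2)[OF m]) simp
qed

section \<open>Rellich compactness\<close>

text \<open>Translation is the time-one map of the flow with constant velocity z. The bound d stands
  in for \<open>norm z\<close> because a speed bound must be positive and z may be 0.\<close>

lemma translation_difference_estimate:
  assumes p: "H1_pair \<Omega> v g" and d: "norm z \<le> d" "d > 0"
  shows "(\<integral>\<^sup>+x. ennreal ((v (x + z) - v x)\<^sup>2) \<partial>lborel) \<le> ennreal (d\<^sup>2 * (l2 g)\<^sup>2)"
proof -
  have [measurable]: "v \<in> borel_measurable borel"
    using p by (auto simp: H1_pair_def L2_def)
  have "(\<integral>\<^sup>+x. ennreal ((v (x + z) - v x)\<^sup>2 / d\<^sup>2) \<partial>lborel) \<le> ennreal (1\<^sup>2 * (l2 g)\<^sup>2)"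
  proof (rule H1_pair_difference_estimate[OF p measure_preserving_translation])
    fix \<phi> assume "test_function \<Omega> \<phi>"
    then obtain K where C: "C1_compact \<phi> (grad \<phi>) K"
      by (rule test_function_C1_compact)
    have "(\<integral>\<^sup>+x. ennreal ((\<phi> (x + 1 *\<^sub>R z) - \<phi> (x + 0 *\<^sub>R z))\<^sup>2 / d\<^sup>2) \<partial>lborel) \<le> ennreal (1\<^sup>2 * (l2 (grad \<phi>))\<^sup>2)"
    proof (rule flow_difference_estimate[OF C measure_preserving_translation, where F'="\<lambda>s x. z"])
      show "continuous_on UNIV (\<lambda>p. snd p + fst p *\<^sub>R z)" by (intro continuous_intros)
      show "((\<lambda>s. x + s *\<^sub>R z) has_vector_derivative z) (at s)" for s and x :: 'a
        by (auto intro!: derivative_eq_intros)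
    qed (use d in auto)
    then show "(\<integral>\<^sup>+x. ennreal ((\<phi> (x + z) - \<phi> x)\<^sup>2 / d\<^sup>2) \<partial>lborel) \<le> ennreal (1\<^sup>2 * (l2 (grad \<phi>))\<^sup>2)"
      by simp
  qed measurable
  then have "ennreal (d\<^sup>2) * (\<integral>\<^sup>+x. ennreal ((v (x + z) - v x)\<^sup>2 / d\<^sup>2) \<partial>lborel) \<le> ennreal (d\<^sup>2) * ennreal ((l2 g)\<^sup>2)"
    by (intro mult_left_mono) auto
  also have "ennreal (d\<^sup>2) * (\<integral>\<^sup>+x. ennreal ((v (x + z) - v x)\<^sup>2 / d\<^sup>2) \<partial>lborel)
    = (\<integral>\<^sup>+x. ennreal (d\<^sup>2) * ennreal ((v (x + z) - v x)\<^sup>2 / d\<^sup>2) \<partial>lborel)"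
    by (rule nn_integral_cmult[symmetric]) measurable
  also have "\<dots> = (\<integral>\<^sup>+x. ennreal ((v (x + z) - v x)\<^sup>2) \<partial>lborel)"
    using d by (intro nn_integral_cong) (simp add: ennreal_mult'[symmetric])
  finally show ?thesis by (simp add: ennreal_mult'[symmetric])
qed

section \<open>Averages over the squares of a grid\<close>

definition cell :: "real \<Rightarrow> real^2 \<Rightarrow> int \<times> int" where
  "cell h x = (\<lfloor>x$1 / h\<rfloor>, \<lfloor>x$2 / h\<rfloor>)"

definition square :: "real \<Rightarrow> int \<times> int \<Rightarrow> (real^2) set" where
  "square h j = {x. cell h x = j}"

lemma square_bounds:
  assumes "h > 0"
  shows "x \<in> square h j \<longleftrightarrow> h * of_int (fst j) \<le> x$1 \<and> x$1 < h * (of_int (fst j) + 1) \<and>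
    h * of_int (snd j) \<le> x$2 \<and> x$2 < h * (of_int (snd j) + 1)"
proof -
  have "\<lfloor>y / h\<rfloor> = i \<longleftrightarrow> h * of_int i \<le> y \<and> y < h * (of_int i + 1)" for y i
    using assms by (simp add: floor_eq_iff field_simps)
  then show ?thesis by (cases j) (auto simp: square_def cell_def)
qed

lemma square_measure:
  assumes h: "h > 0"
  shows "square h j \<in> sets borel" "emeasure lborel (square h j) = ennreal (h\<^sup>2)"
proof -
  let ?l = "vector [h * of_int (fst j), h * of_int (snd j)] :: real^2"
  let ?u = "vector [h * (of_int (fst j) + 1), h * (of_int (snd j) + 1)] :: real^2"
  have eq: "square h j = {x. h * of_int (fst j) \<le> x$1} \<inter> {x. x$1 < h * (of_int (fst j) + 1)} \<inter>
    {x. h * of_int (snd j) \<le> x$2} \<inter> {x. x$2 < h * (of_int (snd j) + 1)}"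
    unfolding set_eq_iff using square_bounds[OF h, of _ j] by simp
  have [measurable]: "(\<lambda>x::real^2. x $ i) \<in> borel_measurable borel" for i
    by (intro borel_measurable_continuous_onI continuous_intros)
  show m: "square h j \<in> sets borel"
    unfolding eq by measurable
  have le: "\<And>b. b \<in> Basis \<Longrightarrow> ?l \<bullet> b \<le> ?u \<bullet> b"
    using h by (auto simp: Basis_real2 inner_axis)
  have vol: "(\<Prod>b\<in>Basis. (?u - ?l) \<bullet> b) = h\<^sup>2"
    by (simp add: Basis_real2 axis_eq_axis inner_axis inner_simps algebra_simps power2_eq_square)
  have sub: "box ?l ?u \<subseteq> square h j" "square h j \<subseteq> cbox ?l ?u"
    by (auto simp: square_bounds[OF h] mem_box_cart forall_2)
  have "ennreal (h\<^sup>2) \<le> emeasure lborel (square h j)"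
    using emeasure_mono[OF sub(1), of lborel] m le vol by (simp add: emeasure_lborel_box)
  moreover have "emeasure lborel (square h j) \<le> ennreal (h\<^sup>2)"
    using emeasure_mono[OF sub(2), of lborel] le vol by (simp add: emeasure_lborel_cbox)
  ultimately show "emeasure lborel (square h j) = ennreal (h\<^sup>2)" by simp
qed

text \<open>Over a square of area h^2, \<open>h\<^sup>2 * v x\<close> is the integral of v minus the
  integral of \<open>v y - v x\<close>; squaring with (a + b)^2 \<le> 2 a^2 + 2 b^2 separates the
  two. The integral of v is not divided by the area, whence the power h^4.\<close>

lemma square_mean_pointwise:
  assumes v: "L2 v" and h: "h > 0" and x: "x \<in> square h j"
  shows "ennreal ((v x)\<^sup>2) \<le> ennreal (2 / h\<^sup>2) * (\<integral>\<^sup>+y. indicator (square h j) y * ennreal ((v y - v x)\<^sup>2) \<partial>lborel)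
    + ennreal (2 / h ^ 4 * (LINT y:square h j|lborel. v y)\<^sup>2)"
proof -
  let ?Q = "square h j"
  have [measurable]: "v \<in> borel_measurable borel" using v by (simp add: L2_def)
  have Q: "?Q \<in> sets borel" "emeasure lborel ?Q < \<infinity>" "measure lborel ?Q = h\<^sup>2"
    using square_measure[OF h, of j] by (auto simp: measure_def)
  note [measurable] = Q(1)
  define k where "k y = indicator ?Q y *\<^sub>R (v y - v x)" for y
  have k: "L2 k"
  proof -
    have "L2 (\<lambda>y. indicator ?Q y *\<^sub>R v y - v x *\<^sub>R indicator ?Q y)"
      by (intro L2_diff L2_scaleR L2_indicator_scaleR(1)[OF v] L2_indicator Q)
    then show ?thesis by (simp add: k_def[abs_def] algebra_simps)
  qed
  let ?m = "LINT y:?Q|lborel. v y"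
  have vi: "integrable lborel (\<lambda>y. indicator ?Q y *\<^sub>R v y)"
    using L2_set_integrable(1)[OF v Q(1,2)] by (simp add: set_integrable_def)
  have ci: "integrable lborel (\<lambda>y. indicator ?Q y *\<^sub>R v x)"
    using Q by (intro integrable_scaleR_left integrable_real_indicator) auto
  have "(LINT y:?Q|lborel. k y) = (LINT y|lborel. indicator ?Q y *\<^sub>R v y - indicator ?Q y *\<^sub>R v x)"
    unfolding set_lebesgue_integral_def k_def
    by (intro Bochner_Integration.integral_cong) (auto simp: indicator_def)
  also have "\<dots> = ?m - h\<^sup>2 * v x"
    using vi ci Q by (simp add: set_lebesgue_integral_def)
  finally have "h\<^sup>2 * v x = ?m - (LINT y:?Q|lborel. k y)" by simp
  then have "\<bar>h\<^sup>2 * v x\<bar> \<le> \<bar>?m\<bar> + h * l2 k"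
    using L2_set_integrable(3)[OF k Q(1,2)] Q(3) h by simp
  then have "(h\<^sup>2 * v x)\<^sup>2 \<le> (\<bar>?m\<bar> + h * l2 k)\<^sup>2"
    using power_mono[of "\<bar>h\<^sup>2 * v x\<bar>" "\<bar>?m\<bar> + h * l2 k" 2] by simp
  also have "\<dots> \<le> 2 * ?m\<^sup>2 + 2 * (h * l2 k)\<^sup>2"
    using sum_squares_bound[of "\<bar>?m\<bar>" "h * l2 k"] by (simp add: power2_sum)
  finally have "(v x)\<^sup>2 \<le> (2 * ?m\<^sup>2 + 2 * (h * l2 k)\<^sup>2) / h ^ 4"
    using h by (simp add: pos_le_divide_eq power_mult_distrib mult.commute)
  also have "\<dots> = 2 / h\<^sup>2 * (l2 k)\<^sup>2 + 2 / h ^ 4 * ?m\<^sup>2"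
    using h by (simp add: field_simps power2_eq_square power4_eq_xxxx)
  finally have "(v x)\<^sup>2 \<le> 2 / h\<^sup>2 * (l2 k)\<^sup>2 + 2 / h ^ 4 * ?m\<^sup>2" .
  then have "ennreal ((v x)\<^sup>2) \<le> ennreal (2 / h\<^sup>2 * (l2 k)\<^sup>2 + 2 / h ^ 4 * ?m\<^sup>2)"
    by (rule ennreal_leI)
  also have "\<dots> = ennreal (2 / h\<^sup>2 * (l2 k)\<^sup>2) + ennreal (2 / h ^ 4 * ?m\<^sup>2)"
    by (rule ennreal_plus) auto
  also have "ennreal (2 / h\<^sup>2 * (l2 k)\<^sup>2) = ennreal (2 / h\<^sup>2) * ennreal ((l2 k)\<^sup>2)"
    by (rule ennreal_mult) auto
  also have "ennreal ((l2 k)\<^sup>2) = (\<integral>\<^sup>+y. indicator ?Q y * ennreal ((v y - v x)\<^sup>2) \<partial>lborel)"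
    unfolding L2_nn_integral[OF k, symmetric]
    by (intro nn_integral_cong) (auto simp: k_def indicator_def)
  finally show ?thesis .
qed

text \<open>Two points of one square differ by a vector of [-h, h]^2, of length at most 2 h. After
  the substitution z = y - x each z costs (2 h)^2 times the energy, and these vectors fill an area
  of 4 h^2.\<close>

lemma cell_double_integral_estimate:
  assumes p: "H1_pair \<Omega> v g" and h: "h > 0"
  shows "(\<integral>\<^sup>+x. (\<integral>\<^sup>+y. indicator (square h (cell h x)) y * ennreal ((v y - v x)\<^sup>2) \<partial>lborel) \<partial>lborel)
    \<le> ennreal (16 * h ^ 4 * (l2 g)\<^sup>2)"
proof -
  have [measurable]: "v \<in> borel_measurable borel"
    using p by (auto simp: H1_pair_def L2_def)
  let ?B = "cbox (vector [- h, - h]) (vector [h, h]) :: (real^2) set"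
  have shift: "(\<integral>\<^sup>+y. f y \<partial>lborel) = (\<integral>\<^sup>+z. f (z + x) \<partial>lborel)" if "f \<in> borel_measurable borel"
    for f :: "real^2 \<Rightarrow> ennreal" and x
    using measure_preserving_nn_integral[OF measure_preserving_translation that] by simp
  have near: "y - x \<in> ?B" if "y \<in> square h (cell h x)" for x y
    using that square_bounds[OF h, of y "cell h x"] square_bounds[OF h, of x "cell h x"]
    by (auto simp: mem_box_cart forall_2 square_def algebra_simps)
  have small: "norm z \<le> 2 * h" if "z \<in> ?B" for z
  proof -
    have "\<bar>z$1\<bar> \<le> h" "\<bar>z$2\<bar> \<le> h" using that by (auto simp: mem_box_cart forall_2 abs_le_iff)
    moreover have "norm z \<le> \<bar>z$1\<bar> + \<bar>z$2\<bar>"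
      using norm_le_l1_cart[of z] by (simp add: sum_2)
    ultimately show ?thesis by linarith
  qed
  have vol: "emeasure lborel ?B = ennreal (4 * h\<^sup>2)"
    using h by (subst emeasure_lborel_cbox)
      (auto simp: Basis_real2 axis_eq_axis inner_axis inner_simps power2_eq_square)
  have "(\<integral>\<^sup>+x. (\<integral>\<^sup>+y. indicator (square h (cell h x)) y * ennreal ((v y - v x)\<^sup>2) \<partial>lborel) \<partial>lborel)
    \<le> (\<integral>\<^sup>+x. (\<integral>\<^sup>+y. indicator ?B (y - x) * ennreal ((v y - v x)\<^sup>2) \<partial>lborel) \<partial>lborel)"
    using near by (intro nn_integral_mono) (auto simp: indicator_def)
  also have "\<dots> = (\<integral>\<^sup>+x. (\<integral>\<^sup>+z. indicator ?B z * ennreal ((v (x + z) - v x)\<^sup>2) \<partial>lborel) \<partial>lborel)"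
  proof (rule nn_integral_cong)
    fix x
    have "(\<integral>\<^sup>+y. indicator ?B (y - x) * ennreal ((v y - v x)\<^sup>2) \<partial>lborel)
      = (\<integral>\<^sup>+z. indicator ?B (z + x - x) * ennreal ((v (z + x) - v x)\<^sup>2) \<partial>lborel)"
      by (rule shift) measurable
    then show "(\<integral>\<^sup>+y. indicator ?B (y - x) * ennreal ((v y - v x)\<^sup>2) \<partial>lborel)
      = (\<integral>\<^sup>+z. indicator ?B z * ennreal ((v (x + z) - v x)\<^sup>2) \<partial>lborel)"
      by (simp add: add.commute)
  qed
  also have "\<dots> = (\<integral>\<^sup>+z. (\<integral>\<^sup>+x. indicator ?B z * ennreal ((v (x + z) - v x)\<^sup>2) \<partial>lborel) \<partial>lborel)"
    by (rule lborel_pair.Fubini') measurable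
  also have "\<dots> \<le> (\<integral>\<^sup>+z. ennreal ((2 * h)\<^sup>2 * (l2 g)\<^sup>2) * indicator ?B z \<partial>lborel)"
    using translation_difference_estimate[OF p small] h
    by (intro nn_integral_mono) (auto simp: indicator_def)
  also have "\<dots> = ennreal ((2 * h)\<^sup>2 * (l2 g)\<^sup>2) * ennreal (4 * h\<^sup>2)"
    by (subst nn_integral_cmult_indicator) (auto simp: vol)
  also have "\<dots> = ennreal (16 * h ^ 4 * (l2 g)\<^sup>2)"
    by (simp add: ennreal_mult'[symmetric] power_mult_distrib power2_eq_square power4_eq_xxxx mult_ac)
  finally show ?thesis .
qed

lemma finite_cells: "h > 0 \<Longrightarrow> finite (cell h ` disc)"
proof (rule finite_subset)
  assume h: "h > 0"
  show "cell h ` disc \<subseteq> {\<lfloor>- 1 / h\<rfloor>..\<lfloor>1 / h\<rfloor>} \<times> {\<lfloor>- 1 / h\<rfloor>..\<lfloor>1 / h\<rfloor>}"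
  proof safe
    fix x :: "real^2" and a b assume x: "x \<in> disc" and ab: "(a, b) = cell h x"
    have "\<lfloor>x $ i / h\<rfloor> \<in> {\<lfloor>- 1 / h\<rfloor>..\<lfloor>1 / h\<rfloor>}" for i
    proof -
      have "\<bar>x $ i\<bar> \<le> 1" using component_le_norm_cart[of x i] x by simp
      then have "- 1 / h \<le> x $ i / h" "x $ i / h \<le> 1 / h"
        using h divide_right_mono[of "- 1" "x $ i" h] divide_right_mono[of "x $ i" 1 h] by auto
      then show ?thesis by (auto intro!: floor_mono)
    qed
    then show "a \<in> {\<lfloor>- 1 / h\<rfloor>..\<lfloor>1 / h\<rfloor>}" "b \<in> {\<lfloor>- 1 / h\<rfloor>..\<lfloor>1 / h\<rfloor>}"
      using ab by (auto simp: cell_def)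
  qed
qed simp

text \<open>Up to a term of order h^2 times the energy, the L2 norm is controlled by finitely many
  numbers, and this is the source of compactness. The factor pi is the area of the disc.\<close>

lemma square_means_control:
  assumes p: "H1_pair disc v g" and h: "h > 0" and out: "\<And>x. x \<notin> disc \<Longrightarrow> v x = 0"
  shows "(l2 v)\<^sup>2 \<le> 32 * h\<^sup>2 * (l2 g)\<^sup>2
    + 2 * pi / h ^ 4 * (\<Sum>j\<in>cell h ` disc. (LINT y:square h j|lborel. v y)\<^sup>2)"
proof -
  have v: "L2 v" using p by (auto simp: H1_pair_def)
  have [measurable]: "v \<in> borel_measurable borel" using v by (auto simp: L2_def)
  let ?m = "\<lambda>j. (LINT y:square h j|lborel. v y)\<^sup>2"
  define S where "S = (\<Sum>j\<in>cell h ` disc. ?m j)"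
  have S0: "0 \<le> S" by (auto simp: S_def intro: sum_nonneg)
  let ?D = "\<lambda>x. \<integral>\<^sup>+y. indicator (square h (cell h x)) y * ennreal ((v y - v x)\<^sup>2) \<partial>lborel"
  have [measurable]: "?D \<in> borel_measurable borel"
  proof -
    have "(\<lambda>x. \<integral>\<^sup>+y. indicator {p. cell h (fst p) = cell h (snd p)} (x, y) * ennreal ((v y - v x)\<^sup>2) \<partial>lborel) \<in> borel_measurable borel"
    proof (rule lborel.borel_measurable_nn_integral)
      \<comment> \<open>Lying in a common square is a countable union of products of squares, which
        makes the inner integral measurable in x.\<close>
      have "{p. cell h (fst p) = cell h (snd p)} = (\<Union>j. square h j \<times> square h j)"
        by (auto simp: square_def)
      moreover have "(\<Union>j. square h j \<times> square h j) \<in> sets (borel \<Otimes>\<^sub>M borel)"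
        using square_measure(1)[OF h] by (intro sets.countable_UN) auto
      ultimately have [measurable]: "{p. cell h (fst p) = cell h (snd p)} \<in> sets (borel \<Otimes>\<^sub>M borel)"
        by simp
      show "(\<lambda>(x, y). indicator {p. cell h (fst p) = cell h (snd p)} (x, y) * ennreal ((v y - v x)\<^sup>2)) \<in> borel_measurable (borel \<Otimes>\<^sub>M lborel)"
        by measurable
    qed
    also have "(\<lambda>x. \<integral>\<^sup>+y. indicator {p. cell h (fst p) = cell h (snd p)} (x, y) * ennreal ((v y - v x)\<^sup>2) \<partial>lborel) = ?D"
      by (auto simp: square_def indicator_def fun_eq_iff intro!: nn_integral_cong)
    finally show ?thesis .
  qed
  have [measurable]: "(indicator disc :: real^2 \<Rightarrow> ennreal) \<in> borel_measurable borel"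
    by (intro borel_measurable_indicator) simp
  have "ennreal ((l2 v)\<^sup>2) = (\<integral>\<^sup>+x. ennreal ((norm (v x))\<^sup>2) \<partial>lborel)"
    using L2_nn_integral[OF v] by simp
  also have "\<dots> \<le> (\<integral>\<^sup>+x. ennreal (2 / h\<^sup>2) * ?D x + ennreal (2 / h ^ 4 * S) * indicator disc x \<partial>lborel)"
  proof (rule nn_integral_mono)
    fix x
    show "ennreal ((norm (v x))\<^sup>2) \<le> ennreal (2 / h\<^sup>2) * ?D x + ennreal (2 / h ^ 4 * S) * indicator disc x"
    proof (cases "x \<in> disc")
      case True
      have "ennreal ((v x)\<^sup>2) \<le> ennreal (2 / h\<^sup>2) * ?D x + ennreal (2 / h ^ 4 * ?m (cell h x))"
        by (rule square_mean_pointwise[OF v h]) (simp add: square_def)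
      also have "\<dots> \<le> ennreal (2 / h\<^sup>2) * ?D x + ennreal (2 / h ^ 4 * S)"
      proof (intro add_left_mono ennreal_leI mult_left_mono)
        show "?m (cell h x) \<le> S"
          unfolding S_def using True finite_cells[OF h] by (intro member_le_sum) auto
      qed (use h in auto)
      finally show ?thesis using True by simp
    qed (simp add: out)
  qed
  also have "\<dots> = ennreal (2 / h\<^sup>2) * (\<integral>\<^sup>+x. ?D x \<partial>lborel) + ennreal (2 / h ^ 4 * S) * emeasure lborel disc"
    by (subst nn_integral_add) (auto simp: nn_integral_cmult nn_integral_cmult_indicator)
  also have "\<dots> \<le> ennreal (2 / h\<^sup>2) * ennreal (16 * h ^ 4 * (l2 g)\<^sup>2) + ennreal (2 / h ^ 4 * S) * ennreal pi"
    using cell_double_integral_estimate[OF p h]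
    by (intro add_mono mult_left_mono) (auto simp: emeasure_ball unit_ball_vol_2)
  also have "\<dots> = ennreal (2 / h\<^sup>2 * (16 * h ^ 4 * (l2 g)\<^sup>2) + 2 / h ^ 4 * S * pi)"
    using h S0 by (simp add: ennreal_mult'[symmetric] ennreal_plus[symmetric] del: ennreal_plus)
  finally have "(l2 v)\<^sup>2 \<le> 2 / h\<^sup>2 * (16 * h ^ 4 * (l2 g)\<^sup>2) + 2 / h ^ 4 * S * pi"
    using h S0 by (subst (asm) ennreal_le_iff) auto
  also have "\<dots> = 32 * h\<^sup>2 * (l2 g)\<^sup>2 + 2 * pi / h ^ 4 * S"
    using h by (simp add: field_simps power2_eq_square power4_eq_xxxx)
  finally show ?thesis unfolding S_def .
qed

text \<open>The integrals over all squares of the grids of side 1/(m + 1) form a countable,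
  uniformly bounded family, so a diagonal subsequence makes all of them converge. Applied to
  differences of members, the grid estimate then gives the Cauchy property.\<close>

lemma rellich:
  assumes p: "\<And>n::nat. H1_pair disc (v n) (g n)" and zero: "\<And>n. rot_mean_zero (v n)"
    and out: "\<And>n x. x \<notin> disc \<Longrightarrow> v n x = 0" and B: "\<And>n. l2 (g n) \<le> B"
  obtains r w where "strict_mono (r :: nat \<Rightarrow> nat)" "L2 w" "\<forall>x. x \<notin> disc \<longrightarrow> w x = 0"
    "(\<lambda>n. l2 (\<lambda>x. v (r n) x - w x)) \<longlonglongrightarrow> 0"
proof -
  have L: "L2 (v n)" "L2 (g n)" for n using p by (auto simp: H1_pair_def)
  define h where "h m = inverse (real (Suc m))" for m
  have h: "h m > 0" "h m \<le> 1" for m by (auto simp: h_def field_simps)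
  define f where "f n = (\<lambda>(m, j). LINT y:square (h m) j|lborel. v n y)" for n
  have fb: "norm (f n q) \<le> (1 + 2 * pi) * B" for n q
  proof -
    obtain m j where Pair: "q = (m, j)" by (metis surj_pair)
    have "norm (f n q) \<le> sqrt (measure lborel (square (h m) j)) * l2 (v n)"
      unfolding f_def Pair prod.case
      by (rule L2_set_integrable(3)[OF L(1)]) (use square_measure[OF h(1)] in auto)
    also have "\<dots> \<le> 1 * ((1 + 2 * pi) * l2 (g n))"
      using rot_mean_zero_poincare[OF p zero out, of n] h[of m] square_measure(2)[OF h(1)]
      by (intro mult_mono) (auto simp: measure_def)
    also have "\<dots> \<le> (1 + 2 * pi) * B"
      using B[of n] by (simp add: mult_left_mono)
    finally show ?thesis .
  qed
  obtain r where r: "strict_mono r" and conv: "\<And>q. \<exists>l. (\<lambda>n. f (r n) q) \<longlonglongrightarrow> l"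
    using function_convergent_subsequence[of UNIV f "(1 + 2 * pi) * B"] fb by auto
  obtain l where l: "\<And>q. (\<lambda>n. f (r n) q) \<longlonglongrightarrow> l q" using conv by metis
  define s where "s m n = (\<Sum>j\<in>cell (h m) ` disc. (f (r n) (m, j) - l (m, j))\<^sup>2)" for m n
  have s: "s m \<longlonglongrightarrow> 0" for m
  proof -
    have "s m \<longlonglongrightarrow> (\<Sum>j\<in>cell (h m) ` disc. (l (m, j) - l (m, j))\<^sup>2)"
      unfolding s_def by (intro tendsto_intros l)
    then show ?thesis by simp
  qed
  have key: "(l2 (\<lambda>x. v (r i) x - v (r k) x))\<^sup>2 \<le> 128 * (h m)\<^sup>2 * B\<^sup>2 + 4 * pi / h m ^ 4 * (s m i + s m k)" for i k m
  proof -
    have pd: "H1_pair disc (\<lambda>x. v (r i) x - v (r k) x) (\<lambda>x. g (r i) x - g (r k) x)"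
      using H1_pair_diff p by blast
    have "l2 (\<lambda>x. g (r i) x - g (r k) x) \<le> 2 * B"
      using l2_triangle[OF L(2) L2_minus[OF L(2)], of "r i" "r k"] B[of "r i"] B[of "r k"]
      by (simp add: l2_minus)
    from power_mono[OF this, of 2] have gB: "(l2 (\<lambda>x. g (r i) x - g (r k) x))\<^sup>2 \<le> 4 * B\<^sup>2"
      by (simp add: power_mult_distrib)
    have diff: "(LINT y:square (h m) j|lborel. v (r i) y - v (r k) y) = f (r i) (m, j) - f (r k) (m, j)" for j
      unfolding f_def prod.case using square_measure[OF h(1)]
      by (intro set_integral_diff(2) L2_set_integrable(1)[OF L(1)]) auto
    have "(l2 (\<lambda>x. v (r i) x - v (r k) x))\<^sup>2 \<le> 32 * (h m)\<^sup>2 * (l2 (\<lambda>x. g (r i) x - g (r k) x))\<^sup>2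
      + 2 * pi / h m ^ 4 * (\<Sum>j\<in>cell (h m) ` disc. (f (r i) (m, j) - f (r k) (m, j))\<^sup>2)"
      using square_means_control[OF pd h(1)[of m]] out unfolding diff by simp
    also have "\<dots> \<le> 32 * (h m)\<^sup>2 * (4 * B\<^sup>2) + 2 * pi / h m ^ 4 * (\<Sum>j\<in>cell (h m) ` disc. 2 * (f (r i) (m, j) - l (m, j))\<^sup>2 + 2 * (f (r k) (m, j) - l (m, j))\<^sup>2)"
    proof (intro add_mono mult_left_mono gB sum_mono)
      fix j
      have *: "(a - b)\<^sup>2 \<le> 2 * (a - c)\<^sup>2 + 2 * (b - c)\<^sup>2" for a b c :: real
        using sum_squares_bound[of "a - c" "c - b"] zero_le_power2[of "(a - c) + (b - c)"]
        by (simp add: power2_eq_square algebra_simps)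
      show "(f (r i) (m, j) - f (r k) (m, j))\<^sup>2 \<le> 2 * (f (r i) (m, j) - l (m, j))\<^sup>2 + 2 * (f (r k) (m, j) - l (m, j))\<^sup>2"
        by (rule *)
    qed (use h(1)[of m] in auto)
    also have "\<dots> = 128 * (h m)\<^sup>2 * B\<^sup>2 + 4 * pi / h m ^ 4 * (s m i + s m k)"
      unfolding s_def by (simp add: sum.distrib sum_distrib_left[symmetric] algebra_simps)
    finally show ?thesis .
  qed
  have Cauchy: "\<exists>N. \<forall>i\<ge>N. \<forall>k\<ge>N. l2 (\<lambda>x. v (r i) x - v (r k) x) < e" if e: "e > 0" for e
  proof -
    \<comment> \<open>The grid is fixed before the indices: m makes the energy term small, and only
      then N makes the finitely many squares settle.\<close>
    have "(\<lambda>m. 128 * (h m)\<^sup>2 * B\<^sup>2) \<longlonglongrightarrow> 128 * 0\<^sup>2 * B\<^sup>2"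
      unfolding h_def by (intro tendsto_intros LIMSEQ_inverse_real_of_nat)
    then have "\<forall>\<^sub>F m in sequentially. 128 * (h m)\<^sup>2 * B\<^sup>2 < e\<^sup>2 / 2"
      using e by (intro order_tendstoD(2)) auto
    then obtain m where m: "128 * (h m)\<^sup>2 * B\<^sup>2 < e\<^sup>2 / 2"
      by (auto dest: eventually_happens)
    have "(\<lambda>n. 4 * pi / h m ^ 4 * s m n) \<longlonglongrightarrow> 4 * pi / h m ^ 4 * 0"
      by (intro tendsto_intros s)
    then have "\<forall>\<^sub>F n in sequentially. 4 * pi / h m ^ 4 * s m n < e\<^sup>2 / 4"
      using e by (intro order_tendstoD(2)) auto
    then obtain N where N: "\<And>n. n \<ge> N \<Longrightarrow> 4 * pi / h m ^ 4 * s m n < e\<^sup>2 / 4"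
      by (auto simp: eventually_sequentially)
    have "l2 (\<lambda>x. v (r i) x - v (r k) x) < e" if "i \<ge> N" "k \<ge> N" for i k
    proof -
      have "(l2 (\<lambda>x. v (r i) x - v (r k) x))\<^sup>2 < e\<^sup>2"
        using key[of i k m] N[OF that(1)] N[OF that(2)] m by (simp only: distrib_left)
      then show ?thesis by (rule power_less_imp_less_base) (use e in simp)
    qed
    then show ?thesis by blast
  qed
  obtain w where "L2 w" "\<And>x. x \<notin> disc \<Longrightarrow> w x = 0" "(\<lambda>n. l2 (\<lambda>x. v (r n) x - w x)) \<longlonglongrightarrow> 0"
  proof (rule L2_complete[of "\<lambda>n. v (r n)" disc])
    show "emeasure lborel disc < \<infinity>" by (simp add: emeasure_ball)
  qed (use L out Cauchy in auto)
  with r that show ?thesis by blast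
qed

section \<open>The weighted functional\<close>

text \<open>An admissible function extended by zero, together with its gradient. The zero function
  is kept, so the class is stable under multiples and differences.\<close>

definition zero_mean_pair :: "(real^2 \<Rightarrow> real) \<Rightarrow> (real^2 \<Rightarrow> real^2) \<Rightarrow> bool" where
  "zero_mean_pair v g \<longleftrightarrow> H1_pair disc v g \<and> rot_mean_zero v \<and> (\<forall>x. x \<notin> disc \<longrightarrow> v x = 0)"

text \<open>At the origin the denominator is 0 and so is the weight. This matches the value 0 of
  \<open>1 / norm x\<close> there and lets pointwise bounds hold at every point.\<close>

definition log_weight :: "real \<Rightarrow> real \<Rightarrow> real^2 \<Rightarrow> real" where
  "log_weight q a x = indicator disc x / ((norm x)\<^sup>2 * (ln (a / norm x)) powr (q/2 + 1))"

definition weighted_power :: "real \<Rightarrow> real \<Rightarrow> (real^2 \<Rightarrow> real) \<Rightarrow> real" where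
  "weighted_power q a v = (LINT x|lborel. log_weight q a x * \<bar>v x\<bar> powr q)"

lemma log_weighted_integral_eq:
  "log_weighted_integral q a u = weighted_power q a (\<lambda>x. indicator disc x * u x)"
  unfolding log_weighted_integral_def weighted_power_def set_lebesgue_integral_def
  by (intro Bochner_Integration.integral_cong) (auto simp: log_weight_def indicator_def)

lemma log_weight_measurable [measurable]: "log_weight q a \<in> borel_measurable borel"
proof -
  have [measurable]: "(indicator disc :: real^2 \<Rightarrow> real) \<in> borel_measurable borel"
    by (intro borel_measurable_indicator) simp
  show ?thesis unfolding log_weight_def[abs_def] by measurable
qed

lemma log_weight_nonneg: "0 \<le> log_weight q a x"
  by (simp add: log_weight_def)

lemma log_weight_pos:
  assumes "a > 1" "x \<in> disc" "x \<noteq> 0"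
  shows "0 < log_weight q a x"
proof -
  have "norm x < 1" "norm x > 0" using assms by auto
  then have "a / norm x > 1" using assms(1) by (simp add: field_simps)
  then have "ln (a / norm x) > 0" by simp
  then show ?thesis using assms by (simp add: log_weight_def)
qed

text \<open>On the ball of radius d the logarithm is at least \<open>ln (a / d)\<close>, which tends
  to infinity as d tends to 0. This is the smallness behind compactness.\<close>

lemma log_weight_near:
  assumes "a > 1" "q > 0" "0 < d" "d \<le> 1" "norm x \<le> d"
  shows "log_weight q a x \<le> ln (a / d) powr - (q/2 + 1) * (1 / norm x)\<^sup>2"
proof (cases "x \<in> disc \<and> x \<noteq> 0")
  case True
  then have n: "norm x < 1" "norm x > 0" by auto
  have l: "0 < ln (a / d)" using assms by (simp add: field_simps)
  have "ln (a / d) \<le> ln (a / norm x)"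
  proof -
    have "a / d \<le> a / norm x"
      by (intro divide_left_mono[OF assms(5)] mult_pos_pos n(2) assms(3)) (use assms(1) in simp)
    moreover have "0 < a / d" "0 < a / norm x" using assms(1,3) n(2) by simp_all
    ultimately show ?thesis by (simp only: ln_le_cancel_iff)
  qed
  then have le: "ln (a / d) powr (q/2 + 1) \<le> ln (a / norm x) powr (q/2 + 1)"
    using l assms by (intro powr_mono2) auto
  have p: "0 < ln (a / d) powr (q/2 + 1)" using l by simp
  have "log_weight q a x = (1 / norm x)\<^sup>2 * (1 / ln (a / norm x) powr (q/2 + 1))"
    using True by (simp add: log_weight_def power_divide)
  also have "\<dots> \<le> (1 / norm x)\<^sup>2 * (1 / ln (a / d) powr (q/2 + 1))"
    using less_le_trans[OF p le] p by (intro mult_left_mono divide_left_mono[OF le] mult_pos_pos) simp_all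
  also have "\<dots> = ln (a / d) powr - (q/2 + 1) * (1 / norm x)\<^sup>2"
    by (simp only: powr_minus_divide mult.commute)
  finally show ?thesis .
qed (auto simp: log_weight_def)

text \<open>The case d = 1: as a > 1, the logarithm stays above \<open>ln a > 0\<close> up to the
  boundary.\<close>

lemma log_weight_le:
  assumes "a > 1" "q > 0"
  shows "log_weight q a x \<le> ln a powr - (q/2 + 1) * (1 / norm x)\<^sup>2"
proof (cases "x \<in> disc")
  case True
  then show ?thesis using log_weight_near[of a q 1 x] assms by simp
qed (auto simp: log_weight_def)

section \<open>Integrals of powers against the logarithmic weight\<close>

lemma zero_mean_pair_power_integral:
  assumes p: "zero_mean_pair v g"
  shows "integrable lborel (\<lambda>x. (v x ^ Suc k / norm x)\<^sup>2)"
    and "(LINT x|lborel. (v x ^ Suc k / norm x)\<^sup>2) \<le> (fact (Suc k) * ((1 + 2 * pi) * l2 g) ^ Suc k)\<^sup>2"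
proof -
  have [measurable]: "v \<in> borel_measurable borel"
    using p by (auto simp: zero_mean_pair_def H1_pair_def L2_def)
  note est = rot_mean_zero_power_estimate[of disc v g k]
  show I: "integrable lborel (\<lambda>x. (v x ^ Suc k / norm x)\<^sup>2)"
  proof (rule integrableI_bounded)
    show "(\<integral>\<^sup>+x. ennreal (norm ((v x ^ Suc k / norm x)\<^sup>2)) \<partial>lborel) < \<infinity>"
      using est p by (auto simp: zero_mean_pair_def simp del: power_Suc intro: le_less_trans)
  qed measurable
  have "ennreal (LINT x|lborel. (v x ^ Suc k / norm x)\<^sup>2) = (\<integral>\<^sup>+x. ennreal ((v x ^ Suc k / norm x)\<^sup>2) \<partial>lborel)"
    by (rule nn_integral_eq_integral[OF I, symmetric]) auto
  also have "\<dots> \<le> ennreal ((fact (Suc k) * ((1 + 2 * pi) * l2 g) ^ Suc k)\<^sup>2)"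
    using est p by (auto simp: zero_mean_pair_def simp del: power_Suc)
  finally show "(LINT x|lborel. (v x ^ Suc k / norm x)\<^sup>2) \<le> (fact (Suc k) * ((1 + 2 * pi) * l2 g) ^ Suc k)\<^sup>2"
    by (subst (asm) ennreal_le_iff) auto
qed

lemma weighted_even_power:
  assumes p: "zero_mean_pair v g" and aq: "a > 1" "q > 0"
  shows "integrable lborel (\<lambda>x. log_weight q a x * (v x ^ Suc k)\<^sup>2)"
    and "(LINT x|lborel. log_weight q a x * (v x ^ Suc k)\<^sup>2)
      \<le> ln a powr - (q/2 + 1) * (fact (Suc k) * ((1 + 2 * pi) * l2 g) ^ Suc k)\<^sup>2"
proof -
  have [measurable]: "v \<in> borel_measurable borel"
    using p by (auto simp: zero_mean_pair_def H1_pair_def L2_def)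
  note P = zero_mean_pair_power_integral[OF p, of k]
  let ?c = "ln a powr - (q/2 + 1)"
  have le: "log_weight q a x * (v x ^ Suc k)\<^sup>2 \<le> ?c * (v x ^ Suc k / norm x)\<^sup>2" for x
  proof -
    have "log_weight q a x * (v x ^ Suc k)\<^sup>2 \<le> (?c * (1 / norm x)\<^sup>2) * (v x ^ Suc k)\<^sup>2"
      by (intro mult_right_mono log_weight_le aq) auto
    also have "\<dots> = ?c * (v x ^ Suc k / norm x)\<^sup>2"
      by (simp only: power_divide) (simp add: power_divide)
    finally show ?thesis .
  qed
  have nn: "0 \<le> log_weight q a x * (v x ^ Suc k)\<^sup>2" for x
    by (intro mult_nonneg_nonneg log_weight_nonneg) auto
  show I: "integrable lborel (\<lambda>x. log_weight q a x * (v x ^ Suc k)\<^sup>2)"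
  proof (rule Bochner_Integration.integrable_bound)
    show "integrable lborel (\<lambda>x. ?c * (v x ^ Suc k / norm x)\<^sup>2)"
      by (intro integrable_mult_right P)
    show "AE x in lborel. norm (log_weight q a x * (v x ^ Suc k)\<^sup>2) \<le> norm (?c * (v x ^ Suc k / norm x)\<^sup>2)"
      using order_trans[OF le abs_ge_self] nn by (intro AE_I2) (simp only: real_norm_def abs_of_nonneg)
  qed measurable
  have "(LINT x|lborel. log_weight q a x * (v x ^ Suc k)\<^sup>2) \<le> (LINT x|lborel. ?c * (v x ^ Suc k / norm x)\<^sup>2)"
    by (intro integral_mono I integrable_mult_right P le)
  also have "\<dots> = ?c * (LINT x|lborel. (v x ^ Suc k / norm x)\<^sup>2)"
    by (rule integral_mult_right_zero)
  also have "\<dots> \<le> ?c * (fact (Suc k) * ((1 + 2 * pi) * l2 g) ^ Suc k)\<^sup>2"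
    by (intro mult_left_mono P) auto
  finally show "(LINT x|lborel. log_weight q a x * (v x ^ Suc k)\<^sup>2)
      \<le> ?c * (fact (Suc k) * ((1 + 2 * pi) * l2 g) ^ Suc k)\<^sup>2" .
qed

text \<open>Near the origin the logarithm makes the weight small compared to \<open>1 / norm x\<^sup>2\<close>; away from it
  the weight is bounded.\<close>

lemma weighted_square_split:
  assumes p: "zero_mean_pair v g" and aq: "a > 1" "q > 0" and d: "0 < d" "d \<le> 1"
  shows "(LINT x|lborel. log_weight q a x * (v x)\<^sup>2)
      \<le> ln (a / d) powr - (q/2 + 1) * ((1 + 2 * pi) * l2 g)\<^sup>2 + ln a powr - (q/2 + 1) / d\<^sup>2 * (l2 v)\<^sup>2"
proof -
  have [measurable]: "v \<in> borel_measurable borel" and v: "L2 v"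
    using p by (auto simp: zero_mean_pair_def H1_pair_def L2_def)
  have P: "integrable lborel (\<lambda>x. (v x / norm x)\<^sup>2)" "(LINT x|lborel. (v x / norm x)\<^sup>2) \<le> ((1 + 2 * pi) * l2 g)\<^sup>2"
    using zero_mean_pair_power_integral[OF p, of 0] by simp_all
  have vi: "integrable lborel (\<lambda>x. (v x)\<^sup>2)" and vl: "(LINT x|lborel. (v x)\<^sup>2) = (l2 v)\<^sup>2"
    using v by (simp_all add: L2_def l2_power2)
  let ?c = "ln (a / d) powr - (q/2 + 1)" and ?b = "ln a powr - (q/2 + 1) / d\<^sup>2"
  have le: "log_weight q a x * (v x)\<^sup>2 \<le> ?c * (v x / norm x)\<^sup>2 + ?b * (v x)\<^sup>2" for x
  proof (cases "norm x \<le> d")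
    case True
    have "log_weight q a x * (v x)\<^sup>2 \<le> (?c * (1 / norm x)\<^sup>2) * (v x)\<^sup>2"
      by (intro mult_right_mono log_weight_near aq d True) auto
    also have "\<dots> = ?c * (v x / norm x)\<^sup>2"
      by (simp add: power_divide)
    also have "\<dots> \<le> ?c * (v x / norm x)\<^sup>2 + ?b * (v x)\<^sup>2" by simp
    finally show ?thesis .
  next
    case False
    have "norm x > 0" using False d by linarith
    then have "(1 / norm x)\<^sup>2 \<le> (1 / d)\<^sup>2"
      using False d by (intro power_mono divide_left_mono) auto
    then have "ln a powr - (q/2 + 1) * (1 / norm x)\<^sup>2 \<le> ln a powr - (q/2 + 1) * (1 / d)\<^sup>2"
      by (intro mult_left_mono) auto
    also have "\<dots> = ?b" by (simp add: power_divide)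
    finally have "log_weight q a x \<le> ?b"
      using log_weight_le[OF aq, of x] by linarith
    then have "log_weight q a x * (v x)\<^sup>2 \<le> ?b * (v x)\<^sup>2"
      by (intro mult_right_mono) auto
    also have "\<dots> \<le> ?c * (v x / norm x)\<^sup>2 + ?b * (v x)\<^sup>2" by simp
    finally show ?thesis .
  qed
  have I: "integrable lborel (\<lambda>x. log_weight q a x * (v x)\<^sup>2)"
    using weighted_even_power(1)[OF p aq, of 0] by simp
  have "(LINT x|lborel. log_weight q a x * (v x)\<^sup>2) \<le> (LINT x|lborel. ?c * (v x / norm x)\<^sup>2 + ?b * (v x)\<^sup>2)"
    by (intro integral_mono I Bochner_Integration.integrable_add integrable_mult_right P vi le)
  also have "\<dots> = ?c * (LINT x|lborel. (v x / norm x)\<^sup>2) + ?b * (LINT x|lborel. (v x)\<^sup>2)"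
    by (subst Bochner_Integration.integral_add) (simp_all only: integrable_mult_right P vi integral_mult_right_zero)
  also have "\<dots> \<le> ?c * ((1 + 2 * pi) * l2 g)\<^sup>2 + ?b * (l2 v)\<^sup>2"
    unfolding vl by (intro add_right_mono mult_left_mono P) auto
  finally show ?thesis .
qed

text \<open>For z = y / T the power z^q is at most z^2 if z \<le> 1 and at most z^(2 (k + 1))
  otherwise. T is kept free: the high power carries the factor T^(q - 2 (k + 1)), which is small for
  large T when q < 2 (k + 1).\<close>

lemma powr_le_even_powers:
  fixes y :: real
  assumes "y \<ge> 0" "2 < q" "q \<le> 2 * real (Suc k)" "T > 0"
  shows "y powr q \<le> T powr q * ((1 / T\<^sup>2) * y\<^sup>2 + (1 / T ^ Suc k)\<^sup>2 * (y ^ Suc k)\<^sup>2)"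
proof -
  define z where "z = y / T"
  have z: "z \<ge> 0" using assms by (simp add: z_def)
  have "z powr q \<le> z\<^sup>2 + (z ^ Suc k)\<^sup>2"
  proof (cases "z = 0")
    case True
    then show ?thesis by simp
  next
    case False
    then have z0: "z > 0" using z by simp
    show ?thesis
    proof (cases "z \<le> 1")
      case True
      have "z powr q \<le> z powr 2" using True z0 assms by (intro powr_mono') auto
      also have "\<dots> = z\<^sup>2" using z0 by simp
      also have "\<dots> \<le> z\<^sup>2 + (z ^ Suc k)\<^sup>2" by (simp del: power_Suc)
      finally show ?thesis .
    next
      case False
      have "z powr q \<le> z powr (real (2 * Suc k))" using False assms by (intro powr_mono) auto
      also have "\<dots> = (z ^ Suc k)\<^sup>2"
        using z0 by (subst powr_realpow) (auto simp: power_mult[symmetric] mult.commute simp del: power_Suc)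
      also have "\<dots> \<le> z\<^sup>2 + (z ^ Suc k)\<^sup>2" by simp
      finally show ?thesis .
    qed
  qed
  then have "T powr q * z powr q \<le> T powr q * (z\<^sup>2 + (z ^ Suc k)\<^sup>2)"
    by (intro mult_left_mono) auto
  moreover have "T powr q * z powr q = y powr q"
    using assms by (simp add: z_def powr_mult[symmetric])
  moreover have "z\<^sup>2 = (1 / T\<^sup>2) * y\<^sup>2" "(z ^ Suc k)\<^sup>2 = (1 / T ^ Suc k)\<^sup>2 * (y ^ Suc k)\<^sup>2"
    by (simp_all add: z_def power_divide)
  ultimately show ?thesis by simp
qed

lemma weighted_power_integrable:
  assumes p: "zero_mean_pair v g" and aq: "a > 1" "q > 2" and k: "q \<le> 2 * real (Suc k)" and T: "T > 0"
  shows "integrable lborel (\<lambda>x. log_weight q a x * \<bar>v x\<bar> powr q)"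
    and "weighted_power q a v \<le> T powr q * (1 / T\<^sup>2 * (LINT x|lborel. log_weight q a x * (v x)\<^sup>2)
      + (1 / T ^ Suc k)\<^sup>2 * (LINT x|lborel. log_weight q a x * (v x ^ Suc k)\<^sup>2))"
proof -
  have q0: "q > 0" using aq by simp
  have [measurable]: "v \<in> borel_measurable borel"
    using p by (auto simp: zero_mean_pair_def H1_pair_def L2_def)
  have I1: "integrable lborel (\<lambda>x. log_weight q a x * (v x)\<^sup>2)"
    using weighted_even_power(1)[OF p aq(1) q0, of 0] by simp
  note I2 = weighted_even_power(1)[OF p aq(1) q0, of k]
  let ?h = "\<lambda>x. T powr q * (1 / T\<^sup>2 * (log_weight q a x * (v x)\<^sup>2) + (1 / T ^ Suc k)\<^sup>2 * (log_weight q a x * (v x ^ Suc k)\<^sup>2))"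
  have hi: "integrable lborel ?h"
    by (intro integrable_mult_right Bochner_Integration.integrable_add I1 I2)
  have le: "log_weight q a x * \<bar>v x\<bar> powr q \<le> ?h x" for x
  proof -
    have "log_weight q a x * \<bar>v x\<bar> powr q
      \<le> log_weight q a x * (T powr q * ((1 / T\<^sup>2) * \<bar>v x\<bar>\<^sup>2 + (1 / T ^ Suc k)\<^sup>2 * (\<bar>v x\<bar> ^ Suc k)\<^sup>2))"
      by (intro mult_left_mono powr_le_even_powers log_weight_nonneg aq k T) auto
    moreover have "\<bar>v x\<bar>\<^sup>2 = (v x)\<^sup>2" "(\<bar>v x\<bar> ^ Suc k)\<^sup>2 = (v x ^ Suc k)\<^sup>2"
      by (simp_all only: power_abs[symmetric] abs_power2 power2_abs)
    ultimately show ?thesis by (simp only: algebra_simps)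
  qed
  have nn: "0 \<le> log_weight q a x * \<bar>v x\<bar> powr q" for x
    by (intro mult_nonneg_nonneg log_weight_nonneg) auto
  show I: "integrable lborel (\<lambda>x. log_weight q a x * \<bar>v x\<bar> powr q)"
  proof (rule Bochner_Integration.integrable_bound[OF hi])
    show "AE x in lborel. norm (log_weight q a x * \<bar>v x\<bar> powr q) \<le> norm (?h x)"
      using order_trans[OF le abs_ge_self] nn by (intro AE_I2) (simp only: real_norm_def abs_of_nonneg)
  qed measurable
  have "weighted_power q a v \<le> (LINT x|lborel. ?h x)"
    unfolding weighted_power_def by (intro integral_mono I hi le)
  also have "\<dots> = T powr q * (1 / T\<^sup>2 * (LINT x|lborel. log_weight q a x * (v x)\<^sup>2)
      + (1 / T ^ Suc k)\<^sup>2 * (LINT x|lborel. log_weight q a x * (v x ^ Suc k)\<^sup>2))"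
    by (subst integral_mult_right_zero, subst Bochner_Integration.integral_add)
      (simp_all only: integrable_mult_right I1 I2 integral_mult_right_zero)
  finally show "weighted_power q a v \<le> T powr q * (1 / T\<^sup>2 * (LINT x|lborel. log_weight q a x * (v x)\<^sup>2)
      + (1 / T ^ Suc k)\<^sup>2 * (LINT x|lborel. log_weight q a x * (v x ^ Suc k)\<^sup>2))" .
qed

lemma exponent_bound: obtains k where "(q::real) < 2 * real (Suc k)"
proof -
  obtain n :: nat where "q < real n" using reals_Archimedean2 by blast
  then have "q < 2 * real (Suc n)" by simp
  then show ?thesis by (rule that)
qed

text \<open>Finiteness of the supremum over the unit ball, on which the positivity of D rests.
  Interpolation with T = 1 is enough.\<close>

lemma weighted_power_bounded:
  assumes "a > 1" "q > 2"
  obtains S where "\<And>v g. zero_mean_pair v g \<Longrightarrow> l2 g \<le> 1 \<Longrightarrow> weighted_power q a v \<le> S"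
proof -
  have q0: "q > 0" using assms by simp
  obtain k where k: "q < 2 * real (Suc k)" by (rule exponent_bound)
  let ?c = "ln a powr - (q/2 + 1)"
  let ?M = "\<lambda>k. ?c * (fact (Suc k) * ((1 + 2 * pi) * 1) ^ Suc k)\<^sup>2"
  have "weighted_power q a v \<le> ?M 0 + ?M k" if p: "zero_mean_pair v g" and g: "l2 g \<le> 1" for v g
  proof -
    have M: "(LINT x|lborel. log_weight q a x * (v x ^ Suc k)\<^sup>2) \<le> ?M k" for k
    proof -
      have "(LINT x|lborel. log_weight q a x * (v x ^ Suc k)\<^sup>2) \<le> ?c * (fact (Suc k) * ((1 + 2 * pi) * l2 g) ^ Suc k)\<^sup>2"
        by (rule weighted_even_power(2)[OF p assms(1) q0])
      also have "\<dots> \<le> ?M k"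
        using g by (intro mult_left_mono power_mono) auto
      finally show ?thesis .
    qed
    show ?thesis
      using weighted_power_integrable(2)[OF p assms less_imp_le[OF k] zero_less_one] M[of k] M[of 0]
      by (simp del: power_Suc add: fact_Suc)
  qed
  then show ?thesis by (rule that)
qed

text \<open>Two thresholds are fixed before n: d makes the contribution near the origin small for
  the squares, and T makes the contribution of the high even power small. Both depend on the
  sequence only through the energy bound B; what remains is controlled by
  \<open>l2 (v n)\<close>.\<close>

lemma weighted_power_tendsto_0:
  assumes p: "\<And>n::nat. zero_mean_pair (v n) (g n)" and B: "\<And>n. l2 (g n) \<le> B"
    and lim: "(\<lambda>n. l2 (v n)) \<longlonglongrightarrow> 0" and aq: "a > 1" "q > 2"
  shows "(\<lambda>n. weighted_power q a (v n)) \<longlonglongrightarrow> 0"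
proof -
  have q0: "q > 0" using aq by simp
  have B0: "0 \<le> B" using B[of 0] order_trans[OF l2_nonneg] by blast
  let ?s = "- (q/2 + 1)"
  let ?A = "\<lambda>n. LINT x|lborel. log_weight q a x * (v n x)\<^sup>2"
  have A0: "0 \<le> ?A n" for n
    by (intro Bochner_Integration.integral_nonneg) (auto simp: log_weight_nonneg)
  have W0: "0 \<le> weighted_power q a (v n)" for n
    unfolding weighted_power_def by (intro Bochner_Integration.integral_nonneg) (auto simp: log_weight_nonneg)
  have A: "?A \<longlonglongrightarrow> 0"
  proof (rule order_tendstoI)
    fix e :: real assume e: "0 < e"
    let ?K = "((1 + 2 * pi) * B)\<^sup>2"
    have "((\<lambda>M. M powr ?s * ?K) \<longlongrightarrow> 0 * ?K) at_top"
      using q0 by (intro tendsto_mult tendsto_const tendsto_neg_powr filterlim_ident) auto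
    then have "\<forall>\<^sub>F M in at_top. M powr ?s * ?K < e / 2"
      using e by (intro order_tendstoD(2)) auto
    then have "\<forall>\<^sub>F M in at_top. M powr ?s * ?K < e / 2 \<and> ln a \<le> M"
      using eventually_ge_at_top by (rule eventually_conj)
    then obtain M where M: "M powr ?s * ?K < e / 2" "ln a \<le> M"
      by (auto dest: eventually_happens)
    \<comment> \<open>Chosen so that \<open>ln (a / d) = M\<close>; the condition
      \<open>ln a \<le> M\<close> becomes d \<le> 1.\<close>
    define d where "d = a * exp (- M)"
    have "a / d = exp M" using aq by (simp add: d_def exp_minus field_simps)
    then have d: "0 < d" "ln (a / d) = M" using aq by (auto simp: d_def)
    have d1: "d \<le> 1"
    proof -
      have "a = exp (ln a)" using aq by simp
      also have "\<dots> \<le> exp M" using M by simp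
      finally show ?thesis by (simp add: d_def exp_minus field_simps)
    qed
    let ?b = "ln a powr ?s / d\<^sup>2"
    have "(\<lambda>n. ?b * (l2 (v n))\<^sup>2) \<longlonglongrightarrow> ?b * 0\<^sup>2"
      by (intro tendsto_intros lim)
    then have "\<forall>\<^sub>F n in sequentially. ?b * (l2 (v n))\<^sup>2 < e / 2"
      using e by (intro order_tendstoD(2)) auto
    then show "\<forall>\<^sub>F n in sequentially. ?A n < e"
    proof eventually_elim
      case (elim n)
      have "?A n \<le> M powr ?s * ((1 + 2 * pi) * l2 (g n))\<^sup>2 + ?b * (l2 (v n))\<^sup>2"
        using weighted_square_split[OF p aq(1) q0 d(1) d1] unfolding d(2) .
      moreover have "M powr ?s * ((1 + 2 * pi) * l2 (g n))\<^sup>2 \<le> M powr ?s * ?K"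
        by (intro mult_left_mono power_mono B) auto
      ultimately show ?case using elim M(1) by linarith
    qed
  next
    fix e :: real assume "e < 0"
    then show "\<forall>\<^sub>F n in sequentially. e < ?A n"
      by (intro always_eventually allI less_le_trans[OF _ A0])
  qed
  obtain k where k: "q < 2 * real (Suc k)" by (rule exponent_bound)
  show ?thesis
  proof (rule order_tendstoI)
    fix e :: real assume e: "0 < e"
    let ?K = "ln a powr ?s * (fact (Suc k) * ((1 + 2 * pi) * B) ^ Suc k)\<^sup>2"
    have "((\<lambda>T. T powr (q - real (2 * Suc k)) * ?K) \<longlongrightarrow> 0 * ?K) at_top"
      using k by (intro tendsto_mult tendsto_const tendsto_neg_powr filterlim_ident) auto
    then have "\<forall>\<^sub>F T in at_top. T powr (q - real (2 * Suc k)) * ?K < e / 2"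
      using e by (intro order_tendstoD(2)) auto
    then have "\<forall>\<^sub>F T in at_top. T powr (q - real (2 * Suc k)) * ?K < e / 2 \<and> 1 \<le> T"
      using eventually_ge_at_top by (rule eventually_conj)
    then obtain T where T: "T powr (q - real (2 * Suc k)) * ?K < e / 2" "1 \<le> T"
      by (auto dest: eventually_happens)
    have T0: "T > 0" using T by simp
    have Tp: "T powr q * (1 / T ^ Suc k)\<^sup>2 = T powr (q - real (2 * Suc k))"
    proof -
      have "T powr real (2 * Suc k) = (T ^ Suc k)\<^sup>2"
        using T0 by (subst powr_realpow) (auto simp: power_mult[symmetric] mult.commute simp del: power_Suc)
      then show ?thesis by (simp add: powr_diff power_divide del: power_Suc of_nat_Suc)
    qed
    have "(\<lambda>n. T powr q * (1 / T\<^sup>2 * ?A n)) \<longlonglongrightarrow> T powr q * (1 / T\<^sup>2 * 0)"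
      by (intro tendsto_mult tendsto_const A)
    then have "\<forall>\<^sub>F n in sequentially. T powr q * (1 / T\<^sup>2 * ?A n) < e / 2"
      using e by (intro order_tendstoD(2)) auto
    then show "\<forall>\<^sub>F n in sequentially. weighted_power q a (v n) < e"
    proof eventually_elim
      case (elim n)
      let ?L = "LINT x|lborel. log_weight q a x * (v n x ^ Suc k)\<^sup>2"
      have "weighted_power q a (v n) \<le> T powr q * (1 / T\<^sup>2 * ?A n) + (T powr q * (1 / T ^ Suc k)\<^sup>2) * ?L"
        using weighted_power_integrable(2)[OF p aq less_imp_le[OF k] T0]
        by (simp only: distrib_left mult.assoc)
      moreover have "?L \<le> ?K"
      proof -
        have "?L \<le> ln a powr ?s * (fact (Suc k) * ((1 + 2 * pi) * l2 (g n)) ^ Suc k)\<^sup>2"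
          by (rule weighted_even_power(2)[OF p aq(1) q0])
        also have "\<dots> \<le> ?K"
          by (intro mult_left_mono power_mono B) auto
        finally show ?thesis .
      qed
      then have "(T powr q * (1 / T ^ Suc k)\<^sup>2) * ?L \<le> T powr (q - real (2 * Suc k)) * ?K"
        unfolding Tp by (intro mult_left_mono) auto
      ultimately show ?case using elim T(1) by linarith
    qed
  next
    fix e :: real assume "e < 0"
    then show "\<forall>\<^sub>F n in sequentially. e < weighted_power q a (v n)"
      by (intro always_eventually allI less_le_trans[OF _ W0])
  qed
qed

section \<open>Homogeneity, positivity and a triangle inequality of the functional\<close>

lemma zero_mean_pair_scaleR:
  assumes "zero_mean_pair v g"
  shows "zero_mean_pair (\<lambda>x. c * v x) (\<lambda>x. c *\<^sub>R g x)"
proof -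
  have "rot_mean (\<lambda>x. c * v x) x = c * rot_mean v x" for x
    unfolding rot_mean_def by simp
  then show ?thesis
    using assms H1_pair_scaleR unfolding zero_mean_pair_def rot_mean_zero_def
    by (auto elim: eventually_mono)
qed

lemma weighted_power_scaleR:
  "weighted_power q a (\<lambda>x. c * v x) = \<bar>c\<bar> powr q * weighted_power q a v"
proof -
  have "log_weight q a x * \<bar>c * v x\<bar> powr q = \<bar>c\<bar> powr q * (log_weight q a x * \<bar>v x\<bar> powr q)" for x
    by (simp add: abs_mult powr_mult)
  then show ?thesis unfolding weighted_power_def by (simp only: integral_mult_right_zero)
qed

lemma weighted_power_pos:
  assumes p: "zero_mean_pair v g" and aq: "a > 1" "q > 2" and nz: "\<not> (AE x in lborel. v x = 0)"
  shows "weighted_power q a v > 0"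
proof -
  obtain k where k: "q < 2 * real (Suc k)" by (rule exponent_bound)
  have I: "integrable lborel (\<lambda>x. log_weight q a x * \<bar>v x\<bar> powr q)"
    by (rule weighted_power_integrable(1)[OF p aq less_imp_le[OF k] zero_less_one])
  have nn: "0 \<le> log_weight q a x * \<bar>v x\<bar> powr q" for x
    by (intro mult_nonneg_nonneg log_weight_nonneg) auto
  have "weighted_power q a v \<noteq> 0"
  proof
    assume "weighted_power q a v = 0"
    then have "AE x in lborel. log_weight q a x * \<bar>v x\<bar> powr q = 0"
      unfolding weighted_power_def using I nn by (subst (asm) integral_nonneg_eq_0_iff_AE) auto
    then have "AE x in lborel. v x = 0"
      using AE_lborel_singleton[of "0::real^2"]
    proof eventually_elim
      case (elim x)
      show ?case
      proof (cases "x \<in> disc")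
        case True
        then show ?thesis using elim log_weight_pos[OF aq(1) True, of q] by auto
      next
        case False
        then show ?thesis using p by (simp add: zero_mean_pair_def)
      qed
    qed
    with nz show False by simp
  qed
  moreover have "weighted_power q a v \<ge> 0"
    unfolding weighted_power_def by (intro Bochner_Integration.integral_nonneg nn)
  ultimately show ?thesis by simp
qed

text \<open>Writing v = (1 - t) (w / (1 - t)) + t ((v - w) / t) bounds |v| by the larger of |w| / (1
  - t) and |v - w| / t, whose power is at most the sum of both powers. As t tends to 0 the constant
  of w tends to 1, so nothing is lost once v - w is negligible.\<close>

lemma weighted_power_quasi_triangle:
  assumes p: "zero_mean_pair v g" "zero_mean_pair w h" and pd: "zero_mean_pair (\<lambda>x. v x - w x) k"
    and aq: "a > 1" "q > 2" and t: "0 < t" "t < 1"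
  shows "weighted_power q a v \<le> (1 - t) powr - q * weighted_power q a w
    + t powr - q * weighted_power q a (\<lambda>x. v x - w x)"
proof -
  obtain m where m: "q < 2 * real (Suc m)" by (rule exponent_bound)
  note I = weighted_power_integrable(1)[OF _ aq less_imp_le[OF m] zero_less_one]
  have le: "\<bar>v x\<bar> powr q \<le> (1 - t) powr - q * \<bar>w x\<bar> powr q + t powr - q * \<bar>v x - w x\<bar> powr q" for x
  proof -
    let ?y = "\<bar>w x\<bar> / (1 - t)" and ?z = "\<bar>v x - w x\<bar> / t"
    have "\<bar>v x\<bar> \<le> (1 - t) * ?y + t * ?z" using t by simp
    also have "\<dots> \<le> (1 - t) * max ?y ?z + t * max ?y ?z"
      using t by (intro add_mono mult_left_mono) auto
    also have "\<dots> = max ?y ?z" by (simp add: algebra_simps)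
    finally have "\<bar>v x\<bar> powr q \<le> (max ?y ?z) powr q"
      using aq by (intro powr_mono2) auto
    also have "\<dots> \<le> ?y powr q + ?z powr q" by (simp add: max_def)
    also have "\<dots> = (1 - t) powr - q * \<bar>w x\<bar> powr q + t powr - q * \<bar>v x - w x\<bar> powr q"
      using t by (simp add: powr_divide powr_minus_divide)
    finally show ?thesis .
  qed
  have "weighted_power q a v \<le> (LINT x|lborel. (1 - t) powr - q * (log_weight q a x * \<bar>w x\<bar> powr q)
    + t powr - q * (log_weight q a x * \<bar>v x - w x\<bar> powr q))"
    unfolding weighted_power_def
  proof (intro integral_mono Bochner_Integration.integrable_add integrable_mult_right I[OF p(1)] I[OF p(2)] I[OF pd])
    fix x
    show "log_weight q a x * \<bar>v x\<bar> powr q \<le> (1 - t) powr - q * (log_weight q a x * \<bar>w x\<bar> powr q)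
      + t powr - q * (log_weight q a x * \<bar>v x - w x\<bar> powr q)"
      using mult_left_mono[OF le[of x] log_weight_nonneg[of q a x]] by (simp only: algebra_simps)
  qed
  also have "\<dots> = (1 - t) powr - q * weighted_power q a w + t powr - q * weighted_power q a (\<lambda>x. v x - w x)"
    unfolding weighted_power_def
    by (subst Bochner_Integration.integral_add)
      (simp_all only: integrable_mult_right I[OF p(2)] I[OF pd] integral_mult_right_zero)
  finally show ?thesis .
qed

section \<open>Limits of bounded sequences\<close>

text \<open>Tonelli and rotation invariance. Finiteness of the outer integral makes v square
  integrable on almost every circle.\<close>

lemma L2_rot_square_integral:
  assumes v: "L2 v"
  shows "(\<integral>\<^sup>+x. (\<integral>\<^sup>+t. ennreal ((indicator {0..2*pi} t * v (rot t x))\<^sup>2) \<partial>lborel) \<partial>lborel)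
    = ennreal (2 * pi * (l2 v)\<^sup>2)"
proof -
  have [measurable]: "v \<in> borel_measurable borel" using v by (simp add: L2_def)
  have "(\<integral>\<^sup>+x. (\<integral>\<^sup>+t. ennreal ((indicator {0..2*pi} t * v (rot t x))\<^sup>2) \<partial>lborel) \<partial>lborel)
    = (\<integral>\<^sup>+t. (\<integral>\<^sup>+x. ennreal ((indicator {0..2*pi} t * v (rot t x))\<^sup>2) \<partial>lborel) \<partial>lborel)"
    by (rule lborel_pair.Fubini') measurable
  also have "\<dots> = (\<integral>\<^sup>+t. ennreal ((l2 v)\<^sup>2) * indicator {0..2*pi} t \<partial>lborel)"
  proof (rule nn_integral_cong)
    fix t
    have "(\<integral>\<^sup>+x. ennreal ((v (rot t x))\<^sup>2) \<partial>lborel) = (\<integral>\<^sup>+x. ennreal ((v x)\<^sup>2) \<partial>lborel)"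
      by (rule measure_preserving_nn_integral[OF measure_preserving_rot]) measurable
    also have "\<dots> = ennreal ((l2 v)\<^sup>2)" using L2_nn_integral[OF v] by simp
    finally show "(\<integral>\<^sup>+x. ennreal ((indicator {0..2*pi} t * v (rot t x))\<^sup>2) \<partial>lborel)
      = ennreal ((l2 v)\<^sup>2) * indicator {0..2*pi} t"
      by (auto simp: indicator_def)
  qed
  also have "\<dots> = ennreal ((l2 v)\<^sup>2) * ennreal (2 * pi)"
    by (subst nn_integral_cmult_indicator) auto
  finally show ?thesis by (simp add: ennreal_mult'[symmetric] mult.commute)
qed

lemma rot_square_integrable_pointwise:
  assumes [measurable]: "v \<in> borel_measurable borel"
    and fin: "(\<integral>\<^sup>+t. ennreal ((indicator {0..2*pi} t * v (rot t x))\<^sup>2) \<partial>lborel) \<noteq> \<infinity>" (is "?J \<noteq> _")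
  shows "set_integrable lborel {0..2*pi} (\<lambda>t. v (rot t x))"
    and "ennreal ((rot_mean v x)\<^sup>2) \<le> ennreal (2 * pi) * ?J"
proof -
  define k where "k t = indicator {0..2*pi} t * v (rot t x)" for t
  have km [measurable]: "k \<in> borel_measurable borel" unfolding k_def by measurable
  obtain j where j: "j \<ge> 0" "?J = ennreal j" using fin by (cases ?J) auto
  have k: "L2 k" "l2 k \<le> sqrt j"
    using L2_nn_integralI[OF km, of "sqrt j"] j by (simp_all add: k_def)
  have eq: "(\<lambda>t. indicator {0..2*pi} t * k t) = (\<lambda>t. indicator {0..2*pi} t * v (rot t x))"
    by (auto simp: k_def indicator_def fun_eq_iff)
  show "set_integrable lborel {0..2*pi} (\<lambda>t. v (rot t x))"
    using L2_set_integrable(1)[OF k(1), of "{0..2*pi}"] by (simp add: set_integrable_def eq)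
  have "rot_mean v x = (LINT t:{0..2*pi}|lborel. k t)"
    by (simp add: rot_mean_def set_lebesgue_integral_def eq)
  then have "\<bar>rot_mean v x\<bar> \<le> sqrt (2 * pi) * l2 k"
    using L2_set_integrable(3)[OF k(1), of "{0..2*pi}"] by simp
  also have "\<dots> \<le> sqrt (2 * pi) * sqrt j" by (intro mult_left_mono k) auto
  finally have "\<bar>rot_mean v x\<bar>\<^sup>2 \<le> (sqrt (2 * pi) * sqrt j)\<^sup>2"
    by (intro power_mono) auto
  then have "(rot_mean v x)\<^sup>2 \<le> (2 * pi) * j"
    using j(1) by (simp add: power_mult_distrib)
  then show "ennreal ((rot_mean v x)\<^sup>2) \<le> ennreal (2 * pi) * ?J"
    using j by (simp add: ennreal_mult'[symmetric] ennreal_leI)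
qed

text \<open>Additivity of the Bochner integral needs integrability, so the linearity of
  \<open>rot_mean\<close> almost everywhere rests on this.\<close>

lemma L2_AE_rot_integrable:
  fixes v :: "real^2 \<Rightarrow> real"
  assumes v: "L2 v"
  shows "AE x in lborel. set_integrable lborel {0..2*pi} (\<lambda>t. v (rot t x))"
proof -
  have [measurable]: "v \<in> borel_measurable borel" using v by (simp add: L2_def)
  have "AE x in lborel. (\<integral>\<^sup>+t. ennreal ((indicator {0..2*pi} t * v (rot t x))\<^sup>2) \<partial>lborel) \<noteq> \<infinity>"
    by (intro nn_integral_PInf_AE lborel.borel_measurable_nn_integral)
      (measurable, simp add: L2_rot_square_integral[OF v])
  then show ?thesis
    by eventually_elim (rule rot_square_integrable_pointwise(1), measurable)
qed

text \<open>One factor 2 pi comes from Cauchy-Schwarz in the angle, the other from the length of the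
  angle interval. Where the circle integral is infinite the pointwise bound is trivial.\<close>

lemma rot_mean_L2:
  assumes v: "L2 v"
  shows "(\<integral>\<^sup>+x. ennreal ((rot_mean v x)\<^sup>2) \<partial>lborel) \<le> ennreal ((2 * pi * l2 v)\<^sup>2)"
proof -
  have [measurable]: "v \<in> borel_measurable borel" using v by (simp add: L2_def)
  have "ennreal ((rot_mean v x)\<^sup>2) \<le> ennreal (2 * pi) * (\<integral>\<^sup>+t. ennreal ((indicator {0..2*pi} t * v (rot t x))\<^sup>2) \<partial>lborel)"
    (is "_ \<le> _ * ?J x") for x
    by (cases "?J x = \<infinity>") (auto simp: ennreal_mult_top intro: rot_square_integrable_pointwise(2))
  then have "(\<integral>\<^sup>+x. ennreal ((rot_mean v x)\<^sup>2) \<partial>lborel)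
    \<le> (\<integral>\<^sup>+x. ennreal (2 * pi) * (\<integral>\<^sup>+t. ennreal ((indicator {0..2*pi} t * v (rot t x))\<^sup>2) \<partial>lborel) \<partial>lborel)"
    by (intro nn_integral_mono)
  also have "\<dots> = ennreal (2 * pi) * ennreal (2 * pi * (l2 v)\<^sup>2)"
    by (subst nn_integral_cmult, intro lborel.borel_measurable_nn_integral)
      (measurable, simp add: L2_rot_square_integral[OF v])
  also have "\<dots> = ennreal ((2 * pi * l2 v)\<^sup>2)"
    by (simp add: ennreal_mult'[symmetric] power_mult_distrib power2_eq_square mult_ac)
  finally show ?thesis .
qed

lemma rot_mean_diff_AE:
  assumes "L2 v" "L2 w"
  shows "AE x in lborel. rot_mean (\<lambda>x. v x - w x) x = rot_mean v x - rot_mean w x"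
  using L2_AE_rot_integrable[OF assms(1)] L2_AE_rot_integrable[OF assms(2)]
  by eventually_elim (simp add: rot_mean_def set_integral_diff)

text \<open>As a bounded operator on L2, \<open>rot_mean\<close> has at w a norm of at most 2 pi
  times the distance from w to a function on which it vanishes.\<close>

lemma rot_mean_zero_limit:
  assumes v: "\<And>n::nat. L2 (v n)" "\<And>n. rot_mean_zero (v n)" and w: "L2 w"
    and lim: "(\<lambda>n. l2 (\<lambda>x. v n x - w x)) \<longlonglongrightarrow> 0"
  shows "rot_mean_zero w"
proof -
  have [measurable]: "w \<in> borel_measurable borel" using w by (simp add: L2_def)
  let ?J = "\<integral>\<^sup>+x. ennreal ((rot_mean w x)\<^sup>2) \<partial>lborel"
  have le: "?J \<le> ennreal ((2 * pi * l2 (\<lambda>x. v n x - w x))\<^sup>2)" for n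
  proof -
    have "?J = (\<integral>\<^sup>+x. ennreal ((rot_mean (\<lambda>x. v n x - w x) x)\<^sup>2) \<partial>lborel)"
    proof (rule nn_integral_cong_AE)
      show "AE x in lborel. ennreal ((rot_mean w x)\<^sup>2) = ennreal ((rot_mean (\<lambda>x. v n x - w x) x)\<^sup>2)"
        using rot_mean_diff_AE[OF v(1) w, of n] v(2)[of n] unfolding rot_mean_zero_def
        by eventually_elim simp
    qed
    also have "\<dots> \<le> ennreal ((2 * pi * l2 (\<lambda>x. v n x - w x))\<^sup>2)"
      by (rule rot_mean_L2[OF L2_diff[OF v(1) w]])
    finally show ?thesis .
  qed
  have "(\<lambda>n. ennreal ((2 * pi * l2 (\<lambda>x. v n x - w x))\<^sup>2)) \<longlonglongrightarrow> ennreal ((2 * pi * 0)\<^sup>2)"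
    by (intro tendsto_ennrealI tendsto_intros lim)
  then have "?J \<le> ennreal ((2 * pi * 0)\<^sup>2)"
    by (rule LIMSEQ_le_const) (use le in blast)
  then have "?J = 0" by simp
  then have "AE x in lborel. ennreal ((rot_mean w x)\<^sup>2) = 0"
    by (subst (asm) nn_integral_0_iff_AE) auto
  then show ?thesis
    unfolding rot_mean_zero_def by eventually_elim simp
qed

text \<open>Near-minimisers of the Dirichlet norm in the decreasing convex sets \<open>K n\<close> have gradients that form
  a Cauchy sequence by the parallelogram law; this replaces weak compactness.\<close>

lemma H1_pair_bounded_limit:
  fixes w :: "'a::euclidean_space \<Rightarrow> real"
  assumes p: "\<And>n::nat. H1_pair \<Omega> (v n) (g n)" and B: "\<And>n. l2 (g n) \<le> 1" and w: "L2 w"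
    and lim: "(\<lambda>n. l2 (\<lambda>x. v n x - w x)) \<longlonglongrightarrow> 0" and \<Omega>: "open \<Omega>" "bounded \<Omega>"
  obtains h where "H1_pair \<Omega> w h" "l2 h \<le> 1"
proof -
  define e where "e n = inverse (real (Suc n))" for n
  have e: "e n > 0" for n by (simp add: e_def)
  have e_mono: "e n \<le> e m" if "m \<le> n" for m n
    using that unfolding e_def by (intro le_imp_inverse_le) auto
  have e_lim: "e \<longlonglongrightarrow> 0"
    unfolding e_def[abs_def] by (rule LIMSEQ_inverse_real_of_nat)
  \<comment> \<open>Both norm conditions are convex. Each set is nonempty: a test function close to
    some \<open>v m\<close> that is itself close to w belongs to it.\<close>
  define K where "K n = {\<phi>. test_function \<Omega> \<phi> \<and> l2 (\<lambda>x. \<phi> x - w x) \<le> e n \<and> l2 (grad \<phi>) \<le> 1 + e n}" for n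
  have K_mono: "K n \<subseteq> K m" if "m \<le> n" for m n
    using e_mono[OF that] unfolding K_def by force
  have K_ne: "K n \<noteq> {}" for n
  proof -
    have "\<forall>\<^sub>F m in sequentially. l2 (\<lambda>x. v m x - w x) < e n / 2"
      using lim e[of n] by (intro order_tendstoD(2)) auto
    then obtain m where m: "l2 (\<lambda>x. v m x - w x) < e n / 2"
      by (auto dest: eventually_happens)
    obtain \<phi> where q: "L2 (v m)" "L2 (g m)" "\<And>i::nat. test_function \<Omega> (\<phi> i)"
      "(\<lambda>i. l2 (\<lambda>x. \<phi> i x - v m x)) \<longlonglongrightarrow> 0" "(\<lambda>i. l2 (\<lambda>x. grad (\<phi> i) x - g m x)) \<longlonglongrightarrow> 0"
      using p[of m] unfolding H1_pair_def by blast
    have "\<forall>\<^sub>F i in sequentially. l2 (\<lambda>x. \<phi> i x - v m x) < e n / 2"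
      "\<forall>\<^sub>F i in sequentially. l2 (\<lambda>x. grad (\<phi> i) x - g m x) < e n"
      using order_tendstoD(2)[OF q(4), of "e n / 2"] order_tendstoD(2)[OF q(5), of "e n"] e[of n] by simp_all
    then have "\<forall>\<^sub>F i in sequentially. l2 (\<lambda>x. \<phi> i x - v m x) < e n / 2 \<and> l2 (\<lambda>x. grad (\<phi> i) x - g m x) < e n"
      by (rule eventually_conj)
    then obtain i where i: "l2 (\<lambda>x. \<phi> i x - v m x) < e n / 2" "l2 (\<lambda>x. grad (\<phi> i) x - g m x) < e n"
      by (auto dest: eventually_happens)
    note L = test_function_L2[OF q(3)]
    have "l2 (\<lambda>x. \<phi> i x - w x) \<le> e n"
      using l2_diff_triangle[OF L(1) q(1) w, of i] m i(1) by linarith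
    moreover have "l2 (grad (\<phi> i)) \<le> 1 + e n"
      using l2_le_l2_diff[OF L(2) q(2), of i] i(2) B[of m] by linarith
    ultimately show ?thesis using q(3) unfolding K_def by blast
  qed
  define d where "d n = (INF \<phi>\<in>K n. l2 (grad \<phi>))" for n
  have bdd: "bdd_below ((\<lambda>\<phi>. l2 (grad \<phi>)) ` K n)" for n
    by (intro bdd_belowI[of _ 0]) auto
  have d_le: "d n \<le> l2 (grad \<phi>)" if "\<phi> \<in> K n" for \<phi> n
    unfolding d_def by (rule cINF_lower[OF bdd that])
  have d_mono: "d m \<le> d n" if "m \<le> n" for m n
    unfolding d_def by (intro cINF_superset_mono K_ne bdd K_mono that) auto
  have d0: "0 \<le> d n" for n
    unfolding d_def by (intro cINF_greatest K_ne) auto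
  have d2: "d n \<le> 2" for n
  proof -
    obtain \<phi> where "\<phi> \<in> K n" using K_ne by auto
    moreover have "e n \<le> 1" by (simp add: e_def inverse_le_1_iff)
    ultimately show ?thesis using d_le[of \<phi> n] by (auto simp: K_def)
  qed
  have inc: "incseq d" using d_mono by (auto simp: incseq_def)
  \<comment> \<open>The infima increase because the sets shrink, and 2 bounds them because
    \<open>e n \<le> 1\<close>. From index N on, the chosen gradients have norms below
    \<open>D + e N\<close>.\<close>
  obtain D where D: "d \<longlonglongrightarrow> D" and "\<forall>i. d i \<le> D"
    by (rule incseq_convergent[OF inc allI[OF d2]])
  then have dD: "d n \<le> D" for n by blast
  have "\<exists>\<phi>. \<phi> \<in> K n \<and> l2 (grad \<phi>) < d n + e n" for n
  proof -
    have "(INF \<phi>\<in>K n. l2 (grad \<phi>)) < d n + e n" using e[of n] by (simp add: d_def)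
    then show ?thesis by (subst (asm) cINF_less_iff[OF K_ne bdd]) auto
  qed
  then obtain \<phi> where \<phi>: "\<And>n. \<phi> n \<in> K n" "\<And>n. l2 (grad (\<phi> n)) < d n + e n" by metis
  have test: "test_function \<Omega> (\<phi> n)" for n using \<phi>(1) by (auto simp: K_def)
  note L = test_function_L2[OF test]
  \<comment> \<open>The midpoint of two members of \<open>K N\<close> lies in \<open>K N\<close>, so
    the norm of its gradient is at least \<open>d N\<close>; the parallelogram law leaves for the
    difference only what separates \<open>d N\<close> from \<open>D + e N\<close>.\<close>
  have par: "(l2 (\<lambda>x. grad (\<phi> m) x - grad (\<phi> n) x))\<^sup>2 \<le> 4 * (D + e N)\<^sup>2 - 4 * (d N)\<^sup>2"
    if mn: "N \<le> m" "N \<le> n" for m n N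
  proof -
    let ?\<psi> = "\<lambda>x. 1/2 * (\<phi> m x + \<phi> n x)"
    have mem: "\<phi> m \<in> K N" "\<phi> n \<in> K N" using \<phi>(1) K_mono mn by blast+
    have ts: "test_function \<Omega> (\<lambda>x. \<phi> m x + \<phi> n x)" by (intro test_function_add test)
    have gr: "grad ?\<psi> = (\<lambda>x. (1/2) *\<^sub>R (grad (\<phi> m) x + grad (\<phi> n) x))"
      using grad_scale[OF ts, of "1/2"] grad_add[OF test test] by auto
    have "?\<psi> \<in> K N"
    proof -
      have "l2 (\<lambda>x. ?\<psi> x - w x) = l2 (\<lambda>x. (1/2) *\<^sub>R ((\<phi> m x - w x) + (\<phi> n x - w x)))"
        by (intro arg_cong[where f=l2] ext) (simp add: field_simps)
      also have "\<dots> = 1/2 * l2 (\<lambda>x. (\<phi> m x - w x) + (\<phi> n x - w x))"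
        by (subst l2_scaleR) simp
      also have "\<dots> \<le> 1/2 * (l2 (\<lambda>x. \<phi> m x - w x) + l2 (\<lambda>x. \<phi> n x - w x))"
        by (intro mult_left_mono l2_triangle L2_diff L w) auto
      also have "\<dots> \<le> e N" using mem by (auto simp: K_def)
      finally have 1: "l2 (\<lambda>x. ?\<psi> x - w x) \<le> e N" .
      have "l2 (grad ?\<psi>) = 1/2 * l2 (\<lambda>x. grad (\<phi> m) x + grad (\<phi> n) x)"
        unfolding gr by (subst l2_scaleR) simp
      also have "\<dots> \<le> 1/2 * (l2 (grad (\<phi> m)) + l2 (grad (\<phi> n)))"
        by (intro mult_left_mono l2_triangle L) auto
      also have "\<dots> \<le> 1 + e N" using mem by (auto simp: K_def)
      finally have 2: "l2 (grad ?\<psi>) \<le> 1 + e N" .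
      show ?thesis using 1 2 test_function_scale[OF ts, of "1/2"] by (simp add: K_def)
    qed
    then have "d N \<le> l2 (grad ?\<psi>)" by (rule d_le)
    also have "\<dots> = 1/2 * l2 (\<lambda>x. grad (\<phi> m) x + grad (\<phi> n) x)"
      unfolding gr by (subst l2_scaleR) simp
    finally have "2 * d N \<le> l2 (\<lambda>x. grad (\<phi> m) x + grad (\<phi> n) x)" by simp
    then have sq: "4 * (d N)\<^sup>2 \<le> (l2 (\<lambda>x. grad (\<phi> m) x + grad (\<phi> n) x))\<^sup>2"
      using power_mono[of "2 * d N" _ 2] d0[of N] by (simp add: power_mult_distrib)
    have up: "(l2 (grad (\<phi> i)))\<^sup>2 \<le> (D + e N)\<^sup>2" if "N \<le> i" for i
      using \<phi>(2)[of i] dD[of i] e_mono[OF that] by (intro power_mono) auto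
    show ?thesis
      using l2_parallelogram[OF L(2) L(2), of m n] sq up[OF mn(1)] up[OF mn(2)] by linarith
  qed
  have Cauchy: "\<exists>N. \<forall>m\<ge>N. \<forall>n\<ge>N. l2 (\<lambda>x. grad (\<phi> m) x - grad (\<phi> n) x) < \<epsilon>" if \<epsilon>: "\<epsilon> > 0" for \<epsilon>
  proof -
    have "(\<lambda>N. 4 * (D + e N)\<^sup>2 - 4 * (d N)\<^sup>2) \<longlonglongrightarrow> 4 * (D + 0)\<^sup>2 - 4 * D\<^sup>2"
      by (intro tendsto_intros e_lim D)
    then have "\<forall>\<^sub>F N in sequentially. 4 * (D + e N)\<^sup>2 - 4 * (d N)\<^sup>2 < \<epsilon>\<^sup>2"
      using \<epsilon> by (intro order_tendstoD(2)) auto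
    then obtain N where N: "4 * (D + e N)\<^sup>2 - 4 * (d N)\<^sup>2 < \<epsilon>\<^sup>2"
      by (auto dest: eventually_happens)
    have "l2 (\<lambda>x. grad (\<phi> m) x - grad (\<phi> n) x) < \<epsilon>" if "m \<ge> N" "n \<ge> N" for m n
      using le_less_trans[OF par[OF that] N] by (rule power_less_imp_less_base) (use \<epsilon> in simp)
    then show ?thesis by blast
  qed
  obtain h where h: "L2 h" "(\<lambda>n. l2 (\<lambda>x. grad (\<phi> n) x - h x)) \<longlonglongrightarrow> 0"
  proof (rule L2_complete[of "\<lambda>n. grad (\<phi> n)" \<Omega>])
    show "\<Omega> \<in> sets borel" "emeasure lborel \<Omega> < \<infinity>"
      using \<Omega> emeasure_bounded_finite by auto
  qed (use L test_function_outside[OF test] Cauchy in auto)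
  have "(\<lambda>n. l2 (\<lambda>x. \<phi> n x - w x)) \<longlonglongrightarrow> 0"
    by (rule Lim_null_comparison[OF _ e_lim]) (use \<phi>(1) in \<open>auto simp: K_def\<close>)
  then have "H1_pair \<Omega> w h"
    unfolding H1_pair_def using w h test by blast
  moreover have "l2 h \<le> 1"
  proof -
    have "(\<lambda>n. 1 + e n) \<longlonglongrightarrow> 1 + 0" by (intro tendsto_intros e_lim)
    moreover have "l2 (grad (\<phi> n)) \<le> 1 + e n" for n using \<phi>(1)[of n] by (auto simp: K_def)
    ultimately show ?thesis
      using LIMSEQ_le[OF l2_tendsto[OF L(2) h], of "\<lambda>n. 1 + e n"] by simp
  qed
  ultimately show ?thesis by (rule that)
qed

section \<open>Admissible functions\<close>

text \<open>Leads from the given function class to pairs, on which all estimates are stated. The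
  cut-off outside the disc leaves the energy unchanged.\<close>

lemma admissible_imp_pair:
  assumes u: "u \<in> admissible"
  obtains g where "zero_mean_pair (\<lambda>x. indicator disc x * u x) g"
    "\<not> (AE x in lborel. indicator disc x * u x = 0)" "dirichlet_energy disc u = (l2 g)\<^sup>2"
proof -
  let ?v = "\<lambda>x. indicator disc x * u x"
  have "u \<in> H01 disc" using u by (simp add: admissible_def)
  then obtain g where g: "H1_pair disc ?v g"
    by (rule H01_imp_H1_pair) auto
  have vm: "?v \<in> borel_measurable borel" using g by (auto simp: H1_pair_def L2_def)
  have "zero_circular_means u" using u by (simp add: admissible_def)
  then have "rot_mean_zero ?v" by (subst (asm) zero_circular_means_iff[OF vm])
  with g have "zero_mean_pair ?v g" by (simp add: zero_mean_pair_def)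
  moreover have "\<not> (AE x in lborel. ?v x = 0)"
  proof
    assume "AE x in lborel. ?v x = 0"
    then have "AE x in lborel. x \<in> disc \<longrightarrow> u x = 0" by eventually_elim (auto simp: indicator_def)
    with u show False by (simp add: admissible_def)
  qed
  moreover have "dirichlet_energy disc u = (l2 g)\<^sup>2"
    by (rule H1_pair_energy[OF g]) auto
  ultimately show ?thesis by (rule that)
qed

lemma pair_imp_admissible:
  assumes p: "zero_mean_pair v g" and nz: "\<not> (AE x in lborel. v x = 0)"
  shows "v \<in> admissible" "dirichlet_energy disc v = (l2 g)\<^sup>2"
    "log_weighted_integral q a v = weighted_power q a v"
proof -
  have H: "H1_pair disc v g" and out: "\<And>x. x \<notin> disc \<Longrightarrow> v x = 0" and z: "rot_mean_zero v"
    using p by (auto simp: zero_mean_pair_def)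
  have eq: "(\<lambda>x. indicator disc x * v x) = v"
    using out by (auto simp: indicator_def fun_eq_iff)
  have vm: "v \<in> borel_measurable borel" using H by (auto simp: H1_pair_def L2_def)
  have "zero_circular_means v"
    using zero_circular_means_iff[of v] z vm unfolding eq by simp
  moreover have "\<not> (AE x in lborel. x \<in> disc \<longrightarrow> v x = 0)"
  proof
    assume "AE x in lborel. x \<in> disc \<longrightarrow> v x = 0"
    then have "AE x in lborel. v x = 0" by eventually_elim (use out in auto)
    with nz show False by simp
  qed
  ultimately show "v \<in> admissible"
    using H1_pair_imp_H01[OF H out] by (simp add: admissible_def)
  show "dirichlet_energy disc v = (l2 g)\<^sup>2"
    by (rule H1_pair_energy[OF H]) auto
  show "log_weighted_integral q a v = weighted_power q a v"
    unfolding log_weighted_integral_eq eq ..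
qed

text \<open>A bump minus its mirror image in the horizontal axis is odd in the angle.\<close>

lemma admissible_nonempty: "admissible \<noteq> {}"
proof -
  \<comment> \<open>The boxes are mirror images in the horizontal axis and touch it from either
    side. On both, |x1| + |x2| is at most 3/4, which keeps them inside the disc.\<close>
  define a b c d :: "real^2" where "a = vector [- 1/4, 0]" and "b = vector [1/4, 1/2]"
    and "c = vector [- 1/4, - 1/2]" and "d = vector [1/4, 0]"
  note defs = a_def b_def c_def d_def
  define \<phi> where "\<phi> x = box_bump 1 a b x + (- 1) * box_bump 1 c d x" for x
  have small: "x \<in> disc" if "\<bar>x$1\<bar> \<le> 1/4" "\<bar>x$2\<bar> \<le> 1/2" for x :: "real^2"
  proof -
    have "norm x \<le> \<bar>x$1\<bar> + \<bar>x$2\<bar>" using norm_le_l1_cart[of x] by (simp add: sum_2)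
    with that show ?thesis by simp
  qed
  have sub: "cbox a b \<subseteq> disc" "cbox c d \<subseteq> disc"
    by (auto simp: defs mem_box_cart forall_2 simp del: mem_ball_0 intro!: small)
  have test: "test_function disc \<phi>"
    unfolding \<phi>_def[abs_def]
    by (intro test_function_add test_function_scale test_function_box_bump sub) auto
  have mirror: "\<phi> (vector [x, - y]) = - \<phi> (vector [x, y])" for x y
    by (simp add: \<phi>_def box_bump_def Basis_real2 axis_eq_axis inner_axis inner_simps defs mult_ac add_ac)
  have H: "H1_pair disc \<phi> (grad \<phi>)"
    unfolding H1_pair_def using test_function_L2[OF test] test
    by (intro conjI exI[of _ "\<lambda>n. \<phi>"]) auto
  have out: "\<phi> x = 0" if "x \<notin> disc" for x
    using test_function_outside(1)[OF test that] .
  have "\<phi> \<in> H01 disc" by (rule H1_pair_imp_H01[OF H out])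
  moreover have "zero_circular_means \<phi>"
  proof -
    have "(LINT t:{0..2*pi}|lborel. \<phi> (vector [r * cos t, r * sin t])) = 0" for r
    proof -
      let ?f = "\<lambda>t. indicator {0..2*pi} t *\<^sub>R \<phi> (vector [r * cos t, r * sin t])"
      \<comment> \<open>The substitution of 2 pi - t for t maps the interval to itself and changes
        only the sign of the sine.\<close>
      have odd: "?f (2 * pi + (- 1) * t) = - ?f t" for t
      proof -
        have "indicator {0..2*pi} (2 * pi - t) = (indicator {0..2*pi} t :: real)"
          by (auto simp: indicator_def)
        moreover have "cos (2 * pi - t) = cos t" "sin (2 * pi - t) = - sin t"
          by (simp_all add: cos_diff sin_diff)
        ultimately show ?thesis by (simp add: mirror)
      qed
      have "(LINT t|lborel. ?f t) = \<bar>- 1\<bar> *\<^sub>R (LINT t|lborel. ?f (2 * pi + (- 1) * t))"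
        by (rule lborel_integral_real_affine) simp
      also have "\<dots> = - (LINT t|lborel. ?f t)"
        unfolding odd by simp
      finally show ?thesis by (simp add: set_lebesgue_integral_def)
    qed
    then show ?thesis unfolding zero_circular_means_def by simp
  qed
  moreover have "\<not> (AE x in lborel. x \<in> disc \<longrightarrow> \<phi> x = 0)"
  proof
    assume zero: "AE x in lborel. x \<in> disc \<longrightarrow> \<phi> x = 0"
    have ne: "\<phi> x \<noteq> 0" "x \<in> disc" if x: "x \<in> box a b" for x
    proof -
      have "x \<notin> box c d" using x by (auto simp: defs mem_box_cart forall_2)
      then have "box_bump 1 c d x = 0" by (simp add: box_bump_eq_0_iff)
      moreover have "box_bump 1 a b x \<noteq> 0" using x by (simp add: box_bump_eq_0_iff)
      ultimately show "\<phi> x \<noteq> 0" by (simp add: \<phi>_def)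
      show "x \<in> disc" using x sub(1) box_subset_cbox by blast
    qed
    from zero have "AE x in lborel. x \<notin> box a b" by eventually_elim (use ne in auto)
    then have "emeasure lborel (box a b) = 0"
      by (subst (asm) AE_iff_measurable[OF _ refl]) auto
    then show False
      by (subst (asm) emeasure_lborel_box)
        (auto simp: Basis_real2 axis_eq_axis inner_axis inner_simps defs)
  qed
  ultimately have "\<phi> \<in> admissible" by (simp add: admissible_def)
  then show ?thesis by auto
qed

theorem corollary3:
  fixes q a :: real
  assumes "q > 2" and "a > 1"
  shows "D q a > 0 \<and> (\<exists>u. is_minimizer q a u)"
proof -
  note aq = assms(2) assms(1)
  \<comment> \<open>The values of the functional on the unit ball of the Dirichlet norm. By
    homogeneity the infimum of the quotient is the supremum S of these values to the power
    -2/q.\<close>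
  define A where "A = {weighted_power q a v | v g. zero_mean_pair v g \<and> l2 g \<le> 1}"
  define S where "S = Sup A"
  obtain S0 where S0: "\<And>v g. zero_mean_pair v g \<Longrightarrow> l2 g \<le> 1 \<Longrightarrow> weighted_power q a v \<le> S0"
    using weighted_power_bounded[OF aq] by blast
  have bdd: "bdd_above A" unfolding A_def by (intro bdd_aboveI[of _ S0]) (auto intro: S0)
  have le_S: "weighted_power q a v \<le> S" if "zero_mean_pair v g" "l2 g \<le> 1" for v g
    unfolding S_def using that by (intro cSup_upper bdd) (auto simp: A_def)
  \<comment> \<open>A nonzero v with a gradient of norm 0 could be scaled freely inside the unit
    ball, which would make the functional unbounded.\<close>
  have pos_norm: "l2 g > 0" if p: "zero_mean_pair v g" and nz: "\<not> (AE x in lborel. v x = 0)" for v g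
  proof (rule ccontr)
    assume "\<not> l2 g > 0"
    then have g0: "l2 g = 0" using l2_nonneg[of g] by linarith
    define W where "W = weighted_power q a v"
    have W: "W > 0" unfolding W_def by (rule weighted_power_pos[OF p aq nz])
    have *: "t powr q * W \<le> S" if "t > 0" for t
      using le_S[OF zero_mean_pair_scaleR[OF p, of t]] that g0
      by (simp add: l2_scaleR weighted_power_scaleR W_def)
    have S: "S > 0" using *[of 1] W by simp
    \<comment> \<open>This is the scaling t for which t^q W = 2 S, a value above the
      supremum.\<close>
    have "(2 * S / W) powr (1/q) > 0" using S W by simp
    from *[OF this] have "2 * S \<le> S" using S W assms by (simp add: powr_powr)
    with S show False by simp
  qed
  have scaled: "weighted_power q a v \<le> S * l2 g powr q"
    if p: "zero_mean_pair v g" and nz: "\<not> (AE x in lborel. v x = 0)" for v g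
  proof -
    have G: "l2 g > 0" by (rule pos_norm[OF p nz])
    have "(1 / l2 g) powr q * weighted_power q a v \<le> S"
    proof -
      have "weighted_power q a (\<lambda>x. (1 / l2 g) * v x) \<le> S"
        by (rule le_S[OF zero_mean_pair_scaleR[OF p]], subst l2_scaleR) (use G in simp)
      then show ?thesis unfolding weighted_power_scaleR using G by simp
    qed
    then show ?thesis using G by (simp add: powr_divide field_simps)
  qed
  have S: "S > 0"
  proof -
    obtain u where "u \<in> admissible" using admissible_nonempty by auto
    then obtain g where g: "zero_mean_pair (\<lambda>x. indicator disc x * u x) g"
      "\<not> (AE x in lborel. indicator disc x * u x = 0)"
      by (rule admissible_imp_pair)
    have "0 < S * l2 g powr q"
      using weighted_power_pos[OF g(1) aq g(2)] scaled[OF g] by linarith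
    then show ?thesis by (simp add: zero_less_mult_iff)
  qed
  \<comment> \<open>The power 2/q turns the q-homogeneous bound by S into one by the energy. This is
    the lower bound that makes D positive.\<close>
  have quotient_ge: "S powr - (2/q) \<le> quotient q a u" if u: "u \<in> admissible" for u
  proof -
    let ?v = "\<lambda>x. indicator disc x * u x"
    obtain g where g: "zero_mean_pair ?v g" "\<not> (AE x in lborel. ?v x = 0)"
      and E: "dirichlet_energy disc u = (l2 g)\<^sup>2"
      using u by (rule admissible_imp_pair)
    define W where "W = weighted_power q a ?v"
    have W: "W > 0" unfolding W_def by (rule weighted_power_pos[OF g(1) aq g(2)])
    have G: "l2 g > 0" by (rule pos_norm[OF g])
    have "W powr (2/q) \<le> (S * l2 g powr q) powr (2/q)"
      using scaled[OF g] W assms by (intro powr_mono2) (auto simp: W_def)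
    also have "\<dots> = S powr (2/q) * (l2 g)\<^sup>2"
      using S G assms by (simp add: powr_mult powr_powr)
    finally have "S powr - (2/q) * W powr (2/q) \<le> S powr - (2/q) * (S powr (2/q) * (l2 g)\<^sup>2)"
      by (intro mult_left_mono) auto
    also have "\<dots> = (l2 g)\<^sup>2"
      using S by (simp add: powr_minus)
    finally have "S powr - (2/q) \<le> (l2 g)\<^sup>2 / W powr (2/q)"
      using W by (simp add: pos_le_divide_eq)
    then show ?thesis
      unfolding quotient_def E log_weighted_integral_eq W_def .
  qed
  have "\<exists>v g. zero_mean_pair v g \<and> l2 g \<le> 1 \<and> weighted_power q a v > S - inverse (real (Suc n))" for n
  proof -
    \<comment> \<open>Approximating a supremum requires a nonempty set; the zero pair arises as the
      multiple by 0 of an admissible function.\<close>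
    have "A \<noteq> {}"
    proof -
      have "zero_mean_pair (\<lambda>x. 0) (\<lambda>x. 0)"
      proof -
        obtain u where "u \<in> admissible" using admissible_nonempty by auto
        then obtain g where "zero_mean_pair (\<lambda>x. indicator disc x * u x) g"
          by (rule admissible_imp_pair)
        from zero_mean_pair_scaleR[OF this, of 0] show ?thesis by simp
      qed
      moreover have "l2 (\<lambda>x::real^2. 0::real^2) \<le> 1" by simp
      ultimately show ?thesis unfolding A_def by blast
    qed
    moreover have "S - inverse (real (Suc n)) < Sup A" by (simp add: S_def)
    ultimately obtain y where "y \<in> A" "S - inverse (real (Suc n)) < y"
      using less_cSup_iff[of A] bdd by blast
    then show ?thesis unfolding A_def by auto
  qed
  then obtain v g where p: "\<And>n. zero_mean_pair (v n) (g n)" and g: "\<And>n. l2 (g n) \<le> 1"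
    and vS: "\<And>n. weighted_power q a (v n) > S - inverse (real (Suc n))" by metis
  have pH: "\<And>n. H1_pair disc (v n) (g n)" and pz: "\<And>n. rot_mean_zero (v n)"
    and pout: "\<And>n x. x \<notin> disc \<Longrightarrow> v n x = 0"
    using p by (auto simp: zero_mean_pair_def)
  have L: "L2 (v n)" for n using pH by (auto simp: H1_pair_def)
  obtain r w where r: "strict_mono (r :: nat \<Rightarrow> nat)" and w: "L2 w" "\<forall>x. x \<notin> disc \<longrightarrow> w x = 0"
    and lim: "(\<lambda>n. l2 (\<lambda>x. v (r n) x - w x)) \<longlonglongrightarrow> 0"
    by (rule rellich[OF pH pz pout g])
  obtain h where h: "H1_pair disc w h" "l2 h \<le> 1"
    using H1_pair_bounded_limit[OF pH g w(1) lim] by auto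
  have "rot_mean_zero w" by (rule rot_mean_zero_limit[OF L pz w(1) lim])
  with h w have wp: "zero_mean_pair w h" by (auto simp: zero_mean_pair_def)
  have dp: "zero_mean_pair (\<lambda>x. v (r n) x - w x) (\<lambda>x. g (r n) x - h x)" for n
  proof -
    have "rot_mean_zero (\<lambda>x. v (r n) x - w x)"
      using rot_mean_diff_AE[OF L w(1), of "r n"] pz[of "r n"] \<open>rot_mean_zero w\<close>
      unfolding rot_mean_zero_def by eventually_elim simp
    then show ?thesis
      using H1_pair_diff[OF pH h(1)] pout w(2) by (auto simp: zero_mean_pair_def)
  qed
  have dB: "l2 (\<lambda>x. g (r n) x - h x) \<le> 2" for n
  proof -
    have "L2 (g (r n))" "L2 h" using pH h(1) by (auto simp: H1_pair_def)
    from l2_triangle[OF this(1) L2_minus[OF this(2)]] show ?thesis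
      using g[of "r n"] h(2) by (simp add: l2_minus)
  qed
  have W0: "(\<lambda>n. weighted_power q a (\<lambda>x. v (r n) x - w x)) \<longlonglongrightarrow> 0"
    by (rule weighted_power_tendsto_0[OF dp dB lim aq])
  \<comment> \<open>With t fixed, the term with the differences disappears as n tends to infinity;
    only afterwards is t sent to 0.\<close>
  have le_t: "S \<le> (1 - t) powr - q * weighted_power q a w" if t: "0 < t" "t < 1" for t
  proof (rule LIMSEQ_le)
    show "(\<lambda>n. S - inverse (real (Suc (r n)))) \<longlonglongrightarrow> S"
      using tendsto_diff[OF tendsto_const[of S] LIMSEQ_subseq_LIMSEQ[OF LIMSEQ_inverse_real_of_nat r]]
      by (simp add: o_def)
    show "(\<lambda>n. (1 - t) powr - q * weighted_power q a w + t powr - q * weighted_power q a (\<lambda>x. v (r n) x - w x))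
      \<longlonglongrightarrow> (1 - t) powr - q * weighted_power q a w"
      using tendsto_add[OF tendsto_const tendsto_mult_right_zero[OF W0]] by force
    show "\<exists>N. \<forall>n\<ge>N. S - inverse (real (Suc (r n)))
      \<le> (1 - t) powr - q * weighted_power q a w + t powr - q * weighted_power q a (\<lambda>x. v (r n) x - w x)"
      using weighted_power_quasi_triangle[OF p wp dp aq t] vS by (intro exI allI impI) (meson less_imp_le order_trans)
  qed
  have Sw: "S \<le> weighted_power q a w"
  proof (rule LIMSEQ_le_const)
    \<comment> \<open>Here t = 1/(n + 2), which lies strictly between 0 and 1 already for n =
      0.\<close>
    have "(\<lambda>n. (1 - inverse (real (Suc (Suc n)))) powr - q) \<longlonglongrightarrow> (1 - 0) powr - q"
      by (intro tendsto_powr tendsto_diff tendsto_const LIMSEQ_Suc[OF LIMSEQ_inverse_real_of_nat]) auto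
    from tendsto_mult_right[OF this, of "weighted_power q a w"]
    show "(\<lambda>n. (1 - inverse (real (Suc (Suc n)))) powr - q * weighted_power q a w) \<longlonglongrightarrow> weighted_power q a w"
      by simp
    have "S \<le> (1 - inverse (real (Suc (Suc n)))) powr - q * weighted_power q a w" for n
    proof (rule le_t)
      show "inverse (real (Suc (Suc n))) < 1" by (intro inverse_less_1_iff[THEN iffD2] disjI2) simp
    qed simp
    then show "\<exists>N. \<forall>n\<ge>N. S \<le> (1 - inverse (real (Suc (Suc n)))) powr - q * weighted_power q a w"
      by blast
  qed
  \<comment> \<open>The limit cannot be trivial, since the functional at w is at least S >
    0.\<close>
  have wnz: "\<not> (AE x in lborel. w x = 0)"
  proof
    assume "AE x in lborel. w x = 0"
    then have "AE x in lborel. log_weight q a x * \<bar>w x\<bar> powr q = 0" by eventually_elim simp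
    then have "weighted_power q a w = 0"
      unfolding weighted_power_def by (rule integral_eq_zero_AE)
    with Sw S show False by simp
  qed
  have wadm: "w \<in> admissible" by (rule pair_imp_admissible(1)[OF wp wnz])
  \<comment> \<open>The gradient of w has norm at most 1 and the functional is at least S, so the
    quotient at w meets the lower bound valid for all admissible functions.\<close>
  have quotient_le: "quotient q a w \<le> S powr - (2/q)"
  proof -
    have "quotient q a w = (l2 h)\<^sup>2 / (weighted_power q a w) powr (2/q)"
      unfolding quotient_def pair_imp_admissible(2,3)[OF wp wnz] ..
    also have "\<dots> \<le> 1 / S powr (2/q)"
    proof (rule frac_le)
      show "(l2 h)\<^sup>2 \<le> 1" using h(2) by (simp add: power_le_one)
      show "S powr (2/q) \<le> weighted_power q a w powr (2/q)"
        using S Sw assms by (intro powr_mono2) auto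
    qed (use S in auto)
    finally show ?thesis by (simp add: powr_minus_divide)
  qed
  have "D q a \<le> quotient q a w"
    unfolding D_def by (rule cINF_lower[OF _ wadm]) (auto intro!: bdd_belowI2[of _ "S powr - (2/q)"] quotient_ge)
  moreover have "S powr - (2/q) \<le> D q a"
    unfolding D_def by (intro cINF_greatest admissible_nonempty quotient_ge)
  ultimately have "quotient q a w = D q a" "S powr - (2/q) \<le> D q a"
    using quotient_le by auto
  moreover have "S powr - (2/q) > 0" using S by simp
  ultimately have "D q a > 0" by linarith
  moreover have "is_minimizer q a w"
    using wadm \<open>quotient q a w = D q a\<close> by (simp add: is_minimizer_def)
  ultimately show ?thesis by blast
qed

end
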